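(* Let $p$ be a prime. Then the minimal exponential growth rates of the Baumslag-Solitar group $BS(1,p)$ and of the lamplighter group $\mathcal{L}_p$ are both realized on the canonical generating set $\{a,t\}$, that is, $\Omega(BS(1,p))=\omega(BS(1,p),\{a,t\})$ and $\Omega(\mathcal{L}_p)=\omega(\mathcal{L}_p,\{a,t\})$. Moreover: (i) if $p=2k+1$ is odd, then $\Omega(\mathcal{L}_p)=\Omega(BS(1,p))=\omega_k$; (ii) if $p=2$, then $\Omega(\mathcal{L}_2)=\frac{1+\sqrt5}{2}<\Omega(BS(1,2))=\beta$, where $\beta$ is the unique positive root of $z^3-z^2-2$.
   Context: For a finitely generated group $G$ and a finite generating set $S$ of $G$, let $\ell_{G,S}(g)$ be the minimal length of a word in $S\cup S^{-1}$ representing $g\in G$, let $F_{G,S}(n)$ be the number of $g\in G$ with $\ell_{G,S}(g)\le n$, and define the exponential growth rate $\omega(G,S)=\lim_{n\to\infty}F_{G,S}(n)^{1/n}$ (the limit exists). The minimal exponential growth rate is $\Omega(G)=\inf_S\omega(G,S)$, the infimum over all finite generating sets $S$ of $G$. $BS(1,n)=\langle a,t\mid tat^{-1}=a^n\rangle$. $\mathcal{L}_n=(\mathbb{Z}/n\mathbb{Z})\wr\mathbb{Z}$ is the restricted wreath product, with presentation $\langle a,t\mid a^n=1,\ [t^kat^{-k},a]=1\ (k=1,2,\ldots)\rangle$. For $k\ge1$, $\omega_k$ denotes the unique positive root of $T_k(x)=x^{k+1}-x^k-2x^{k-1}-\dots-2x-2=x^{k+1}-x^k-2\sum_{j=0}^{k-1}x^j$.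 *)

theory Defs
  imports Complex_Main "HOL-Algebra.Product_Groups" "HOL-Computational_Algebra.Primes"
begin

section \<open>Growth rates of finitely generated groups\<close>

definition finite_generating_set :: "('a, 'm) monoid_scheme \<Rightarrow> 'a set \<Rightarrow> bool" where
  "finite_generating_set G S \<longleftrightarrow> finite S \<and> S \<subseteq> carrier G \<and> generate G S = carrier G"

definition word_length :: "('a, 'm) monoid_scheme \<Rightarrow> 'a set \<Rightarrow> 'a \<Rightarrow> nat" where
  "word_length G S g =
     (LEAST n. \<exists>ws. length ws = n \<and> set ws \<subseteq> S \<union> m_inv G ` S \<and>
                    foldr (\<otimes>\<^bsub>G\<^esub>) ws \<one>\<^bsub>G\<^esub> = g)"

definition growth_function :: "('a, 'm) monoid_scheme \<Rightarrow> 'a set \<Rightarrow> nat \<Rightarrow> nat" where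
  "growth_function G S n = card {g \<in> carrier G. word_length G S g \<le> n}"

definition growth_rate :: "('a, 'm) monoid_scheme \<Rightarrow> 'a set \<Rightarrow> real" where
  "growth_rate G S = lim (\<lambda>n. root n (real (growth_function G S n)))"

text \<open>The infimum is over a set bounded below by 1, which is nonempty for finitely generated
  \<^term>\<open>G\<close>.\<close>

definition min_growth_rate :: "('a, 'm) monoid_scheme \<Rightarrow> real" where
  "min_growth_rate G = (INF S\<in>{S. finite_generating_set G S}. growth_rate G S)"

section \<open>Group presentations\<close>

text \<open>A letter \<^term>\<open>(x, True)\<close> stands for the generator \<^term>\<open>x\<close>, and \<^term>\<open>(x, False)\<close> for its
  formal inverse. A pair \<^term>\<open>(r, s)\<close> of words in \<^term>\<open>R\<close> is the relation $r = s$.\<close>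

type_synonym 'g word = "('g \<times> bool) list"

inductive pres_eq :: "('g word \<times> 'g word) set \<Rightarrow> 'g word \<Rightarrow> 'g word \<Rightarrow> bool" for R where
  refl: "pres_eq R u u"
| sym: "pres_eq R u v \<Longrightarrow> pres_eq R v u"
| trans: "pres_eq R u v \<Longrightarrow> pres_eq R v w \<Longrightarrow> pres_eq R u w"
| cancel: "pres_eq R (u @ [(x, b), (x, \<not> b)] @ v) (u @ v)"
| rel: "(r, s) \<in> R \<Longrightarrow> pres_eq R (u @ r @ v) (u @ s @ v)"

definition pres_rel :: "('g word \<times> 'g word) set \<Rightarrow> ('g word \<times> 'g word) set" where
  "pres_rel R = {(u, v). pres_eq R u v}"

definition pres_class :: "('g word \<times> 'g word) set \<Rightarrow> 'g word \<Rightarrow> 'g word set" where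
  "pres_class R u = pres_rel R `` {u}"

definition presented_group :: "('g word \<times> 'g word) set \<Rightarrow> 'g word set monoid" where
  "presented_group R =
     \<lparr>carrier = UNIV // pres_rel R,
      monoid.mult = (\<lambda>X Y. \<Union>u\<in>X. \<Union>v\<in>Y. pres_class R (u @ v)),
      one = pres_class R []\<rparr>"

lemma equiv_pres_rel: "equiv UNIV (pres_rel R)"
  unfolding pres_rel_def
  by (rule equivI) (auto intro!: refl_onI symI transI intro: pres_eq.intros)

lemma pres_class_eq_iff: "pres_class R u = pres_class R v \<longleftrightarrow> pres_eq R u v"
  unfolding pres_class_def eq_equiv_class_iff[OF equiv_pres_rel UNIV_I UNIV_I]
  by (simp add: pres_rel_def)

lemma carrier_presented_group: "carrier (presented_group R) = range (pres_class R)"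
  by (auto simp: presented_group_def quotient_def pres_class_def)

lemma pres_eq_append_context: "pres_eq R u v \<Longrightarrow> pres_eq R (x @ u @ y) (x @ v @ y)"
proof (induction rule: pres_eq.induct)
  case (cancel u a b v)
  show ?case using pres_eq.cancel[of R "x @ u" a b "v @ y"] by simp
next
  case (rel r s u v)
  then show ?case using pres_eq.rel[of r s R "x @ u" "v @ y"] by simp
qed (blast intro: pres_eq.intros)+

lemma pres_eq_append: "pres_eq R u u' \<Longrightarrow> pres_eq R v v' \<Longrightarrow> pres_eq R (u @ v) (u' @ v')"
  using pres_eq_append_context[of R u u' "[]" v] pres_eq_append_context[of R v v' u' "[]"]
  by (auto intro: pres_eq.trans)

lemma mult_presented_group:
  "pres_class R u \<otimes>\<^bsub>presented_group R\<^esub> pres_class R v = pres_class R (u @ v)"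
proof -
  have "pres_class R (u' @ v') = pres_class R (u @ v)"
    if "u' \<in> pres_class R u" "v' \<in> pres_class R v" for u' v'
  proof -
    have "pres_eq R u u'" "pres_eq R v v'"
      using that by (auto simp: pres_class_def pres_rel_def)
    then have "pres_eq R (u @ v) (u' @ v')" by (rule pres_eq_append)
    then show ?thesis by (metis pres_class_eq_iff)
  qed
  moreover have "w \<in> pres_class R w" for w
    by (simp add: pres_class_def pres_rel_def pres_eq.refl)
  ultimately have "(\<Union>u'\<in>pres_class R u. \<Union>v'\<in>pres_class R v. pres_class R (u' @ v')) =
      pres_class R (u @ v)"
    by blast
  then show ?thesis
    by (simp add: presented_group_def)
qed

lemma one_presented_group: "\<one>\<^bsub>presented_group R\<^esub> = pres_class R []"
  by (simp add: presented_group_def)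

definition inv_word :: "'g word \<Rightarrow> 'g word" where
  "inv_word u = rev (map (\<lambda>(x, b). (x, \<not> b)) u)"

lemma pres_eq_inv_word: "pres_eq R (inv_word u @ u) []"
proof (induction u)
  case Nil
  show ?case by (simp add: inv_word_def pres_eq.refl)
next
  case (Cons l u)
  obtain x b where l: "l = (x, b)" by force
  have "pres_eq R (inv_word u @ [(x, \<not> b), (x, \<not> \<not> b)] @ u) (inv_word u @ u)"
    by (rule pres_eq.cancel)
  with Cons.IH show ?case
    by (auto simp: l inv_word_def intro: pres_eq.trans)
qed

lemma group_presented_group: "group (presented_group R)"
proof (rule groupI)
  fix X assume "X \<in> carrier (presented_group R)"
  then obtain u where X: "X = pres_class R u" by (auto simp: carrier_presented_group)
  show "\<exists>Y\<in>carrier (presented_group R). Y \<otimes>\<^bsub>presented_group R\<^esub> X = \<one>\<^bsub>presented_group R\<^esub>"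
  proof (rule bexI)
    show "pres_class R (inv_word u) \<otimes>\<^bsub>presented_group R\<^esub> X = \<one>\<^bsub>presented_group R\<^esub>"
      by (simp add: X mult_presented_group one_presented_group pres_class_eq_iff pres_eq_inv_word)
    show "pres_class R (inv_word u) \<in> carrier (presented_group R)"
      by (simp add: carrier_presented_group)
  qed
qed (auto simp: carrier_presented_group mult_presented_group one_presented_group)

lemma inv_presented_group: "inv\<^bsub>presented_group R\<^esub> pres_class R u = pres_class R (inv_word u)"
proof (rule group.inv_equality[OF group_presented_group])
  show "pres_class R (inv_word u) \<otimes>\<^bsub>presented_group R\<^esub> pres_class R u =
        \<one>\<^bsub>presented_group R\<^esub>"
    by (simp add: mult_presented_group one_presented_group pres_class_eq_iff pres_eq_inv_word)
qed (simp_all add: carrier_presented_group)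

section \<open>The groups $BS(1,n)$\<close>

datatype bs_gen = gen_a | gen_t

definition BS1_relations :: "nat \<Rightarrow> (bs_gen word \<times> bs_gen word) set" where
  "BS1_relations n =
     {([(gen_t, True), (gen_a, True), (gen_t, False)], replicate n (gen_a, True))}"

definition BS1 :: "nat \<Rightarrow> bs_gen word set monoid" where
  "BS1 n = presented_group (BS1_relations n)"

definition BS1_gen :: "nat \<Rightarrow> bs_gen \<Rightarrow> bs_gen word set" where
  "BS1_gen n x = pres_class (BS1_relations n) [(x, True)]"

lemma finite_generating_set_BS1: "finite_generating_set (BS1 n) {BS1_gen n gen_a, BS1_gen n gen_t}"
proof -
  define R where "R = BS1_relations n"
  let ?S = "{pres_class R [(gen_a, True)], pres_class R [(gen_t, True)]}"
  interpret group "presented_group R" by (rule group_presented_group)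
  have S: "?S \<subseteq> carrier (presented_group R)" by (auto simp: carrier_presented_group)
  have "pres_class R u \<in> generate (presented_group R) ?S" for u
  proof (induction u)
    case Nil
    show ?case by (metis generate.one one_presented_group)
  next
    case (Cons l u)
    obtain x b where l: "l = (x, b)" by force
    have x: "pres_class R [(x, True)] \<in> generate (presented_group R) ?S"
      by (cases x) (auto intro: generate.incl)
    have "pres_class R [(x, False)] \<in> generate (presented_group R) ?S"
      using generate_m_inv_closed[OF S x] by (simp add: inv_presented_group inv_word_def)
    with x have "pres_class R [l] \<in> generate (presented_group R) ?S"
      by (cases b) (auto simp: l)
    from generate.eng[OF this Cons.IH] show ?case by (simp add: mult_presented_group)
  qed
  then have "generate (presented_group R) ?S = carrier (presented_group R)"
    using generate_incl[OF S] by (auto simp: carrier_presented_group)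
  with S show ?thesis
    by (simp add: finite_generating_set_def BS1_def BS1_gen_def R_def)
qed

section \<open>Restricted wreath products and lamplighter groups\<close>

text \<open>\<^term>\<open>H\<close> acts on the direct sum of copies of \<^term>\<open>A\<close> indexed by \<^term>\<open>H\<close> by left translation.\<close>

definition wreath_product ::
  "('a, 'm) monoid_scheme \<Rightarrow> ('h, 'n) monoid_scheme \<Rightarrow> (('h \<Rightarrow> 'a) \<times> 'h) monoid" where
  "wreath_product A H =
     (let B = sum_group (carrier H) (\<lambda>_. A) in
      \<lparr>carrier = carrier B \<times> carrier H,
       monoid.mult = (\<lambda>(f, h) (g, k).
         (f \<otimes>\<^bsub>B\<^esub> (\<lambda>x\<in>carrier H. g (inv\<^bsub>H\<^esub> h \<otimes>\<^bsub>H\<^esub> x)), h \<otimes>\<^bsub>H\<^esub> k)),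
       one = (\<one>\<^bsub>B\<^esub>, \<one>\<^bsub>H\<^esub>)\<rparr>)"

definition lamplighter :: "nat \<Rightarrow> ((int \<Rightarrow> int) \<times> int) monoid" where
  "lamplighter n = wreath_product (integer_mod_group n) integer_group"

text \<open>Taking residues mod \<^term>\<open>n\<close> matters only for \<open>n = 1\<close>.\<close>

definition lamp_a :: "nat \<Rightarrow> (int \<Rightarrow> int) \<times> int" where
  "lamp_a n = ((\<lambda>i. if i = 0 then 1 mod int n else 0), 0)"

definition lamp_t :: "(int \<Rightarrow> int) \<times> int" where
  "lamp_t = ((\<lambda>_. 0), 1)"

lemma carrier_lamplighter:
  "carrier (lamplighter n) =
     {f. (\<forall>i. f i \<in> carrier (integer_mod_group n)) \<and> finite {i. f i \<noteq> 0}} \<times> UNIV"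
  by (auto simp: lamplighter_def wreath_product_def Let_def carrier_sum_group PiE_iff)

lemma mult_lamplighter:
  "(f, h) \<otimes>\<^bsub>lamplighter n\<^esub> (g, k) = ((\<lambda>i. (f i + g (i - h)) mod int n), h + k)"
  by (auto simp: lamplighter_def wreath_product_def Let_def)

lemma one_lamplighter: "\<one>\<^bsub>lamplighter n\<^esub> = ((\<lambda>_. 0), 0)"
  by (auto simp: lamplighter_def wreath_product_def Let_def)

lemma mod_in_integer_mod_group: "i mod int n \<in> carrier (integer_mod_group n)"
  by (auto simp: carrier_integer_mod_group)

lemma integer_mod_group_mod: "i \<in> carrier (integer_mod_group n) \<Longrightarrow> i mod int n = i"
  by (auto simp: carrier_integer_mod_group split: if_splits)

lemma finite_shift: "finite {i. f i \<noteq> (0::int)} \<Longrightarrow> finite {i::int. f (i - h) \<noteq> 0}"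
  by (rule finite_subset[where B = "(\<lambda>i. i + h) ` {i. f i \<noteq> 0}"])
     (auto intro: image_eqI[where x = "_ - h"])

lemma group_lamplighter: "group (lamplighter n)"
proof (rule groupI)
  fix x y assume "x \<in> carrier (lamplighter n)" "y \<in> carrier (lamplighter n)"
  then obtain f h g k where x: "x = (f, h)" "y = (g, k)"
    and fin: "finite {i. f i \<noteq> 0}" "finite {i. g i \<noteq> 0}"
    by (auto simp: carrier_lamplighter)
  have "finite {i. (f i + g (i - h)) mod int n \<noteq> 0}"
    by (rule finite_subset[where B = "{i. f i \<noteq> 0} \<union> {i. g (i - h) \<noteq> 0}"])
       (auto simp: fin finite_shift)
  then show "x \<otimes>\<^bsub>lamplighter n\<^esub> y \<in> carrier (lamplighter n)"
    by (simp add: x mult_lamplighter carrier_lamplighter mod_in_integer_mod_group)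
next
  fix x y z
  assume "x \<in> carrier (lamplighter n)" "y \<in> carrier (lamplighter n)" "z \<in> carrier (lamplighter n)"
  then show "x \<otimes>\<^bsub>lamplighter n\<^esub> y \<otimes>\<^bsub>lamplighter n\<^esub> z =
             x \<otimes>\<^bsub>lamplighter n\<^esub> (y \<otimes>\<^bsub>lamplighter n\<^esub> z)"
    by (cases x; cases y; cases z)
       (auto simp: mult_lamplighter mod_add_left_eq mod_add_right_eq algebra_simps)
next
  fix x assume "x \<in> carrier (lamplighter n)"
  then obtain f h where x: "x = (f, h)" and fin: "finite {i. f i \<noteq> 0}"
    by (auto simp: carrier_lamplighter)
  have "finite {i. (- f (i + h)) mod int n \<noteq> 0}"
    using finite_shift[OF fin, of "- h"] by (rule rev_finite_subset) auto
  then show "\<exists>y\<in>carrier (lamplighter n). y \<otimes>\<^bsub>lamplighter n\<^esub> x = \<one>\<^bsub>lamplighter n\<^esub>"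
    by (intro bexI[of _ "((\<lambda>i. (- f (i + h)) mod int n), - h)"])
       (auto simp: x mult_lamplighter carrier_lamplighter mod_in_integer_mod_group one_lamplighter
         mod_add_left_eq)
qed (auto simp: carrier_lamplighter mult_lamplighter one_lamplighter integer_mod_group_mod)

lemma finite_generating_set_lamplighter: "finite_generating_set (lamplighter n) {lamp_a n, lamp_t}"
proof -
  interpret group "lamplighter n" by (rule group_lamplighter)
  let ?S = "{lamp_a n, lamp_t}" and ?gen = "generate (lamplighter n) {lamp_a n, lamp_t}"
  have sub: "?S \<subseteq> carrier (lamplighter n)"
    by (auto simp: lamp_a_def lamp_t_def carrier_lamplighter mod_in_integer_mod_group)
  have t: "((\<lambda>_. 0), k) \<in> ?gen" for k
  proof (induction k rule: int_induct[where k = 0])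
    case base
    show ?case using generate.one[of "lamplighter n" ?S] by (simp add: one_lamplighter)
  next
    case (step1 k)
    from generate.eng[OF step1(2) generate.incl[of lamp_t ?S]] show ?case
      by (simp add: lamp_t_def mult_lamplighter)
  next
    case (step2 k)
    have "inv\<^bsub>lamplighter n\<^esub> lamp_t = ((\<lambda>_. 0), - 1)"
      by (rule inv_equality) (auto simp: lamp_t_def mult_lamplighter one_lamplighter carrier_lamplighter)
    with generate.eng[OF step2(2) generate.inv[of lamp_t ?S]] show ?case
      by (simp add: mult_lamplighter)
  qed
  have a: "((\<lambda>i. if i = j then int m mod int n else (0::int)), 0::int) \<in> ?gen" for j m
  proof (induction m)
    case 0
    show ?case using t[of 0] by (simp cong: if_cong)
  next
    case (Suc m)
    have *: "((\<lambda>_. 0), j) \<otimes>\<^bsub>lamplighter n\<^esub> lamp_a n \<otimes>\<^bsub>lamplighter n\<^esub> ((\<lambda>_. 0), - j) \<in> ?gen"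
      by (intro generate.eng t) (auto intro: generate.incl)
    have "((\<lambda>i. if i = j then 1 mod int n else 0), 0) \<in> ?gen"
    proof -
      have "((\<lambda>_. 0), j) \<otimes>\<^bsub>lamplighter n\<^esub> lamp_a n \<otimes>\<^bsub>lamplighter n\<^esub> ((\<lambda>_. 0), - j) =
            ((\<lambda>i. if i = j then 1 mod int n else 0), 0)"
        by (auto simp: lamp_a_def mult_lamplighter fun_eq_iff)
      with * show ?thesis by simp
    qed
    from generate.eng[OF Suc.IH this]
    have "((\<lambda>i. ((if i = j then int m mod int n else 0) + (if i = j then 1 mod int n else 0)) mod int n), 0) \<in> ?gen"
      by (simp add: mult_lamplighter)
    moreover have "(\<lambda>i. ((if i = j then int m mod int n else 0) + (if i = j then 1 mod int n else 0)) mod int n) = (\<lambda>i. if i = j then int (Suc m) mod int n else 0)"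
      by (auto simp: fun_eq_iff mod_add_eq algebra_simps)
    ultimately show ?case by (simp only:)
  qed
  have a': "((\<lambda>i. if i = j then c else 0), 0) \<in> ?gen" if c: "c \<in> carrier (integer_mod_group n)" for j c
  proof (cases "c \<ge> 0")
    case True
    then show ?thesis using a[of j "nat c"] integer_mod_group_mod[OF c] by (simp cong: if_cong)
  next
    case False
    with c have n: "n = 0" by (auto simp: carrier_integer_mod_group split: if_splits)
    have "inv\<^bsub>lamplighter n\<^esub> ((\<lambda>i. if i = j then - c else 0), 0) = ((\<lambda>i. if i = j then c else 0), 0)"
      by (rule inv_equality)
         (auto simp: n mult_lamplighter one_lamplighter carrier_lamplighter fun_eq_iff carrier_integer_mod_group)
    moreover have "((\<lambda>i. if i = j then - c else 0), 0) \<in> ?gen"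
      using a[of j "nat (- c)"] False by (simp add: n cong: if_cong)
    ultimately show ?thesis using generate_m_inv_closed[OF sub] by metis
  qed
  have f: "finite F \<Longrightarrow> \<forall>i. f i \<in> carrier (integer_mod_group n) \<Longrightarrow> {i. f i \<noteq> 0} \<subseteq> F \<Longrightarrow> (f, 0) \<in> ?gen" for F f
  proof (induction F arbitrary: f rule: finite_induct)
    case empty
    then have "f = (\<lambda>_. 0)" by auto
    then show ?case using t[of 0] by simp
  next
    case (insert j F)
    have "(f(j := 0), 0) \<in> ?gen"
      using insert.prems insert.hyps by (intro insert.IH) auto
    moreover have "((\<lambda>i. if i = j then f j else 0), 0) \<in> ?gen"
      using insert.prems by (intro a') auto
    ultimately have "(f(j := 0), 0) \<otimes>\<^bsub>lamplighter n\<^esub> ((\<lambda>i. if i = j then f j else 0), 0) \<in> ?gen"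
      by (rule generate.eng)
    moreover have "(\<lambda>i. ((f(j := 0)) i + (if i = j then f j else 0)) mod int n) = f"
      using insert.prems by (auto simp: fun_eq_iff integer_mod_group_mod)
    ultimately show ?case by (simp add: mult_lamplighter cong: if_cong)
  qed
  have "carrier (lamplighter n) \<subseteq> ?gen"
  proof
    fix x assume x: "x \<in> carrier (lamplighter n)"
    obtain g h where gh: "x = (g, h)" by force
    with x have g: "\<forall>i. g i \<in> carrier (integer_mod_group n)" "finite {i. g i \<noteq> 0}"
      by (auto simp: carrier_lamplighter)
    from generate.eng[OF f[OF g(2,1) subset_refl] t[of h]] g show "x \<in> ?gen"
      by (simp add: gh mult_lamplighter integer_mod_group_mod)
  qed
  with sub generate_incl[OF sub] show ?thesis
    by (auto simp: finite_generating_set_def)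
qed

section \<open>The algebraic numbers\<close>

definition positive_root :: "(real \<Rightarrow> real) \<Rightarrow> real" where
  "positive_root f = (THE x. 0 < x \<and> f x = 0)"

definition T_poly :: "nat \<Rightarrow> real \<Rightarrow> real" where
  "T_poly k x = x ^ (k + 1) - x ^ k - 2 * (\<Sum>j<k. x ^ j)"

definition omega :: "nat \<Rightarrow> real" where
  "omega k = positive_root (T_poly k)"

definition beta :: real where
  "beta = positive_root (\<lambda>z. z ^ 3 - z ^ 2 - 2)"

lemma T_poly_unique_root:
  assumes "k \<ge> 1"
  shows "\<exists>!x. 0 < x \<and> T_poly k x = 0"
proof -
  have ex: "\<exists>x. 0 < x \<and> T_poly k x = 0"
  proof -
    have "(\<Sum>j<k. 0 ^ j) = (1::real)"
      using assms by (subst sum.remove[of _ 0]) (auto intro: sum.neutral)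
    then have "T_poly k 0 < 0" using assms by (simp add: T_poly_def power_0_left)
    moreover have "T_poly k 3 = 3 ^ k + 1"
      by (simp add: T_poly_def geometric_sum field_simps)
    then have "T_poly k 3 > 0"
      by (simp add: add_pos_pos)
    moreover have "continuous_on {0..3} (T_poly k)"
      unfolding T_poly_def[abs_def] by (intro continuous_intros)
    ultimately obtain x where "0 \<le> x" "x \<le> 3" "T_poly k x = 0"
      using IVT'[of "T_poly k" 0 0 3] by auto
    with \<open>T_poly k 0 < 0\<close> have "x \<noteq> 0" by auto
    with \<open>0 \<le> x\<close> \<open>T_poly k x = 0\<close> show ?thesis by (intro exI[of _ x]) simp
  qed
  have less: "T_poly k x * y ^ k < T_poly k y * x ^ k" if "0 < x" "x < y" for x y
  proof -
    have le: "(\<Sum>j<k. y ^ j * x ^ k) \<le> (\<Sum>j<k. x ^ j * y ^ k)"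
    proof (rule sum_mono)
      fix j assume "j \<in> {..<k}"
      then have k: "k = j + (k - j)" by simp
      have "x ^ (k - j) \<le> y ^ (k - j)" using that by (intro power_mono) auto
      then have "(x ^ j * y ^ j) * x ^ (k - j) \<le> (x ^ j * y ^ j) * y ^ (k - j)"
        using that by (intro mult_left_mono) auto
      then show "y ^ j * x ^ k \<le> x ^ j * y ^ k"
        by (subst (1 2) k) (simp add: power_add mult_ac)
    qed
    have "0 < x ^ k * y ^ k * (y - x)" using that by simp
    with le show ?thesis
      by (simp add: T_poly_def sum_distrib_left[symmetric] sum_distrib_right[symmetric] algebra_simps)
  qed
  have "x = y" if "0 < x" "T_poly k x = 0" "0 < y" "T_poly k y = 0" for x y
    using less[of x y] less[of y x] that by (cases x y rule: linorder_cases) auto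
  with ex show ?thesis by blast
qed

lemma beta_unique_root: "\<exists>!z::real. 0 < z \<and> z ^ 3 - z ^ 2 - 2 = 0"
proof -
  have "\<exists>z::real. 1 \<le> z \<and> z \<le> 2 \<and> z ^ 3 - z ^ 2 - 2 = 0"
    by (rule IVT') (auto intro!: continuous_intros)
  then obtain z :: real where z: "1 \<le> z" "z ^ 3 - z ^ 2 - 2 = 0" by blast
  have "x = y" if "0 < x" "x ^ 3 - x ^ 2 - 2 = 0" "0 < y" "y ^ 3 - y ^ 2 - 2 = 0" for x y :: real
  proof -
    have *: "\<not> x < y" if "0 < x" "x ^ 3 - x ^ 2 - 2 = 0" "0 < y" "y ^ 3 - y ^ 2 - 2 = 0" for x y :: real
    proof
      assume "x < y"
      have "x ^ 2 * (x - 1) = 2" "y ^ 2 * (y - 1) = 2"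
        using that by (auto simp: algebra_simps power2_eq_square power3_eq_cube)
      moreover have "x > 1"
        using \<open>x ^ 2 * (x - 1) = 2\<close> that(1) by (smt (verit) mult_nonneg_nonpos zero_le_power2)
      then have "x ^ 2 * (x - 1) < y ^ 2 * (y - 1)"
        using \<open>x < y\<close> by (intro mult_strict_mono power_strict_mono) auto
      ultimately show False by simp
    qed
    from *[of x y] *[of y x] that show ?thesis by auto
  qed
  with z show ?thesis by (intro ex1I[of _ z]) auto
qed

end

theory Submission
  imports Defs "HOL-Library.Function_Algebras"
begin

text \<open>
  Both groups have the form \<open>A \<rtimes> \<int>\<close>, where \<open>A\<close> carries a filtration shifted by the generator \<open>t\<close>
  (by the subgroups \<open>p\<^sup>j \<int>\<close> for \<open>BS(1,p)\<close>, by the position of the lowest lamp for the lamplighter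
  group) with successive quotients of order \<open>p\<close>.

  Lower bound: a generating set contains non-commuting \<open>u\<close>, \<open>v\<close>. After conjugation (in a larger group),
  \<open>u = (0, m)\<close> and \<open>v = (x, n)\<close>, with \<open>m > 0\<close> and \<open>n = 0\<close> or \<open>n \<ge> m\<close>. Suitable words in \<open>u\<close>, \<open>v\<close> and their
  inverses map the ball around 0 into itself; finitely many words with pairwise disjoint images
  generate a free monoid, whose growth rate is at least \<open>1/z\<close> if the sum of \<open>z\<close> to the lengths of the
  words is at least 1. For \<open>n = 0\<close> the words \<open>v\<^sup>i u\<close> with \<open>|i| \<le> k\<close> give exactly \<open>\<omega>\<^sub>k\<close> (for \<open>p = 2\<close>, the words
  \<open>u\<close>, \<open>vu\<close> give the golden ratio and \<open>u\<close>, \<open>vuu\<close>, \<open>v\<^sup>-\<^sup>1uu\<close> give \<open>\<beta>\<close>); the other cases give at least as much, in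
  particular at least \<open>1 + \<surd>2 \<ge> \<omega>\<^sub>k\<close> if \<open>m < n\<close> and \<open>p \<ge> 5\<close>.

  Upper bound: up to polynomially many choices of end data, an element of length at most \<open>n\<close> is given by
  a product of the same words of total length at most \<open>n\<close>, because carrying in base \<open>p\<close> to the digits
  \<open>-k, \<dots>, k\<close> (to a non-adjacent form for \<open>BS(1,2)\<close>) does not increase the sum of the absolute values.
\<close>

section \<open>Subadditive sequences (Fekete's lemma)\<close>

lemma fekete:
  fixes a :: "nat \<Rightarrow> real"
  assumes sub: "\<And>m n. a (m + n) \<le> a m + a n" and nonneg: "\<And>n. 0 \<le> a n"
  shows "convergent (\<lambda>n. a n / n)"
proof -
  define L where "L = (INF n\<in>{1..}. a n / real n)"
  have bdd: "bdd_below ((\<lambda>n. a n / real n) ` {1..})"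
    by (rule bdd_belowI2[where m = 0]) (simp add: nonneg)
  have mult: "a (q * N + r) \<le> real q * a N + a r" for q N r
  proof (induction q)
    case (Suc q)
    have "a (Suc q * N + r) \<le> a N + a (q * N + r)"
      using sub[of N "q * N + r"] by (simp add: add.assoc)
    with Suc show ?case by (simp add: algebra_simps)
  qed simp
  \<comment> \<open>The limit is the infimum: for \<open>N\<close> with \<open>a N / N\<close> close
    to \<open>L\<close>, dividing \<open>n\<close> by \<open>N\<close> with remainder bounds
    \<open>a n / n\<close> by \<open>a N / N\<close> plus a term that vanishes.\<close>
  have "(\<lambda>n. a n / n) \<longlonglongrightarrow> L"
  proof (rule LIMSEQ_I)
    fix e :: real assume "0 < e"
    have "\<exists>N\<in>{1..}. a N / real N < L + e / 2"
      unfolding L_def using \<open>0 < e\<close> by (subst cINF_less_iff[symmetric, OF _ bdd]) auto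
    then obtain N where N: "N \<ge> 1" "a N / real N < L + e / 2" by auto
    \<comment> \<open>By nonnegativity the sum bounds \<open>a r\<close> for every remainder
      \<open>r\<close>; it disappears after division by \<open>n\<close>.\<close>
    define M where "M = (\<Sum>r<N. a r)"
    have M: "a r \<le> M" if "r < N" for r
      unfolding M_def using that by (intro member_le_sum) (auto simp: nonneg)
    obtain n0 where n0: "M / (e / 2) < real n0" using reals_Archimedean2 by blast
    show "\<exists>no. \<forall>n\<ge>no. norm (a n / n - L) < e"
    proof (intro exI[of _ "max 1 n0"] allI impI)
      fix n assume "max 1 n0 \<le> n"
      then have n: "n \<ge> 1" "n \<ge> n0" by auto
      have "M / (e / 2) < real n" using n0 n(2) by linarith
      then have "M / real n < e / 2" using \<open>0 < e\<close> n(1) by (simp add: field_simps)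
      have "a n \<le> real (n div N) * a N + a (n mod N)"
        using mult[of "n div N" N "n mod N"] by simp
      also have "\<dots> \<le> real (n div N) * a N + M"
        using M N(1) by (intro add_left_mono) auto
      also have "real (n div N) * a N \<le> real n / real N * a N"
        by (intro mult_right_mono nonneg of_nat_div_le_of_nat)
      finally have "a n \<le> real n / real N * a N + M" by simp
      then have "a n / real n \<le> a N / real N + M / real n"
        using n(1) N(1) by (simp add: field_simps)
      with N(2) \<open>M / real n < e / 2\<close> have "a n / real n < L + e" by argo
      moreover have "L \<le> a n / real n"
        unfolding L_def using n(1) by (intro cINF_lower bdd) auto
      ultimately show "norm (a n / n - L) < e" by auto
    qed
  qed
  then show ?thesis by (rule convergentI)
qed

section \<open>Balls in the word metric\<close>

definition word_prod :: "('a, 'm) monoid_scheme \<Rightarrow> 'a list \<Rightarrow> 'a" where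
  "word_prod G ws = foldr (\<otimes>\<^bsub>G\<^esub>) ws \<one>\<^bsub>G\<^esub>"

definition symm_words :: "('a, 'm) monoid_scheme \<Rightarrow> 'a set \<Rightarrow> 'a list set" where
  "symm_words G S = lists (S \<union> m_inv G ` S)"

definition word_ball :: "('a, 'm) monoid_scheme \<Rightarrow> 'a set \<Rightarrow> nat \<Rightarrow> 'a set" where
  "word_ball G S n = word_prod G ` {ws \<in> symm_words G S. length ws \<le> n}"

context group
begin

lemma word_prod_Nil [simp]: "word_prod G [] = \<one>"
  by (simp add: word_prod_def)

lemma word_prod_Cons [simp]: "word_prod G (x # ws) = x \<otimes> word_prod G ws"
  by (simp add: word_prod_def)

lemma word_prod_closed [simp]: "set ws \<subseteq> carrier G \<Longrightarrow> word_prod G ws \<in> carrier G"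
  by (induction ws) auto

lemma word_prod_append:
  "set xs \<subseteq> carrier G \<Longrightarrow> set ys \<subseteq> carrier G \<Longrightarrow>
    word_prod G (xs @ ys) = word_prod G xs \<otimes> word_prod G ys"
  by (induction xs) (auto simp: m_assoc)

lemma symm_words_closed:
  "S \<subseteq> carrier G \<Longrightarrow> ws \<in> symm_words G S \<Longrightarrow> set ws \<subseteq> carrier G"
  unfolding symm_words_def by auto

lemma finite_word_ball: "finite S \<Longrightarrow> finite (word_ball G S n)"
  unfolding word_ball_def symm_words_def
  by (rule finite_imageI, rule finite_subset[OF _ finite_lists_length_le[of "S \<union> m_inv G ` S" n]])
     (auto simp: lists_eq_set)

lemma generate_word:
  assumes "S \<subseteq> carrier G" "g \<in> generate G S"
  shows "\<exists>ws\<in>symm_words G S. word_prod G ws = g"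
  using assms(2)
proof (induction rule: generate.induct)
  case one
  show ?case by (intro bexI[of _ "[]"]) (auto simp: symm_words_def)
next
  case (incl h)
  with assms(1) show ?case by (intro bexI[of _ "[h]"]) (auto simp: symm_words_def)
next
  case (inv h)
  with assms(1) show ?case by (intro bexI[of _ "[inv h]"]) (auto simp: symm_words_def)
next
  case (eng h1 h2)
  then obtain ws1 ws2 where ws: "ws1 \<in> symm_words G S" "ws2 \<in> symm_words G S"
    "word_prod G ws1 = h1" "word_prod G ws2 = h2" by blast
  with assms(1) show ?case
    by (intro bexI[of _ "ws1 @ ws2"])
       (auto simp: word_prod_append symm_words_closed, auto simp: symm_words_def)
qed

text \<open>\<open>word_length\<close> is a \<open>LEAST\<close>, meaningful only when some word
  represents \<open>g\<close>; generation provides one, so the minimum is attained.\<close>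

lemma word_length_le_iff:
  assumes "finite_generating_set G S" "g \<in> carrier G"
  shows "word_length G S g \<le> n \<longleftrightarrow> g \<in> word_ball G S n"
proof -
  let ?P = "\<lambda>n. \<exists>ws. length ws = n \<and> set ws \<subseteq> S \<union> m_inv G ` S \<and> foldr (\<otimes>) ws \<one> = g"
  obtain ws where "ws \<in> symm_words G S" "word_prod G ws = g"
    using generate_word[of S g] assms by (auto simp: finite_generating_set_def)
  then have "?P (length ws)" by (auto simp: symm_words_def word_prod_def)
  then have "?P (LEAST n. ?P n)" by (rule LeastI)
  then obtain vs where vs: "length vs = word_length G S g" "set vs \<subseteq> S \<union> m_inv G ` S"
    "foldr (\<otimes>) vs \<one> = g"
    unfolding word_length_def by blast
  show ?thesis
  proof
    assume "word_length G S g \<le> n"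
    with vs show "g \<in> word_ball G S n"
      unfolding word_ball_def symm_words_def word_prod_def by (intro image_eqI[of _ _ vs]) auto
  next
    assume "g \<in> word_ball G S n"
    then obtain us where us: "us \<in> symm_words G S" "length us \<le> n" "g = word_prod G us"
      by (auto simp: word_ball_def)
    have "?P (length us)"
      using us by (intro exI[of _ us]) (auto simp: symm_words_def word_prod_def)
    from le_trans[OF Least_le[of ?P, OF this] us(2)] show "word_length G S g \<le> n"
      unfolding word_length_def .
  qed
qed

lemma growth_function_eq:
  assumes "finite_generating_set G S"
  shows "growth_function G S n = card (word_ball G S n)"
proof -
  have "S \<subseteq> carrier G" using assms by (simp add: finite_generating_set_def)
  then have "word_ball G S n \<subseteq> carrier G"
    by (auto simp: word_ball_def symm_words_closed)
  then have "{g \<in> carrier G. word_length G S g \<le> n} = word_ball G S n"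
    using word_length_le_iff[OF assms] by auto
  then show ?thesis by (simp add: growth_function_def)
qed

text \<open>A word of length at most \<open>m + n\<close> is cut after \<open>m\<close>
  letters.\<close>

lemma growth_function_submult:
  assumes "finite_generating_set G S"
  shows "growth_function G S (m + n) \<le> growth_function G S m * growth_function G S n"
proof -
  have S: "finite S" "S \<subseteq> carrier G" using assms by (auto simp: finite_generating_set_def)
  have "word_ball G S (m + n) \<subseteq> (\<lambda>(g, h). g \<otimes> h) ` (word_ball G S m \<times> word_ball G S n)"
  proof
    fix g assume "g \<in> word_ball G S (m + n)"
    then obtain ws where ws: "ws \<in> symm_words G S" "length ws \<le> m + n" "g = word_prod G ws"
      by (auto simp: word_ball_def)
    have *: "take m ws \<in> symm_words G S" "drop m ws \<in> symm_words G S"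
      using ws(1) by (auto simp: symm_words_def dest: in_set_takeD in_set_dropD)
    have "g = word_prod G (take m ws) \<otimes> word_prod G (drop m ws)"
      using word_prod_append[OF symm_words_closed[OF S(2) *(1)] symm_words_closed[OF S(2) *(2)]] ws(3)
      by simp
    moreover have "word_prod G (take m ws) \<in> word_ball G S m"
      using * by (auto simp: word_ball_def)
    moreover have "word_prod G (drop m ws) \<in> word_ball G S n"
      using * ws(2) by (auto simp: word_ball_def)
    ultimately show "g \<in> (\<lambda>(g, h). g \<otimes> h) ` (word_ball G S m \<times> word_ball G S n)"
      by force
  qed
  then have "card (word_ball G S (m + n)) \<le> card (word_ball G S m \<times> word_ball G S n)"
    by (intro surj_card_le finite_cartesian_product finite_word_ball S)
  then show ?thesis by (simp add: growth_function_eq[OF assms] card_cartesian_product)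
qed

lemma growth_function_pos:
  assumes "finite_generating_set G S"
  shows "0 < growth_function G S n"
proof -
  have "\<one> \<in> word_ball G S n"
    unfolding word_ball_def symm_words_def by (rule image_eqI[of _ _ "[]"]) auto
  then show ?thesis
    using assms finite_word_ball[of S n]
    by (auto simp: growth_function_eq card_gt_0_iff finite_generating_set_def)
qed

text \<open>\<open>growth_rate\<close> is a \<open>lim\<close> and has its intended value only if
  the limit exists; Fekete's lemma, applied to the logarithm of the growth function, gives
  existence.\<close>

lemma growth_rate_tendsto:
  assumes "finite_generating_set G S"
  shows "(\<lambda>n. root n (growth_function G S n)) \<longlonglongrightarrow> growth_rate G S"
proof -
  note pos = growth_function_pos[OF assms]
  have pos': "0 < real (growth_function G S n)" for n using pos by simp
  have "convergent (\<lambda>n. ln (growth_function G S n) / n)"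
  proof (rule fekete)
    show "ln (real (growth_function G S (m + n))) \<le>
          ln (growth_function G S m) + ln (growth_function G S n)" for m n
    proof -
      have "real (growth_function G S (m + n)) \<le>
          real (growth_function G S m) * real (growth_function G S n)"
        unfolding of_nat_mult[symmetric] of_nat_le_iff by (rule growth_function_submult[OF assms])
      then show ?thesis
        using ln_mult_pos[OF pos' pos', of m n] ln_le_cancel_iff[OF pos' mult_pos_pos[OF pos' pos'], of "m + n" m n]
        by simp
    qed
    have "1 \<le> real (growth_function G S n)" for n
      using pos[of n] by linarith
    then show "0 \<le> ln (real (growth_function G S n))" for n by simp
  qed
  then obtain l where "(\<lambda>n. ln (growth_function G S n) / n) \<longlonglongrightarrow> l"
    by (auto simp: convergent_def)
  then have "(\<lambda>n. exp (ln (growth_function G S n) / n)) \<longlonglongrightarrow> exp l"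
    by (rule tendsto_exp)
  moreover have "\<forall>\<^sub>F n in sequentially. exp (ln (growth_function G S n) / n) =
      root n (growth_function G S n)"
    using eventually_gt_at_top[of 0]
    by eventually_elim (use pos' in \<open>simp add: root_powr_inverse powr_def\<close>)
  ultimately have "(\<lambda>n. root n (growth_function G S n)) \<longlonglongrightarrow> exp l"
    by (rule Lim_transform_eventually)
  then show ?thesis
    unfolding growth_rate_def by (simp add: limI)
qed

lemma growth_function_le_power:
  fixes r :: real
  assumes "finite_generating_set G S" "growth_rate G S < r"
  shows "\<exists>n0. \<forall>n\<ge>n0. growth_function G S n \<le> r ^ n"
proof -
  have "\<forall>\<^sub>F n in sequentially. root n (growth_function G S n) < r"
    using growth_rate_tendsto[OF assms(1)] assms(2) by (rule order_tendstoD)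
  then have "\<forall>\<^sub>F n in sequentially. growth_function G S n \<le> r ^ n"
    using eventually_gt_at_top[of 0]
  proof eventually_elim
    case (elim n)
    have "root n (growth_function G S n) ^ n \<le> r ^ n"
      using elim by (intro power_mono) auto
    then show ?case using elim(2) by (simp add: real_root_pow_pos2)
  qed
  then show ?thesis by (simp add: eventually_sequentially)
qed

text \<open>The n-th root of \<open>C * (n + 1) ^ d\<close> tends to 1, so polynomial factors do not
  affect the growth rate.\<close>

lemma growth_rate_le:
  fixes r C :: real
  assumes fg: "finite_generating_set G S" and "0 < r"
    and bound: "\<And>n. growth_function G S n \<le> C * (real n + 1) ^ d * r ^ n"
  shows "growth_rate G S \<le> r"
proof (rule LIMSEQ_le[OF growth_rate_tendsto[OF fg]])
  \<comment> \<open>The bound at \<open>n = 0\<close> forces \<open>C\<close> to be positive,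
    because the ball of radius 0 contains the identity.\<close>
  have C: "0 < C" using bound[of 0] growth_function_pos[OF fg, of 0] by simp
  have "(\<lambda>n. ln (real (Suc n)) / real (Suc n) * (real (Suc n) / real n)) \<longlonglongrightarrow> 0 * 1"
    by (intro tendsto_mult LIMSEQ_Suc_n_over_n filterlim_compose[OF ln_x_over_x_tendsto_0
          filterlim_compose[OF filterlim_real_sequentially filterlim_Suc]])
  moreover have "ln (real (Suc n)) / real (Suc n) * (real (Suc n) / real n) = ln (real n + 1) / real n" for n
    by (subst times_divide_times_eq) (simp add: add.commute)
  ultimately have lim: "(\<lambda>n. ln (real n + 1) / real n) \<longlonglongrightarrow> 0" by (simp only: mult_zero_left)
  have "(\<lambda>n. 1 / real n * ln C + real d * (ln (real n + 1) / real n)) \<longlonglongrightarrow> 0 * ln C + real d * 0"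
    by (rule tendsto_add[OF tendsto_mult[OF lim_1_over_n tendsto_const] tendsto_mult[OF tendsto_const lim]])
  from tendsto_mult[OF tendsto_exp[OF this] tendsto_const[of r]]
  show "(\<lambda>n. exp (1 / real n * ln C + real d * (ln (real n + 1) / n)) * r) \<longlonglongrightarrow> r" by simp
  show "\<exists>N. \<forall>n\<ge>N. root n (growth_function G S n) \<le> exp (1 / n * ln C + d * (ln (real n + 1) / n)) * r"
  proof (intro exI[of _ 1] allI impI)
    fix n :: nat assume n: "1 \<le> n"
    have "exp (1 / n * ln C + d * (ln (real n + 1) / n)) ^ n =
        exp (real n * (1 / n * ln C + d * (ln (real n + 1) / n)))"
      by (rule exp_of_nat_mult[symmetric])
    also have "real n * (1 / n * ln C + d * (ln (real n + 1) / n)) = ln C + real d * ln (real n + 1)"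
      using n by (simp add: field_simps)
    also have "exp \<dots> = C * (real n + 1) ^ d"
      using C by (simp add: exp_add exp_of_nat_mult add_nonneg_pos)
    finally have "exp (1 / n * ln C + d * (ln (real n + 1) / n)) ^ n = C * (real n + 1) ^ d" .
    then have "growth_function G S n \<le> (exp (1 / n * ln C + d * (ln (real n + 1) / n)) * r) ^ n"
      using bound[of n] by (simp add: power_mult_distrib)
    then have "root n (growth_function G S n) \<le>
        root n ((exp (1 / n * ln C + d * (ln (real n + 1) / n)) * r) ^ n)"
      using n by (subst real_root_le_iff) auto
    then show "root n (growth_function G S n) \<le> exp (1 / n * ln C + d * (ln (real n + 1) / n)) * r"
      using n \<open>0 < r\<close> by (simp add: real_root_power_cancel)
  qed
qed

end

lemma min_growth_rate_eqI:
  assumes "finite_generating_set G S0" "growth_rate G S0 \<le> c"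
    and "\<And>S. finite_generating_set G S \<Longrightarrow> c \<le> growth_rate G S"
  shows "min_growth_rate G = c" "growth_rate G S0 = c"
proof -
  show c: "growth_rate G S0 = c" using assms by (simp add: order_antisym)
  have "min_growth_rate G \<le> growth_rate G S0"
    unfolding min_growth_rate_def using assms
    by (intro cINF_lower bdd_belowI2[where m = c]) auto
  moreover have "c \<le> min_growth_rate G"
    unfolding min_growth_rate_def using assms by (intro cINF_greatest) auto
  ultimately show "min_growth_rate G = c" using c by simp
qed

section \<open>Counting words over a weighted alphabet\<close>

text \<open>Expanding the product of \<open>N\<close> copies of the sum produces one monomial per
  list, and weights add along a list.\<close>

lemma sum_weighted_lists:
  fixes z :: "'b::comm_semiring_1"
  assumes "finite D"
  shows "(\<Sum>xs | set xs \<subseteq> D \<and> length xs = N. z ^ sum_list (map wt xs)) = (\<Sum>d\<in>D. z ^ wt d) ^ N"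
proof (induction N)
  case 0
  have "{xs. set xs \<subseteq> D \<and> length xs = 0} = {[]}" by auto
  then show ?case by (simp only:) simp
next
  case (Suc N)
  have "{xs. set xs \<subseteq> D \<and> length xs = Suc N} =
      (\<lambda>(x, xs). x # xs) ` (D \<times> {xs. set xs \<subseteq> D \<and> length xs = N})"
    by (auto simp: length_Suc_conv image_iff)
  moreover have "inj_on (\<lambda>(x, xs). x # xs) (D \<times> {xs. set xs \<subseteq> D \<and> length xs = N})"
    by (auto simp: inj_on_def)
  ultimately have "(\<Sum>xs | set xs \<subseteq> D \<and> length xs = Suc N. z ^ sum_list (map wt xs)) =
      (\<Sum>(x, xs)\<in>D \<times> {xs. set xs \<subseteq> D \<and> length xs = N}. z ^ wt x * z ^ sum_list (map wt xs))"
    by (simp add: sum.reindex case_prod_unfold power_add)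
  then show ?case
    by (simp add: sum.cartesian_product[symmetric] sum_distrib_left[symmetric]
        sum_distrib_right[symmetric] Suc)
qed

lemma length_le_weight:
  fixes wt :: "'e \<Rightarrow> nat"
  assumes "\<And>d. d \<in> D \<Longrightarrow> 1 \<le> wt d" "set xs \<subseteq> D"
  shows "length xs \<le> sum_list (map wt xs)"
  using assms(2) by (induction xs) (auto dest!: assms(1))

lemma finite_weighted_lists:
  fixes wt :: "'e \<Rightarrow> nat"
  assumes "finite D" "\<And>d. d \<in> D \<Longrightarrow> 1 \<le> wt d"
  shows "finite {xs. set xs \<subseteq> D \<and> sum_list (map wt xs) \<le> n}"
  by (rule finite_subset[OF _ finite_lists_length_le[OF assms(1), of n]])
     (use length_le_weight[of D wt] assms(2) in fastforce)

text \<open>Each counted list contributes at least \<open>z ^ n\<close> to the sum of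
  \<open>z\<close> to the weights. Its length is at most \<open>n\<close>, and the lists of any
  fixed length contribute at most 1 in total.\<close>

lemma card_weighted_lists_le:
  fixes z :: real and wt :: "'e \<Rightarrow> nat"
  assumes "finite D" "\<And>d. d \<in> D \<Longrightarrow> 1 \<le> wt d" "0 < z" "z \<le> 1" "(\<Sum>d\<in>D. z ^ wt d) \<le> 1"
  shows "card {xs. set xs \<subseteq> D \<and> sum_list (map wt xs) \<le> n} \<le> (real n + 1) * (1 / z) ^ n"
proof -
  let ?W = "{xs. set xs \<subseteq> D \<and> sum_list (map wt xs) \<le> n}"
  let ?L = "\<lambda>N. {xs. set xs \<subseteq> D \<and> length xs = N}"
  have fin: "finite (?L N)" for N
    using finite_lists_length_eq[OF assms(1)] .
  have W: "?W \<subseteq> (\<Union>N\<in>{..n}. ?L N)"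
    using length_le_weight[of D wt] assms(2) by fastforce
  have "real (card ?W) * z ^ n = (\<Sum>xs\<in>?W. z ^ n)" by simp
  also have "\<dots> \<le> (\<Sum>xs\<in>?W. z ^ sum_list (map wt xs))"
    using assms(3,4) by (intro sum_mono power_decreasing) auto
  also have "\<dots> \<le> (\<Sum>xs\<in>(\<Union>N\<in>{..n}. ?L N). z ^ sum_list (map wt xs))"
    using assms(3) fin by (intro sum_mono2 W) auto
  also have "\<dots> = (\<Sum>N\<le>n. \<Sum>xs\<in>?L N. z ^ sum_list (map wt xs))"
    using fin by (intro sum.UNION_disjoint) auto
  also have "\<dots> = (\<Sum>N\<le>n. (\<Sum>d\<in>D. z ^ wt d) ^ N)"
    by (simp add: sum_weighted_lists[OF assms(1)])
  also have "\<dots> \<le> (\<Sum>N\<le>n. 1)"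
    using assms(3,5) by (intro sum_mono power_le_one sum_nonneg) auto
  finally have "real (card ?W) * z ^ n \<le> real n + 1" by simp
  then show ?thesis using assms(3) by (simp add: power_divide field_simps)
qed

lemma sum_geometric_le:
  fixes q :: real
  assumes "0 < q" "q < 1"
  shows "(\<Sum>m=N..M. q ^ m) \<le> q ^ N / (1 - q)"
proof (cases "N \<le> M")
  case True
  then have "(1 - q) * (\<Sum>m=N..M. q ^ m) = q ^ N - q ^ Suc M"
    by (rule sum_gp_multiplied)
  also have "\<dots> \<le> q ^ N" using assms by simp
  finally show ?thesis using assms by (simp add: pos_le_divide_eq mult.commute)
qed (use assms in simp)

section \<open>Growth bounds from free monoids and from codings\<close>

context group
begin

text \<open>If the rate were below \<open>1 / z\<close>, choose \<open>r\<close> strictly between.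
  The products of \<open>N\<close> code words have total weight at least 1; by injectivity at most
  \<open>r ^ m\<close> of them have length \<open>m\<close>, and \<open>m \<ge> N\<close>. The total
  is then bounded by a tail of the geometric series of \<open>r * z\<close>, which is less than 1
  for large \<open>N\<close>.\<close>

lemma growth_rate_ge_of_code:
  fixes w :: "'i \<Rightarrow> 'a list" and z :: real
  assumes fg: "finite_generating_set G S" and I: "finite I"
    and w: "\<And>i. i \<in> I \<Longrightarrow> w i \<in> symm_words G S" "\<And>i. i \<in> I \<Longrightarrow> w i \<noteq> []"
    and inj: "\<And>xs ys. \<lbrakk>length xs = length ys; set xs \<subseteq> I; set ys \<subseteq> I;
        word_prod G (concat (map w xs)) = word_prod G (concat (map w ys))\<rbrakk> \<Longrightarrow> xs = ys"
    and z: "0 < z" "z < 1" and sum: "1 \<le> (\<Sum>i\<in>I. z ^ length (w i))"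
  shows "1 / z \<le> growth_rate G S"
proof (rule ccontr)
  assume "\<not> 1 / z \<le> growth_rate G S"
  with z have "max 0 (growth_rate G S) < 1 / z" by simp
  then obtain r where r: "max 0 (growth_rate G S) < r" "r < 1 / z" using dense by blast
  then have q: "0 < r * z" "r * z < 1" using z by (auto simp: field_simps)
  obtain n0 where n0: "\<And>n. n \<ge> n0 \<Longrightarrow> growth_function G S n \<le> r ^ n"
    using growth_function_le_power[OF fg, of r] r(1) by auto
  have "(\<lambda>N. (r * z) ^ N / (1 - r * z)) \<longlonglongrightarrow> 0 / (1 - r * z)"
    using q by (intro tendsto_intros LIMSEQ_realpow_zero) auto
  then have "\<forall>\<^sub>F N in sequentially. (r * z) ^ N / (1 - r * z) < 1"
    by (intro order_tendstoD) auto
  then obtain N1 where N1: "\<And>N. N \<ge> N1 \<Longrightarrow> (r * z) ^ N / (1 - r * z) < 1"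
    by (auto simp: eventually_sequentially)
  \<comment> \<open>\<open>n0\<close> makes the growth bound valid at all lengths
    \<open>m \<ge> N\<close>, and \<open>N1\<close> makes the geometric tail smaller than 1.\<close>
  define N where "N = max n0 N1"
  let ?X = "{xs. set xs \<subseteq> I \<and> length xs = N}"
  let ?wt = "\<lambda>xs. sum_list (map (\<lambda>i. length (w i)) xs)"
  define M where "M = Max (insert N (?wt ` ?X))"
  have fX: "finite ?X" using finite_lists_length_eq[OF I] .
  have M: "?wt ` ?X \<subseteq> {N..M}"
  proof
    fix m assume m: "m \<in> ?wt ` ?X"
    have "N \<le> m"
      using m w(2) length_le_weight[of I "\<lambda>i. length (w i)"] by (fastforce simp: Suc_le_eq)
    with m fX show "m \<in> {N..M}" by (auto simp: M_def)
  qed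
  have le: "card {xs \<in> ?X. ?wt xs = m} \<le> growth_function G S m" for m
  proof -
    let ?f = "\<lambda>xs. word_prod G (concat (map w xs))"
    have "?f ` {xs \<in> ?X. ?wt xs = m} \<subseteq> word_ball G S m"
    proof
      fix g assume "g \<in> ?f ` {xs \<in> ?X. ?wt xs = m}"
      then obtain xs where xs: "set xs \<subseteq> I" "?wt xs = m" "g = ?f xs" by auto
      have "length (concat (map w xs)) = m"
        using xs(2) by (simp add: length_concat comp_def)
      moreover have "concat (map w xs) \<in> symm_words G S"
        using xs(1) w(1) by (simp add: symm_words_def lists_eq_set) blast
      ultimately show "g \<in> word_ball G S m"
        unfolding word_ball_def xs(3) by auto
    qed
    moreover have "inj_on ?f {xs \<in> ?X. ?wt xs = m}"
      using inj by (auto simp: inj_on_def)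
    moreover have "finite (word_ball G S m)"
      using fg by (intro finite_word_ball) (simp add: finite_generating_set_def)
    ultimately show ?thesis
      unfolding growth_function_eq[OF fg] by (intro card_inj_on_le)
  qed
  have "1 \<le> (\<Sum>i\<in>I. z ^ length (w i)) ^ N" using sum by simp
  also have "\<dots> = (\<Sum>xs\<in>?X. z ^ ?wt xs)" by (simp add: sum_weighted_lists[OF I])
  also have "\<dots> = (\<Sum>m\<in>{N..M}. \<Sum>xs\<in>{xs \<in> ?X. ?wt xs = m}. z ^ ?wt xs)"
    using sum.group[OF fX finite_atLeastAtMost M, of "\<lambda>xs. z ^ ?wt xs"] by simp
  also have "\<dots> = (\<Sum>m\<in>{N..M}. card {xs \<in> ?X. ?wt xs = m} * z ^ m)"
    by (intro sum.cong) auto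
  also have "\<dots> \<le> (\<Sum>m\<in>{N..M}. (r * z) ^ m)"
  proof (intro sum_mono)
    fix m assume "m \<in> {N..M}"
    then have "real (card {xs \<in> ?X. ?wt xs = m}) \<le> r ^ m"
      using le[of m] n0[of m] by (simp add: N_def)
    then show "card {xs \<in> ?X. ?wt xs = m} * z ^ m \<le> (r * z) ^ m"
      using z by (simp add: power_mult_distrib)
  qed
  also have "\<dots> \<le> (r * z) ^ N / (1 - r * z)"
    using q by (rule sum_geometric_le)
  also have "\<dots> < 1" by (rule N1) (simp add: N_def)
  finally show False by simp
qed

text \<open>An element of the ball is determined by \<open>k\<close> integers from an interval with
  \<open>2 * n + 1\<close> members and a list of weight at most \<open>n\<close>. The former are
  polynomially many, the latter at most \<open>(n + 1) * (1 / z) ^ n\<close>. The relation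
  \<open>Q\<close> takes the place of an explicit decoding map.\<close>

lemma growth_rate_le_of_coding:
  fixes Q :: "int list \<Rightarrow> 'e list \<Rightarrow> 'a \<Rightarrow> bool" and wt :: "'e \<Rightarrow> nat" and z :: real
  assumes fg: "finite_generating_set G S"
    and D: "finite D" "\<And>d. d \<in> D \<Longrightarrow> 1 \<le> wt d"
    and z: "0 < z" "z \<le> 1" "(\<Sum>d\<in>D. z ^ wt d) \<le> 1"
    and ex: "\<And>n g. g \<in> word_ball G S n \<Longrightarrow> \<exists>ps xs. length ps = k \<and> set ps \<subseteq> {- int n..int n} \<and>
        set xs \<subseteq> D \<and> sum_list (map wt xs) \<le> n \<and> Q ps xs g"
    and unique: "\<And>ps xs g h. \<lbrakk>g \<in> carrier G; h \<in> carrier G; Q ps xs g; Q ps xs h\<rbrakk> \<Longrightarrow> g = h"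
  shows "growth_rate G S \<le> 1 / z"
proof (rule growth_rate_le[OF fg])
  show "0 < 1 / z" using z by simp
  fix n
  let ?P = "{ps. set ps \<subseteq> {- int n..int n} \<and> length ps = k}"
  let ?W = "{xs. set xs \<subseteq> D \<and> sum_list (map wt xs) \<le> n}"
  have S: "S \<subseteq> carrier G" using fg by (simp add: finite_generating_set_def)
  have ball: "g \<in> carrier G" if "g \<in> word_ball G S n" for g
    using that symm_words_closed[OF S] by (auto simp: word_ball_def)
  have sub: "word_ball G S n \<subseteq> (\<lambda>(ps, xs). THE g. g \<in> carrier G \<and> Q ps xs g) ` (?P \<times> ?W)"
  proof
    fix g assume g: "g \<in> word_ball G S n"
    from ex[OF this] obtain ps xs where *: "ps \<in> ?P" "xs \<in> ?W" "Q ps xs g" by blast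
    then have "(THE g. g \<in> carrier G \<and> Q ps xs g) = g"
      using ball[OF g] unique by blast
    with *(1,2) show "g \<in> (\<lambda>(ps, xs). THE g. g \<in> carrier G \<and> Q ps xs g) ` (?P \<times> ?W)"
      by (intro image_eqI[of _ _ "(ps, xs)"]) auto
  qed
  have cP: "card ?P = (2 * n + 1) ^ k"
    by (subst card_lists_length_eq) (auto simp: nat_add_distrib nat_mult_distrib)
  have fin: "finite (?P \<times> ?W)"
    by (intro finite_cartesian_product finite_lists_length_eq finite_weighted_lists D) auto
  have "growth_function G S n \<le> card (?P \<times> ?W)"
    unfolding growth_function_eq[OF fg] by (rule surj_card_le[OF fin sub])
  then have "real (growth_function G S n) \<le> real ((2 * n + 1) ^ k * card ?W)"
    unfolding card_cartesian_product cP of_nat_le_iff .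
  then have "real (growth_function G S n) \<le> (2 * real n + 1) ^ k * real (card ?W)"
    by (simp add: add.commute)
  also have "\<dots> \<le> (2 * (real n + 1)) ^ k * ((real n + 1) * (1 / z) ^ n)"
    by (intro mult_mono power_mono card_weighted_lists_le D z) auto
  finally show "real (growth_function G S n) \<le> 2 ^ k * (real n + 1) ^ (k + 1) * (1 / z) ^ n"
    by (simp add: power_mult_distrib[of 2 "real n + 1"] mult_ac del: distrib_left_numeral)
qed

end

section \<open>Filtered modules and cocycles\<close>

text \<open>The ring type supplies integer multiples via \<open>of_int\<close>. By
  \<open>B_digit\<close>, an integer not divisible by \<open>p\<close> acts injectively on
  \<open>B j\<close> modulo \<open>B (j + 1)\<close>; this is where the primality of
  \<open>p\<close> enters both instances.\<close>

locale filtered_module =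
  fixes p :: nat and act :: "int \<Rightarrow> 'b::comm_ring_1 \<Rightarrow> 'b" and B :: "int \<Rightarrow> 'b set"
  assumes act_add: "act h (x + y) = act h x + act h y"
    and act_act: "act h (act k x) = act (h + k) x"
    and act_0 [simp]: "act 0 x = x"
    and act_of_int: "act h (of_int d * x) = of_int d * act h x"
    and B_0 [simp]: "0 \<in> B j"
    and B_diff: "x \<in> B j \<Longrightarrow> y \<in> B j \<Longrightarrow> x - y \<in> B j"
    and B_of_int: "x \<in> B j \<Longrightarrow> of_int d * x \<in> B j"
    and B_step: "B (j + 1) \<subseteq> B j"
    and act_B: "x \<in> B j \<Longrightarrow> act h x \<in> B (j + h)"
    and B_digit: "x \<in> B j \<Longrightarrow> x \<notin> B (j + 1) \<Longrightarrow> \<not> int p dvd d \<Longrightarrow> of_int d * x \<notin> B (j + 1)"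
begin

lemma act_zero [simp]: "act h 0 = 0"
  using act_of_int[of h 0 0] by simp

lemma act_uminus: "act h (- x) = - act h x"
  using act_of_int[of h "- 1" x] by simp

lemma act_diff: "act h (x - y) = act h x - act h y"
  using act_add[of h x "- y"] by (simp add: act_uminus)

lemma B_uminus: "x \<in> B j \<Longrightarrow> - x \<in> B j"
  using B_diff[of 0 j x] by simp

lemma B_add: "x \<in> B j \<Longrightarrow> y \<in> B j \<Longrightarrow> x + y \<in> B j"
  using B_diff[of x j "- y"] B_uminus by simp

lemma B_mono: "i \<le> j \<Longrightarrow> B j \<subseteq> B i"
  by (induction rule: int_ge_induct) (use B_step in auto)

lemma act_B_iff: "act h x \<in> B j \<longleftrightarrow> x \<in> B (j - h)"
  using act_B[of x "j - h" h] act_B[of "act h x" j "- h"] by (auto simp: act_act)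

lemma B_sum_list: "(\<And>x. x \<in> set xs \<Longrightarrow> x \<in> B j) \<Longrightarrow> sum_list xs \<in> B j"
  by (induction xs) (auto intro: B_add)

text \<open>For lamplighter groups the module consists of integer sequences, of which only the residues
  modulo \<open>p\<close> matter; hence equality is replaced by equality modulo the intersection of the filtration.\<close>

definition approx :: "'b \<Rightarrow> 'b \<Rightarrow> bool" (infix "\<simeq>" 50) where
  "x \<simeq> y \<longleftrightarrow> (\<forall>j. x - y \<in> B j)"

lemma approx_refl [simp, intro]: "x \<simeq> x"
  by (simp add: approx_def)

lemma approx_sym: "x \<simeq> y \<Longrightarrow> y \<simeq> x"
  unfolding approx_def using B_uminus by (metis minus_diff_eq)

lemma approx_trans [trans]: "x \<simeq> y \<Longrightarrow> y \<simeq> z \<Longrightarrow> x \<simeq> z"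
  unfolding approx_def using B_add by (metis diff_add_cancel add_diff_eq)

lemma approx_add: "x \<simeq> y \<Longrightarrow> x' \<simeq> y' \<Longrightarrow> x + x' \<simeq> y + y'"
  unfolding approx_def using B_add by (metis add_diff_add)

lemma approx_uminus: "x \<simeq> y \<Longrightarrow> - x \<simeq> - y"
  unfolding approx_def using B_uminus by (metis minus_diff_minus)

lemma approx_diff: "x \<simeq> y \<Longrightarrow> x' \<simeq> y' \<Longrightarrow> x - x' \<simeq> y - y'"
  using approx_add[of x y "- x'" "- y'"] approx_uminus by simp

lemma approx_act: "x \<simeq> y \<Longrightarrow> act h x \<simeq> act h y"
  unfolding approx_def act_diff[symmetric] by (simp add: act_B_iff)

lemma approx_of_int: "x \<simeq> y \<Longrightarrow> of_int d * x \<simeq> of_int d * y"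
  unfolding approx_def right_diff_distrib[symmetric] by (simp add: B_of_int)

lemma approx_B: "x \<simeq> y \<Longrightarrow> y \<in> B j \<Longrightarrow> x \<in> B j"
  unfolding approx_def by (metis B_add diff_add_cancel)

section \<open>Digit expansions along the filtration\<close>

definition digit_sum :: "'b \<Rightarrow> (int \<times> int) list \<Rightarrow> 'b" where
  "digit_sum x ds = (\<Sum>(c, j)\<leftarrow>ds. of_int c * act j x)"

lemma digit_sum_Nil [simp]: "digit_sum x [] = 0"
  by (simp add: digit_sum_def)

lemma digit_sum_Cons [simp]: "digit_sum x ((c, j) # ds) = of_int c * act j x + digit_sum x ds"
  by (simp add: digit_sum_def)

lemma digit_sum_B:
  assumes "x \<in> B 0" "\<And>c j. (c, j) \<in> set ds \<Longrightarrow> i \<le> j"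
  shows "digit_sum x ds \<in> B i"
  unfolding digit_sum_def
proof (intro B_sum_list)
  fix y assume "y \<in> set (map (\<lambda>(c, j). of_int c * act j x) ds)"
  then obtain c j where "(c, j) \<in> set ds" "y = of_int c * act j x" by auto
  with assms(2) act_B[OF assms(1), of j] B_mono[of i j] show "y \<in> B i"
    by (auto intro: B_of_int)
qed

text \<open>A list entry \<open>(c, j)\<close> is the digit \<open>c\<close> at position \<open>j\<close>; both lists are assumed to be sorted by
  position.\<close>

fun digits_differ :: "(int \<Rightarrow> bool) \<Rightarrow> int \<Rightarrow> (int \<times> int) list \<Rightarrow> (int \<times> int) list \<Rightarrow> bool" where
  "digits_differ P K [] [] = False"
| "digits_differ P K ((c, j) # ds) [] = (j < K \<and> P c)"
| "digits_differ P K [] ((c, j) # es) = (j < K \<and> P c)"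
| "digits_differ P K ((c, i) # ds) ((d, j) # es) =
    (if i < j then i < K \<and> P c
     else if j < i then j < K \<and> P d
     else if c = d then digits_differ P K ds es
     else i < K \<and> P (c - d))"

text \<open>The sums cancel up to the first position \<open>j\<close> where the lists disagree.
  There a non-multiple of \<open>p\<close> times \<open>act j x\<close> remains, which
  \<open>B_digit\<close> keeps out of \<open>B (j + 1)\<close>, while all later digits lie in
  \<open>B (j + 1)\<close>. As \<open>j < K\<close>, the difference is not in
  \<open>B K\<close>.\<close>

lemma digit_sum_differ:
  assumes x: "x \<in> B 0" "x \<notin> B 1"
    and "sorted_wrt (<) (map snd ds)" "sorted_wrt (<) (map snd es)"
    and "digits_differ (\<lambda>c. \<not> int p dvd c) K ds es"
  shows "digit_sum x ds - digit_sum x es \<notin> B K"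
  using assms(3-5)
proof (induction "\<lambda>c. \<not> int p dvd c" K ds es rule: digits_differ.induct)
  have lead: "of_int c * act j x + y \<notin> B K" if "j < K" "\<not> int p dvd c" "y \<in> B (j + 1)" for c j y K
  proof
    assume "of_int c * act j x + y \<in> B K"
    then have "of_int c * act j x + y \<in> B (j + 1)"
      using B_mono[of "j + 1" K] that(1) by auto
    then have "of_int c * act j x \<in> B (j + 1)"
      using B_diff[OF _ that(3), of "of_int c * act j x + y"] by simp
    moreover have "act j x \<in> B j" "act j x \<notin> B (j + 1)"
      using x by (auto simp: act_B_iff)
    ultimately show False using B_digit that(2) by blast
  qed
  have tl: "digit_sum x ds \<in> B (j + 1)" if "\<forall>c'\<in>set ds. j < snd c'" for j ds
    using that by (intro digit_sum_B x(1)) force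
  {
    case 1
    then show ?case by simp
  next
    case (2 K c j ds)
    then show ?case using lead[of j K c, OF _ _ tl] by auto
  next
    case (3 K c j es)
    then have "of_int c * act j x + digit_sum x es \<notin> B K"
      using lead[of j K c, OF _ _ tl] by auto
    then show ?case using B_uminus[of "- (of_int c * act j x + digit_sum x es)" K] by (auto simp: add.commute)
  next
    case (4 K c i ds d j es)
    consider "i < j" | "j < i" | "i = j" "c = d" | "i = j" "c \<noteq> d" by linarith
    then show ?case
    proof cases
      case 1
      have "digit_sum x ((d, j) # es) \<in> B (i + 1)"
        using 4(3) 1 by (intro digit_sum_B x(1)) force
      moreover have "digit_sum x ds \<in> B (i + 1)"
        using 4(2) by (intro tl) auto
      ultimately show ?thesis
        using lead[of i K c "digit_sum x ds - digit_sum x ((d, j) # es)"] 4(4) 1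
        by (auto simp: B_diff algebra_simps)
    next
      case 2
      have "digit_sum x ((c, i) # ds) \<in> B (j + 1)"
        using 4(2) 2 by (intro digit_sum_B x(1)) force
      moreover have "digit_sum x es \<in> B (j + 1)"
        using 4(3) by (intro tl) auto
      ultimately have "of_int d * act j x + (digit_sum x es - digit_sum x ((c, i) # ds)) \<notin> B K"
        using 4(4) 2 by (intro lead B_diff) auto
      then show ?thesis
        using B_uminus[of "digit_sum x ((c, i) # ds) - digit_sum x ((d, j) # es)" K]
        by (auto simp: algebra_simps)
    next
      case 3
      then show ?thesis using 4 by auto
    next
      case c: 4
      have "digit_sum x ds \<in> B (i + 1)" "digit_sum x es \<in> B (i + 1)"
        using 4(2,3) c by (auto intro: tl)
      then show ?thesis
        using lead[of i K "c - d" "digit_sum x ds - digit_sum x es"] 4(4) c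
        by (auto simp: B_diff algebra_simps)
    qed
  }
qed

end

section \<open>Cocycles and words in two group elements\<close>

datatype letter = Lu | Lui | Lv | Lvi

fun letter_height :: "int \<Rightarrow> int \<Rightarrow> letter \<Rightarrow> int" where
  "letter_height m n Lu = m"
| "letter_height m n Lui = - m"
| "letter_height m n Lv = n"
| "letter_height m n Lvi = - n"

text \<open>The digits contributed by a word in \<open>u = (0, m)\<close> and \<open>v = (x, n)\<close> read from height \<open>h\<close>.\<close>

fun word_digits :: "int \<Rightarrow> int \<Rightarrow> int \<Rightarrow> letter list \<Rightarrow> (int \<times> int) list" where
  "word_digits m n h [] = []"
| "word_digits m n h (Lu # w) = word_digits m n (h + m) w"
| "word_digits m n h (Lui # w) = word_digits m n (h - m) w"
| "word_digits m n h (Lv # w) = (1, h) # word_digits m n (h + n) w"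
| "word_digits m n h (Lvi # w) = (- 1, h - n) # word_digits m n (h - n) w"

text \<open>The pair \<open>(\<gamma> g, ht g)\<close> is the image of \<open>g\<close> under a
  homomorphism into the semidirect product of the module, taken modulo \<open>\<simeq>\<close>, with
  the integers.\<close>

locale cocycle_group = filtered_module p act B + group G
  for p :: nat and act :: "int \<Rightarrow> 'b::comm_ring_1 \<Rightarrow> 'b" and B :: "int \<Rightarrow> 'b set"
    and G :: "('a, 'm) monoid_scheme" (structure) +
  fixes \<gamma> :: "'a \<Rightarrow> 'b" and ht :: "'a \<Rightarrow> int"
  assumes cocycle: "g \<in> carrier G \<Longrightarrow> h \<in> carrier G \<Longrightarrow> \<gamma> (g \<otimes> h) \<simeq> \<gamma> g + act (ht g) (\<gamma> h)"
    and ht_mult: "g \<in> carrier G \<Longrightarrow> h \<in> carrier G \<Longrightarrow> ht (g \<otimes> h) = ht g + ht h"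
begin

lemma ht_one [simp]: "ht \<one> = 0"
  using ht_mult[of \<one> \<one>] by simp

lemma ht_inv: "g \<in> carrier G \<Longrightarrow> ht (inv g) = - ht g"
  using ht_mult[of g "inv g"] by simp

lemma \<gamma>_one: "\<gamma> \<one> \<simeq> 0"
proof -
  have "\<gamma> \<one> \<simeq> \<gamma> \<one> + \<gamma> \<one>" using cocycle[of \<one> \<one>] by simp
  from approx_diff[OF this approx_refl[of "\<gamma> \<one>"]] show ?thesis
    by (simp add: approx_sym)
qed

lemma \<gamma>_inv: assumes "g \<in> carrier G" shows "\<gamma> (inv g) \<simeq> - act (- ht g) (\<gamma> g)"
proof -
  have "0 \<simeq> \<gamma> (inv g) + act (- ht g) (\<gamma> g)"
    using approx_trans[OF approx_sym[OF \<gamma>_one], of "\<gamma> (inv g) + act (- ht g) (\<gamma> g)"]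
      cocycle[of "inv g" g] assms by (simp add: ht_inv)
  from approx_diff[OF this approx_refl[of "act (- ht g) (\<gamma> g)"]] show ?thesis
    by (simp add: approx_sym)
qed

text \<open>Ping-pong: \<open>w i\<close> maps \<open>B 0\<close> into \<open>s i + B (h i)\<close>,
  a subset of \<open>B 0\<close>, and the separation condition makes these images pairwise disjoint.
  Hence the first factor of a product can be read off from the image of 0 and cancelled.\<close>

lemma growth_rate_ge_of_separated:
  fixes w :: "'i \<Rightarrow> 'a list" and z :: real
  assumes fg: "finite_generating_set G S" and I: "finite I"
    and w: "\<And>i. i \<in> I \<Longrightarrow> w i \<in> symm_words G S"
    and sep: "\<And>i. i \<in> I \<Longrightarrow> \<gamma> (word_prod G (w i)) \<simeq> s i" "\<And>i. i \<in> I \<Longrightarrow> ht (word_prod G (w i)) = h i"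
      "\<And>i. i \<in> I \<Longrightarrow> s i \<in> B 0" "\<And>i. i \<in> I \<Longrightarrow> 0 < h i"
      "\<And>i j. i \<in> I \<Longrightarrow> j \<in> I \<Longrightarrow> i \<noteq> j \<Longrightarrow> s i - s j \<notin> B (min (h i) (h j))"
    and z: "0 < z" "z < 1" and sum: "1 \<le> (\<Sum>i\<in>I. z ^ length (w i))"
  shows "1 / z \<le> growth_rate G S"
proof (rule growth_rate_ge_of_code[OF fg I w _ _ z sum])
  show "w i \<noteq> []" if "i \<in> I" for i
    using sep(2,4)[OF that] by auto
  have S: "S \<subseteq> carrier G" using fg by (simp add: finite_generating_set_def)
  have wc: "set (w i) \<subseteq> carrier G" if "i \<in> I" for i
    using w[OF that] S by (rule symm_words_closed[rotated])
  have wcc: "set (concat (map w xs)) \<subseteq> carrier G" if "set xs \<subseteq> I" for xs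
    using wc that by auto
  let ?P = "\<lambda>xs. word_prod G (concat (map w xs))"
  have Pc: "?P xs \<in> carrier G" if "set xs \<subseteq> I" for xs
    using wcc[OF that] by simp
  have split: "?P (i # xs) = word_prod G (w i) \<otimes> ?P xs" if "set (i # xs) \<subseteq> I" for i xs
    using wc[of i] wcc[of xs] that by (simp add: word_prod_append)
  have \<gamma>P: "\<gamma> (?P (i # xs)) \<simeq> s i + act (h i) (\<gamma> (?P xs))" if "set (i # xs) \<subseteq> I" for i xs
  proof -
    have "i \<in> I" "set xs \<subseteq> I" using that by auto
    then show ?thesis
      unfolding split[OF that]
      using approx_trans[OF cocycle approx_add[OF sep(1) approx_refl]] wc[of i] Pc sep(2) by fastforce
  qed
  \<comment> \<open>The cocycle value of a product is the image of 0, so it stays in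
    \<open>B 0\<close>.\<close>
  have P0: "\<gamma> (?P xs) \<in> B 0" if "set xs \<subseteq> I" for xs
    using that
  proof (induction xs)
    case Nil
    show ?case using approx_B[OF \<gamma>_one] by simp
  next
    case (Cons i xs)
    then have i: "i \<in> I" "\<gamma> (?P xs) \<in> B 0" by auto
    have "act (h i) (\<gamma> (?P xs)) \<in> B 0"
      using act_B[OF i(2), of "h i"] B_mono[of 0 "h i"] sep(4)[OF i(1)] by auto
    then show ?case
      using approx_B[OF \<gamma>P[OF Cons.prems]] B_add sep(3)[OF i(1)] by blast
  qed
  show "xs = ys" if "length xs = length ys" "set xs \<subseteq> I" "set ys \<subseteq> I" "?P xs = ?P ys" for xs ys
    using that
  proof (induction xs ys rule: list_induct2)
    case (Cons i xs j ys)
    have ij: "i \<in> I" "j \<in> I" and sub: "set xs \<subseteq> I" "set ys \<subseteq> I" using Cons.prems by auto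
    have "i = j"
    proof (rule ccontr)
      assume "i \<noteq> j"
      let ?K = "min (h i) (h j)"
      have "s i + act (h i) (\<gamma> (?P xs)) \<simeq> s j + act (h j) (\<gamma> (?P ys))"
        using approx_trans[OF approx_sym[OF \<gamma>P[of i xs]] \<gamma>P[of j ys, folded Cons.prems(3)]] Cons.prems(1,2)
        by simp
      then have "s i + act (h i) (\<gamma> (?P xs)) - (s j + act (h j) (\<gamma> (?P ys))) \<in> B ?K"
        unfolding approx_def by blast
      moreover have "act (h i) (\<gamma> (?P xs)) \<in> B ?K" "act (h j) (\<gamma> (?P ys)) \<in> B ?K"
        using act_B[OF P0[OF sub(1)], of "h i"] act_B[OF P0[OF sub(2)], of "h j"]
          B_mono[of ?K "h i"] B_mono[of ?K "h j"] by auto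
      ultimately have "s i + act (h i) (\<gamma> (?P xs)) - (s j + act (h j) (\<gamma> (?P ys)))
          - (act (h i) (\<gamma> (?P xs)) - act (h j) (\<gamma> (?P ys))) \<in> B ?K"
        by (rule B_diff[OF _ B_diff])
      then have "s i - s j \<in> B ?K" by (simp add: algebra_simps)
      with sep(5)[OF ij \<open>i \<noteq> j\<close>] show False by blast
    qed
    moreover have "?P xs = ?P ys"
      using Cons.prems(3) split[OF Cons.prems(1)] split[OF Cons.prems(2)] Pc sub wc[OF ij(1)] \<open>i = j\<close>
      by (metis Units_eq Units_l_cancel word_prod_closed)
    ultimately show ?case using Cons.IH sub by simp
  qed simp
qed

end

text \<open>\<open>u\<close> fixes 0 and \<open>v\<close> moves 0 to an \<open>x\<close> of exact
  level 0; a word in \<open>u\<close>, \<open>v\<close> and their inverses then moves 0 by a signed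
  sum of shifts of \<open>x\<close>.\<close>

locale normalized_pair = cocycle_group p act B G \<gamma> ht
  for p :: nat and act :: "int \<Rightarrow> 'b::comm_ring_1 \<Rightarrow> 'b" and B :: "int \<Rightarrow> 'b set"
    and G :: "('a, 'm) monoid_scheme" (structure) and \<gamma> :: "'a \<Rightarrow> 'b" and ht :: "'a \<Rightarrow> int" +
  fixes u v :: 'a and x :: 'b
  assumes u: "u \<in> carrier G" "\<gamma> u \<simeq> 0" and v: "v \<in> carrier G" "\<gamma> v \<simeq> x"
    and x: "x \<in> B 0" "x \<notin> B 1"
begin

fun letter_val :: "letter \<Rightarrow> 'a" where
  "letter_val Lu = u"
| "letter_val Lui = inv u"
| "letter_val Lv = v"
| "letter_val Lvi = inv v"

lemma letter_val_closed [simp]: "letter_val l \<in> carrier G"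
  using u v by (cases l) auto

lemma word_val_closed [simp]: "word_prod G (map letter_val w) \<in> carrier G"
  by (rule word_prod_closed) auto

lemma ht_word:
  "ht (word_prod G (map letter_val w)) = sum_list (map (letter_height (ht u) (ht v)) w)"
proof (induction w)
  case (Cons l w)
  have "ht (letter_val l) = letter_height (ht u) (ht v) l"
    using u v by (cases l) (auto simp: ht_inv)
  with Cons show ?case by (simp add: ht_mult)
qed simp

text \<open>Read from left to right, \<open>v\<close> at height \<open>h\<close> adds
  \<open>act h x\<close>, while \<open>inv v\<close> first descends and subtracts
  \<open>act (h - ht v) x\<close>. The offset \<open>h\<close> makes the induction go
  through.\<close>

lemma \<gamma>_word:
  "act h (\<gamma> (word_prod G (map letter_val w))) \<simeq> digit_sum x (word_digits (ht u) (ht v) h w)"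
proof (induction w arbitrary: h)
  case Nil
  then show ?case using approx_act[OF \<gamma>_one, of h] by simp
next
  case (Cons l w)
  have step: "act h (\<gamma> (word_prod G (map letter_val (l # w)))) \<simeq>
      act h (\<gamma> (letter_val l)) + digit_sum x (word_digits (ht u) (ht v) (h + ht (letter_val l)) w)"
  proof -
    have "act h (\<gamma> (letter_val l \<otimes> word_prod G (map letter_val w))) \<simeq>
      act h (\<gamma> (letter_val l)) + act (h + ht (letter_val l)) (\<gamma> (word_prod G (map letter_val w)))"
      using approx_act[OF cocycle[of "letter_val l" "word_prod G (map letter_val w)"], of h]
      by (simp add: act_add act_act)
    with approx_add[OF approx_refl Cons] show ?thesis using approx_trans by fastforce
  qed
  have L: "act h (\<gamma> (letter_val l)) \<simeq> (case l of Lv \<Rightarrow> act h x | Lvi \<Rightarrow> - act (h - ht v) x | _ \<Rightarrow> 0)"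
  proof (cases l)
    case Lu
    then show ?thesis using approx_act[OF u(2), of h] by simp
  next
    case Lv
    then show ?thesis using approx_act[OF v(2), of h] by simp
  next
    case Lui
    have "- act (- ht u) (\<gamma> u) \<simeq> 0"
      using approx_uminus[OF approx_act[OF u(2)]] by simp
    from approx_act[OF approx_trans[OF \<gamma>_inv[OF u(1)] this], of h] Lui show ?thesis by simp
  next
    case Lvi
    have "- act (- ht v) (\<gamma> v) \<simeq> - act (- ht v) x"
      using approx_uminus[OF approx_act[OF v(2)]] by simp
    from approx_act[OF approx_trans[OF \<gamma>_inv[OF v(1)] this], of h] Lvi show ?thesis
      by (simp add: act_uminus act_act)
  qed
  from approx_trans[OF step approx_add[OF L approx_refl]] show ?case
    using u(1) v(1) by (cases l) (auto simp: ht_inv)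
qed

text \<open>The digits read along \<open>w\<close> may be unsorted or cancel, so \<open>ds\<close>
  is a sorted list with the same sum. With the code given as a list, each pair of words is compared
  once; the opposite order follows from \<open>B_uminus\<close>.\<close>

lemma growth_rate_ge_of_digits:
  fixes C :: "(letter list \<times> (int \<times> int) list) list" and z :: real
  defines "H \<equiv> \<lambda>w. sum_list (map (letter_height (ht u) (ht v)) w)"
  assumes fg: "finite_generating_set G S"
    and uv: "u \<in> S \<union> m_inv G ` S" "v \<in> S \<union> m_inv G ` S"
    and C: "\<And>w ds. (w, ds) \<in> set C \<Longrightarrow> 0 < H w \<and> sorted_wrt (<) (map snd ds) \<and> (\<forall>d\<in>set ds. 0 \<le> snd d) \<and>
        digit_sum x (word_digits (ht u) (ht v) 0 w) = digit_sum x ds"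
    and sep: "sorted_wrt (\<lambda>(w, ds) (w', ds'). digits_differ (\<lambda>c. \<not> int p dvd c) (min (H w) (H w')) ds ds') C"
    and z: "0 < z" "z < 1" and sum: "1 \<le> (\<Sum>(w, ds)\<leftarrow>C. z ^ length w)"
  shows "1 / z \<le> growth_rate G S"
proof (rule growth_rate_ge_of_separated[OF fg, of "{..<length C}" "\<lambda>i. map letter_val (fst (C ! i))"
      "\<lambda>i. digit_sum x (snd (C ! i))" "\<lambda>i. H (fst (C ! i))" z])
  have S: "S \<subseteq> carrier G" using fg by (simp add: finite_generating_set_def)
  have "letter_val l \<in> S \<union> m_inv G ` S" for l
    using uv S by (cases l) (auto simp: subset_eq)
  then show "map letter_val (fst (C ! i)) \<in> symm_words G S" for i
    by (simp add: symm_words_def lists_eq_set image_subset_iff)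
  have Ci: "0 < H (fst (C ! i)) \<and> sorted_wrt (<) (map snd (snd (C ! i))) \<and> (\<forall>d\<in>set (snd (C ! i)). 0 \<le> snd d) \<and>
        digit_sum x (word_digits (ht u) (ht v) 0 (fst (C ! i))) = digit_sum x (snd (C ! i))"
    if "i \<in> {..<length C}" for i
    using C[of "fst (C ! i)" "snd (C ! i)"] that by simp
  show "\<gamma> (word_prod G (map letter_val (fst (C ! i)))) \<simeq> digit_sum x (snd (C ! i))"
    if "i \<in> {..<length C}" for i
    using Ci[OF that] \<gamma>_word[of 0 "fst (C ! i)"] by simp
  show "ht (word_prod G (map letter_val (fst (C ! i)))) = H (fst (C ! i))" for i
    by (simp add: ht_word H_def)
  show "digit_sum x (snd (C ! i)) \<in> B 0" if "i \<in> {..<length C}" for i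
    using Ci[OF that] by (intro digit_sum_B x) auto
  show "0 < H (fst (C ! i))" if "i \<in> {..<length C}" for i
    using Ci[OF that] by simp
  have less: "digit_sum x (snd (C ! i)) - digit_sum x (snd (C ! j)) \<notin> B (min (H (fst (C ! i))) (H (fst (C ! j))))"
    if "i < j" "j < length C" for i j
    using sep that Ci[of i] Ci[of j]
    by (intro digit_sum_differ x) (auto simp: sorted_wrt_iff_nth_less case_prod_unfold)
  show "digit_sum x (snd (C ! i)) - digit_sum x (snd (C ! j)) \<notin> B (min (H (fst (C ! i))) (H (fst (C ! j))))"
    if "i \<in> {..<length C}" "j \<in> {..<length C}" "i \<noteq> j" for i j
  proof (cases "i < j")
    case True
    with less[of i j] that show ?thesis by simp
  next
    case False
    with less[of j i] that have "digit_sum x (snd (C ! j)) - digit_sum x (snd (C ! i)) \<notin> B (min (H (fst (C ! i))) (H (fst (C ! j))))"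
      by (simp add: min.commute)
    then show ?thesis
      using B_uminus[of "digit_sum x (snd (C ! i)) - digit_sum x (snd (C ! j))"] by auto
  qed
  have "(\<Sum>i<length C. z ^ length (map letter_val (fst (C ! i)))) = (\<Sum>(w, ds)\<leftarrow>C. z ^ length w)"
    by (simp add: sum_list_sum_nth case_prod_unfold atLeast0LessThan)
  with sum show "1 \<le> (\<Sum>i\<in>{..<length C}. z ^ length (map letter_val (fst (C ! i))))" by simp
qed (use z in auto)

end

section \<open>The equation of the number \<open>\<omega>\<^sub>k\<close>\<close>

lemma sum_symmetric_Suc:
  fixes f :: "int \<Rightarrow> 'c::comm_monoid_add"
  shows "(\<Sum>i\<in>{- int (Suc k)..int (Suc k)}. f i) =
    (\<Sum>i\<in>{- int k..int k}. f i) + (f (int (Suc k)) + f (- int (Suc k)))"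
proof -
  have "{- int (Suc k)..int (Suc k)} = insert (int (Suc k)) (insert (- int (Suc k)) {- int k..int k})"
    by auto
  then show ?thesis by (simp add: ac_simps)
qed

lemma sum_abs_power:
  fixes z :: real
  shows "(1 - z) * (\<Sum>i\<in>{- int k..int k}. z ^ (nat \<bar>i\<bar> + 1)) = z + z ^ 2 - 2 * z ^ (k + 2)"
proof (induction k)
  case (Suc k)
  show ?case
    unfolding sum_symmetric_Suc distrib_left Suc by (simp add: algebra_simps nat_add_distrib)
qed (simp add: algebra_simps power2_eq_square)

text \<open>The exponents are the lengths of the code words used when \<open>u\<close> and
  \<open>v\<close> have equal heights.\<close>

lemma sum_odd_power:
  fixes z :: real
  shows "(1 - z ^ 2) * (\<Sum>i\<in>{- int k..int k}. z ^ (if 0 < i then 2 * nat i - 1 else 2 * nat (- i) + 1)) =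
    2 * z - z ^ (2 * k + 1) - z ^ (2 * k + 3)"
proof (induction k)
  case (Suc k)
  show ?case
    unfolding sum_symmetric_Suc distrib_left Suc
    by (simp add: algebra_simps nat_add_distrib eval_nat_numeral)
qed (simp add: algebra_simps power2_eq_square eval_nat_numeral)

lemma omega_root:
  assumes "1 \<le> k"
  shows "0 < omega k" "T_poly k (omega k) = 0"
proof -
  have "0 < (THE x. 0 < x \<and> T_poly k x = 0) \<and> T_poly k (THE x. 0 < x \<and> T_poly k x = 0) = 0"
    by (rule theI'[OF T_poly_unique_root[OF assms]])
  then show "0 < omega k" "T_poly k (omega k) = 0"
    by (simp_all add: omega_def positive_root_def)
qed

text \<open>This turns the root equation of \<open>T_poly k\<close> into the weight equation of a
  code with one word of length \<open>|i| + 1\<close> for each digit \<open>i\<close>. The induction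
  rests on \<open>T_poly (Suc k) x = x * T_poly k x - 2\<close>.\<close>

lemma T_poly_times_power:
  fixes x z :: real
  assumes "x * z = 1"
  shows "T_poly k x * z ^ (k + 1) = 1 - (\<Sum>i\<in>{- int k..int k}. z ^ (nat \<bar>i\<bar> + 1))"
proof (induction k)
  case 0
  then show ?case using assms by (simp add: T_poly_def algebra_simps)
next
  case (Suc k)
  have rec: "T_poly (Suc k) x = x * T_poly k x - 2"
    by (simp add: T_poly_def sum.lessThan_Suc_shift algebra_simps sum_distrib_left del: sum.lessThan_Suc)
  have "T_poly (Suc k) x * z ^ (Suc k + 1) = (x * z) * (T_poly k x * z ^ (k + 1)) - 2 * z ^ (k + 2)"
    unfolding rec by (simp add: algebra_simps)
  then show ?case
    unfolding sum_symmetric_Suc assms Suc by (simp add: nat_add_distrib)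
qed

lemma omega_equation:
  assumes "1 \<le> k"
  shows "0 < 1 / omega k" "1 / omega k < 1"
    "(\<Sum>i\<in>{- int k..int k}. (1 / omega k) ^ (nat \<bar>i\<bar> + 1)) = 1"
proof -
  note pos = omega_root(1)[OF assms]
  let ?z = "1 / omega k"
  show "0 < ?z" using pos by simp
  show eq: "(\<Sum>i\<in>{- int k..int k}. ?z ^ (nat \<bar>i\<bar> + 1)) = 1"
    using T_poly_times_power[of "omega k" ?z k] omega_root[OF assms] by simp
  show "?z < 1"
  proof (rule ccontr)
    assume "\<not> ?z < 1"
    then have "(\<Sum>i\<in>{- int k..int k}. 1) \<le> (\<Sum>i\<in>{- int k..int k}. ?z ^ (nat \<bar>i\<bar> + 1))"
      by (intro sum_mono one_le_power) auto
    then show False using eq assms by simp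
  qed
qed

text \<open>The weight sum is strictly increasing in \<open>z\<close> and equals 1 at
  \<open>1 / omega k\<close>.\<close>

lemma omega_le:
  assumes "1 \<le> k" "0 < z" "(\<Sum>i\<in>{- int k..int k}. z ^ (nat \<bar>i\<bar> + 1)) \<le> 1"
  shows "omega k \<le> 1 / z"
proof (rule ccontr)
  assume "\<not> omega k \<le> 1 / z"
  then have "1 / omega k < z"
    using assms(2) omega_root(1)[OF assms(1)] by (simp add: field_simps)
  then have "(\<Sum>i\<in>{- int k..int k}. (1 / omega k) ^ (nat \<bar>i\<bar> + 1)) < (\<Sum>i\<in>{- int k..int k}. z ^ (nat \<bar>i\<bar> + 1))"
    using omega_equation(1)[OF assms(1)] by (intro sum_strict_mono power_strict_mono) auto
  then show False using omega_equation(3)[OF assms(1)] assms(3) by simp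
qed

lemma omega_le_2: "omega 1 \<le> 2"
proof -
  have "{- 1..1::int} = {- 1, 0, 1}" by auto
  then show ?thesis
    using omega_le[of 1 "1 / 2"] by (simp add: power2_eq_square numeral_2_eq_2[symmetric])
qed

text \<open>As \<open>k\<close> tends to infinity, the weight sum increases to
  \<open>(z + z^2) / (1 - z)\<close>, which is 1 at \<open>z = sqrt 2 - 1\<close>.\<close>

lemma omega_le_1_plus_sqrt2:
  assumes "1 \<le> k"
  shows "omega k \<le> 1 + sqrt 2"
proof -
  define z :: real where "z = sqrt 2 - 1"
  have z: "0 < z" "z < 1" using sqrt2_less_2 by (simp_all add: z_def)
  have "z + z ^ 2 - 2 * c \<le> (1 - z) * 1" if "0 \<le> c" for c
    using that by (simp add: z_def power2_eq_square algebra_simps)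
  then have "(1 - z) * (\<Sum>i\<in>{- int k..int k}. z ^ (nat \<bar>i\<bar> + 1)) \<le> (1 - z) * 1"
    unfolding sum_abs_power using z(1) zero_le_power by (metis less_imp_le)
  then have "(\<Sum>i\<in>{- int k..int k}. z ^ (nat \<bar>i\<bar> + 1)) \<le> 1"
    using z(2) by (subst (asm) mult_le_cancel_left_pos) auto
  from omega_le[OF assms z(1) this] have "omega k \<le> 1 / z" .
  also have "1 / z = 1 + sqrt 2" using z(1) by (simp add: z_def field_simps)
  finally show ?thesis .
qed

text \<open>The equation of \<open>omega k\<close> gives
  \<open>1 - z^2 = 2 * z - 2 * z ^ (k + 2)\<close>, and for \<open>k \<ge> 1\<close> the exponents
  \<open>2 * k + 1\<close> and \<open>2 * k + 3\<close> in \<open>sum_odd_power\<close> are at least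
  \<open>k + 2\<close>.\<close>

lemma omega_sum_odd:
  assumes "1 \<le> k"
  defines "z \<equiv> 1 / omega k"
  shows "1 \<le> (\<Sum>i\<in>{- int k..int k}. z ^ (if 0 < i then 2 * nat i - 1 else 2 * nat (- i) + 1))"
proof -
  have z: "0 < z" "z < 1" using omega_equation[OF assms(1)] by (simp_all add: z_def)
  have "1 - z = z + z ^ 2 - 2 * z ^ (k + 2)"
    using sum_abs_power[of z k] omega_equation(3)[OF assms(1)] by (simp add: z_def)
  moreover have "z ^ (2 * k + 1) \<le> z ^ (k + 2)" "z ^ (2 * k + 3) \<le> z ^ (k + 2)"
    by (intro power_decreasing; use z assms(1) in simp)+
  ultimately have "(1 - z ^ 2) * 1 \<le> 2 * z - z ^ (2 * k + 1) - z ^ (2 * k + 3)" by simp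
  moreover have "z ^ 2 < 1" using z by (simp add: power_less_one_iff)
  ultimately show ?thesis
    unfolding sum_odd_power[symmetric] by (subst (asm) mult_le_cancel_left_pos) auto
qed

text \<open>Since \<open>z^2 = 1 - 2 * z\<close>, every power is linear in \<open>z\<close>; the
  total weight of an explicit code thereby becomes a linear expression.\<close>

lemma powers_sqrt2_minus_1:
  defines "z \<equiv> sqrt 2 - 1 :: real"
  shows "z ^ 3 = 5 * z - 2" "z ^ 4 = 5 - 12 * z" "z ^ 5 = 29 * z - 12" "z ^ 6 = 29 - 70 * z"
    "z ^ 7 = 169 * z - 70"
proof -
  have 2: "z * z = 1 - 2 * z" by (simp add: z_def algebra_simps)
  have step: "z ^ Suc i = b + (a - 2 * b) * z" if "z ^ i = a + b * z" for i a b
  proof -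
    have "z ^ Suc i = a * z + b * (z * z)" using that by (simp add: algebra_simps)
    then show ?thesis unfolding 2 by (simp add: algebra_simps)
  qed
  have "z ^ Suc (Suc 0) = 1 + (- 2) * z" using 2 by simp
  from step[OF this] have 3: "z ^ 3 = - 2 + 5 * z" by (simp add: eval_nat_numeral)
  from step[OF this] have 4: "z ^ 4 = 5 + (- 12) * z" by (simp add: eval_nat_numeral)
  from step[OF this] have 5: "z ^ 5 = - 12 + 29 * z" by (simp add: eval_nat_numeral)
  from step[OF this] have 6: "z ^ 6 = 29 + (- 70) * z" by (simp add: eval_nat_numeral)
  from step[OF this] have 7: "z ^ 7 = - 70 + 169 * z" by (simp add: eval_nat_numeral)
  show "z ^ 3 = 5 * z - 2" "z ^ 4 = 5 - 12 * z" "z ^ 5 = 29 * z - 12" "z ^ 6 = 29 - 70 * z"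
    "z ^ 7 = 169 * z - 70"
    using 3 4 5 6 7 by simp_all
qed

section \<open>Lower bounds from a normalized pair\<close>

lemma int_not_dvd_of_abs_less:
  assumes "c \<noteq> 0" "\<bar>c\<bar> < int p"
  shows "\<not> int p dvd c"
  using assms dvd_imp_le_int[of c "int p"] by auto

lemma sum_list_upto: "(\<Sum>i\<leftarrow>[a..b]. f i) = sum f {a..b}" for f :: "int \<Rightarrow> 'c::comm_monoid_add"
  by (simp add: interv_sum_list_conv_sum_set_int)

context normalized_pair
begin

context
  fixes S assumes fg: "finite_generating_set G S"
    and uv: "u \<in> S \<union> m_inv G ` S" "v \<in> S \<union> m_inv G ` S"
begin

text \<open>Distinct digits between \<open>-k\<close> and \<open>k\<close> differ by less than
  \<open>p\<close>, hence not by a multiple of \<open>p\<close>. All code words have the same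
  positive height, so the digit at position 0 separates them.\<close>

lemma growth_rate_ge_digit_range:
  fixes W :: "int \<Rightarrow> letter list" and k :: nat
  assumes p: "p = 2 * k + 1" and m: "0 < ht u"
    and W: "\<And>i. sum_list (map (letter_height (ht u) (ht v)) (W i)) = ht u"
      "\<And>i. digit_sum x (word_digits (ht u) (ht v) 0 (W i)) = of_int i * x"
    and z: "0 < z" "z < 1" and sum: "1 \<le> (\<Sum>i\<in>{- int k..int k}. z ^ length (W i))"
  shows "1 / z \<le> growth_rate G S"
proof (rule growth_rate_ge_of_digits[OF fg uv _ _ z])
  let ?C = "map (\<lambda>i. (W i, if i = 0 then [] else [(i, 0)])) [- int k..int k]"
  show "1 \<le> (\<Sum>(w, ds)\<leftarrow>?C. z ^ length w)"
    using sum by (simp add: comp_def sum_list_upto)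
  show "0 < sum_list (map (letter_height (ht u) (ht v)) w) \<and> sorted_wrt (<) (map snd ds) \<and>
      (\<forall>d\<in>set ds. 0 \<le> snd d) \<and> digit_sum x (word_digits (ht u) (ht v) 0 w) = digit_sum x ds"
    if "(w, ds) \<in> set ?C" for w ds
    using that m W by (auto split: if_splits)
  have *: "digits_differ (\<lambda>c. \<not> int p dvd c) (ht u) (if i = 0 then [] else [(i, 0)]) (if j = 0 then [] else [(j, 0)])"
    if "i < j" "- int k \<le> i" "j \<le> int k" for i j
    using that m int_not_dvd_of_abs_less[of i p] int_not_dvd_of_abs_less[of j p] int_not_dvd_of_abs_less[of "i - j" p]
    by (auto simp: p)
  show "sorted_wrt (\<lambda>(w, ds) (w', ds'). digits_differ (\<lambda>c. \<not> int p dvd c)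
      (min (sum_list (map (letter_height (ht u) (ht v)) w)) (sum_list (map (letter_height (ht u) (ht v)) w'))) ds ds') ?C"
    unfolding sorted_wrt_map prod.case W min.idem
    by (rule sorted_wrt_mono_rel[OF _ sorted_wrt_upto]) (rule *, auto)
qed

lemma word_digits_append:
  "word_digits m n h (w @ w') =
    word_digits m n h w @ word_digits m n (h + sum_list (map (letter_height m n) w)) w'"
  by (induction m n h w rule: word_digits.induct) (auto simp: algebra_simps)

lemma growth_rate_ge_elliptic:
  assumes p: "p = 2 * k + 1" and k: "1 \<le> k" and m: "0 < ht u" and n: "ht v = 0"
  shows "omega k \<le> growth_rate G S"
proof -
  \<comment> \<open>This is \<open>v^i u\<close>, of length \<open>|i| + 1\<close>: powers of
    \<open>v\<close> stay at height 0, so the digit \<open>i\<close> arises at position 0.\<close>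
  define W where "W i = replicate (nat \<bar>i\<bar>) (if 0 < i then Lv else Lvi) @ [Lu]" for i :: int
  have height: "sum_list (map (letter_height (ht u) 0) (replicate j l)) = 0" if "l \<in> {Lv, Lvi}" for j l
    using that by (induction j) auto
  have digits: "digit_sum x (word_digits (ht u) 0 0 (replicate j Lv)) = of_nat j * x"
    "digit_sum x (word_digits (ht u) 0 0 (replicate j Lvi)) = - of_nat j * x" for j
    by (induction j) (auto simp: algebra_simps)
  have sum_app: "digit_sum x (ds @ es) = digit_sum x ds + digit_sum x es" for ds es
    by (simp add: digit_sum_def)
  have "1 / (1 / omega k) \<le> growth_rate G S"
  proof (rule growth_rate_ge_digit_range[OF p m, of W])
    show "sum_list (map (letter_height (ht u) (ht v)) (W i)) = ht u" for i
      using height by (auto simp: W_def n)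
    have "nat \<bar>i\<bar> = nat i \<and> of_nat (nat i) = (of_int i :: 'b)" if "0 < i" for i
      using that by simp
    moreover have "nat \<bar>i\<bar> = nat (- i) \<and> - of_nat (nat (- i)) = (of_int i :: 'b)" if "\<not> 0 < i" for i
      using that by simp
    ultimately show "digit_sum x (word_digits (ht u) (ht v) 0 (W i)) = of_int i * x" for i
      by (cases "0 < i") (simp_all add: W_def n word_digits_append sum_app height digits)
    show "1 \<le> (\<Sum>i\<in>{- int k..int k}. (1 / omega k) ^ length (W i))"
      using omega_equation(3)[OF k] by (simp add: W_def)
  qed (use omega_equation[OF k] in auto)
  then show ?thesis by simp
qed

lemma growth_rate_ge_equal_heights:
  assumes p: "p = 2 * k + 1" and k: "1 \<le> k" and m: "0 < ht u" and n: "ht v = ht u"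
  shows "omega k \<le> growth_rate G S"
proof -
  define P where "P j = concat (replicate j [Lui, Lv])" for j
  define N where "N j = concat (replicate j [Lu, Lvi])" for j
  \<comment> \<open>The words are \<open>v (u^-1 v)^(i-1)\<close> and
    \<open>(u v^-1)^(-i) u\<close>. The repeated factors have height 0, and each changes the digit
    at position 0 by one at the cost of two letters.\<close>
  define W where "W i = (if 0 < i then Lv # P (nat (i - 1)) else N (nat (- i)) @ [Lu])" for i :: int
  have height: "sum_list (map (letter_height (ht u) (ht u)) (P j)) = 0"
      "sum_list (map (letter_height (ht u) (ht u)) (N j)) = 0" for j
    by (induction j) (auto simp: P_def N_def)
  have len: "length (P j) = 2 * j" "length (N j) = 2 * j" for j
    by (induction j) (auto simp: P_def N_def)
  have digits: "digit_sum x (word_digits (ht u) (ht u) (ht u) (P j)) = of_nat j * x"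
    "digit_sum x (word_digits (ht u) (ht u) 0 (N j)) = - of_nat j * x" for j
    by (induction j) (auto simp: P_def N_def algebra_simps)
  have sum_app: "digit_sum x (ds @ es) = digit_sum x ds + digit_sum x es" for ds es
    by (simp add: digit_sum_def)
  have "1 / (1 / omega k) \<le> growth_rate G S"
  proof (rule growth_rate_ge_digit_range[OF p m, of W])
    show "sum_list (map (letter_height (ht u) (ht v)) (W i)) = ht u" for i
      using height by (auto simp: W_def n)
    have "of_nat (nat (i - 1)) = (of_int i - 1 :: 'b)" if "0 < i" for i
      using that by simp
    moreover have "- of_nat (nat (- i)) = (of_int i :: 'b)" if "\<not> 0 < i" for i
      using that by simp
    ultimately show "digit_sum x (word_digits (ht u) (ht v) 0 (W i)) = of_int i * x" for i
      by (cases "0 < i") (simp_all add: W_def n word_digits_append sum_app height digits algebra_simps)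
    have "length (W i) = (if 0 < i then 2 * nat i - 1 else 2 * nat (- i) + 1)" for i
      by (auto simp: W_def len)
    then show "1 \<le> (\<Sum>i\<in>{- int k..int k}. (1 / omega k) ^ length (W i))"
      using omega_sum_odd[OF k] by simp
  qed (use omega_equation[OF k] in auto)
  then show ?thesis by simp
qed

text \<open>\<open>u\<close> and \<open>v\<close> alone generate a free monoid, since
  \<open>B (ht u)\<close> and \<open>x + B (ht v)\<close> are disjoint.\<close>

lemma growth_rate_ge_2:
  assumes "2 \<le> p" "0 < ht u" "0 < ht v"
  shows "2 \<le> growth_rate G S"
proof -
  have "1 / (1 / 2 :: real) \<le> growth_rate G S"
    by (rule growth_rate_ge_of_digits[OF fg uv, of "[([Lu], []), ([Lv], [(1, 0)])]"])
       (use assms int_not_dvd_of_abs_less[of 1 p] in auto)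
  then show ?thesis by simp
qed

lemma growth_rate_ge_golden:
  assumes "2 \<le> p" "0 < ht u" "ht v = 0"
  shows "(1 + sqrt 5) / 2 \<le> growth_rate G S"
proof -
  let ?z = "(sqrt 5 - 1) / 2 :: real"
  have z: "0 < ?z" "?z < 1" by (auto intro: real_less_lsqrt)
  \<comment> \<open>The words \<open>u\<close> and \<open>vu\<close> have lengths 1 and 2, so their
    weights add up to 1 at the inverse of the golden ratio.\<close>
  have "?z + ?z ^ 2 = 1" by (simp add: power2_eq_square field_simps)
  then have "1 / ?z \<le> growth_rate G S"
    by (intro growth_rate_ge_of_digits[OF fg uv, of "[([Lu], []), ([Lv, Lu], [(1, 0)])]"])
       (use assms int_not_dvd_of_abs_less[of 1 p] z in \<open>auto simp: power2_eq_square\<close>)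
  moreover have "1 / ?z = (1 + sqrt 5) / 2" using z by (simp add: field_simps)
  ultimately show ?thesis by simp
qed

text \<open>The code words beyond \<open>u\<close> and \<open>v\<close> make up for the weight missing from \<open>2 * z\<close>
  at \<open>z = sqrt 2 - 1\<close>; for \<open>ht v < 2 * ht u\<close> the total weight is exactly 1.\<close>

lemma growth_rate_ge_distinct_heights:
  assumes p: "5 \<le> p" and m: "0 < ht u" "ht u < ht v"
  shows "1 + sqrt 2 \<le> growth_rate G S"
proof -
  let ?z = "sqrt 2 - 1 :: real"
  have z: "0 < ?z" "?z < 1" using sqrt2_less_2 by simp_all
  \<comment> \<open>The digits occurring below are -1, 1 and 2, so they and their differences have
    absolute value at most 3; this is where \<open>p \<ge> 5\<close> enters.\<close>
  have pd: "\<not> int p dvd 1" "\<not> int p dvd - 1" "\<not> int p dvd 2" "\<not> int p dvd - 2"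
    "\<not> int p dvd 3" "\<not> int p dvd - 3"
    using p by (intro int_not_dvd_of_abs_less; simp)+
  \<comment> \<open>Both fractions are convergents of \<open>sqrt 2\<close>. They are exactly what
    is required: the total weight is \<open>30 - 70 * ?z\<close> for \<open>n = 2 * m\<close> and
    \<open>169 * ?z - 69\<close> for \<open>n > 2 * m\<close>.\<close>
  have "sqrt 2 \<le> 99 / 70" by (rule real_le_lsqrt) (simp_all add: power2_eq_square)
  moreover have "239 / 169 \<le> sqrt 2" by (rule real_le_rsqrt) (simp_all add: power2_eq_square)
  ultimately have sqrt2: "70 * sqrt 2 \<le> 99" "239 \<le> 169 * sqrt 2" by linarith+
  define m n where "m = ht u" and "n = ht v"
  have mn: "0 < m" "m < n" using m by (auto simp: m_def n_def)
  \<comment> \<open>These words serve for all \<open>m < n\<close>. The others depend on the sign of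
    \<open>n - 2 * m\<close>, the position at which \<open>v u^-1 u^-1 v\<close> places its second
    digit.\<close>
  let ?C0 = "[([Lu], []), ([Lv], [(1, 0)]), ([Lv, Lui, Lv], [(1, 0), (1, n - m)]),
     ([Lv, Lu, Lvi, Lu], [(1, 0), (- 1, m)]),
     ([Lv, Lui, Lv, Lui, Lv], [(1, 0), (1, n - m), (1, 2 * n - 2 * m)]),
     ([Lv, Lui, Lv, Lu, Lvi, Lu], [(1, 0), (1, n - m), (- 1, n)])]"
  have "\<exists>C. (\<forall>(w, ds)\<in>set C. 0 < sum_list (map (letter_height m n) w) \<and> sorted_wrt (<) (map snd ds) \<and>
          (\<forall>d\<in>set ds. 0 \<le> snd d) \<and> digit_sum x (word_digits m n 0 w) = digit_sum x ds) \<and>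
      sorted_wrt (\<lambda>(w, ds) (w', ds'). digits_differ (\<lambda>c. \<not> int p dvd c)
        (min (sum_list (map (letter_height m n) w)) (sum_list (map (letter_height m n) w'))) ds ds') C \<and>
      1 \<le> (\<Sum>(w, ds)\<leftarrow>C. ?z ^ length w)"
  proof (cases "n < 2 * m" "n = 2 * m" rule: case_split[case_product case_split])
    case True_False
    let ?C = "?C0 @ [([Lu, Lu, Lvi, Lu], [(- 1, 2 * m - n)]),
      ([Lu, Lv, Lui, Lui, Lv], [(1, n - m), (1, m)]),
      ([Lv, Lv, Lui, Lui, Lv], [(1, 0), (1, 2 * n - 2 * m), (1, n)])]"
    show ?thesis
      apply (intro exI[of _ ?C] conjI)
      subgoal using mn True_False by (auto simp: algebra_simps)
      subgoal using mn True_False pd by auto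
      subgoal by (simp add: powers_sqrt2_minus_1 numeral_2_eq_2[symmetric])
      done
  next
    case False_True
    let ?C = "?C0 @ [([Lu, Lu, Lvi, Lu], [(- 1, 0)]), ([Lv, Lui, Lui, Lv], [(2, 0)])]"
    show ?thesis
      apply (intro exI[of _ ?C] conjI)
      subgoal using mn False_True by (auto simp: algebra_simps)
      subgoal using mn False_True pd by auto
      subgoal
        by (simp add: powers_sqrt2_minus_1 numeral_2_eq_2[symmetric]) (rule sqrt2(1))
      done
  next
    case False_False
    let ?C = "?C0 @ [([Lv, Lui, Lui, Lv], [(1, 0), (1, n - 2 * m)]),
      ([Lv, Lu, Lu, Lvi, Lu], [(1, 0), (- 1, 2 * m)]),
      ([Lv, Lui, Lv, Lui, Lui, Lv], [(1, 0), (1, n - m), (1, 2 * n - 3 * m)]),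
      ([Lv, Lui, Lui, Lv, Lui, Lv], [(1, 0), (1, n - 2 * m), (1, 2 * n - 3 * m)]),
      ([Lv, Lui, Lui, Lv, Lu, Lvi, Lu], [(1, 0), (1, n - 2 * m), (- 1, n - m)]),
      ([Lv, Lui, Lv, Lu, Lu, Lvi, Lu], [(1, 0), (1, n - m), (- 1, n + m)])]"
    show ?thesis
      apply (intro exI[of _ ?C] conjI)
      subgoal using mn False_False by (auto simp: algebra_simps)
      subgoal using mn False_False pd by auto
      subgoal
        by (simp add: powers_sqrt2_minus_1 numeral_2_eq_2[symmetric]) (rule sqrt2(2))
      done
  qed (use mn in auto)
  then have "1 / ?z \<le> growth_rate G S"
    unfolding m_def n_def using growth_rate_ge_of_digits[OF fg uv _ _ z] by blast
  moreover have "1 / ?z = 1 + sqrt 2" using z by (simp add: field_simps)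
  ultimately show ?thesis by simp
qed

end

end

section \<open>The number \<open>\<beta>\<close> and the golden ratio\<close>

lemma beta_root: "0 < beta" "beta ^ 3 - beta ^ 2 - 2 = 0"
proof -
  have "0 < (THE z::real. 0 < z \<and> z ^ 3 - z ^ 2 - 2 = 0) \<and>
      (THE z::real. 0 < z \<and> z ^ 3 - z ^ 2 - 2 = 0) ^ 3 - (THE z::real. 0 < z \<and> z ^ 3 - z ^ 2 - 2 = 0) ^ 2 - 2 = 0"
    by (rule theI'[OF beta_unique_root])
  then show "0 < beta" "beta ^ 3 - beta ^ 2 - 2 = 0"
    by (simp_all add: beta_def positive_root_def)
qed

lemma golden_ratio_equation: "1 / ((1 + sqrt 5) / 2) + (1 / ((1 + sqrt 5) / 2)) ^ 2 = (1 :: real)"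
proof -
  have "0 < 1 + sqrt (5 :: real)" by (simp add: add_pos_pos)
  then show ?thesis by (simp add: field_simps power2_eq_square)
qed

lemma golden_ratio_bounds: "1 < (1 + sqrt 5) / (2::real)" "(1 + sqrt 5) / 2 < (2::real)"
proof -
  have "sqrt 5 < (3::real)" by (rule real_less_lsqrt) auto
  moreover have "1 < sqrt (5::real)" by simp
  ultimately show "1 < (1 + sqrt 5) / (2::real)" "(1 + sqrt 5) / 2 < (2::real)" by simp_all
qed

text \<open>Beyond 1 the function \<open>z^2 * (z - 1)\<close> increases. It is 2 at
  \<open>beta\<close>, but at the golden ratio \<open>g\<close> it is \<open>g < 2\<close>, because
  \<open>g * (g - 1) = 1\<close>.\<close>

lemma golden_ratio_less_beta: "(1 + sqrt 5) / 2 < beta"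
proof (rule ccontr)
  let ?g = "(1 + sqrt 5) / 2 :: real"
  assume "\<not> ?g < beta"
  then have le: "beta \<le> ?g" by simp
  have eq: "beta ^ 2 * (beta - 1) = 2"
    using beta_root(2) by (simp add: algebra_simps power2_eq_square power3_eq_cube)
  then have "1 < beta"
    by (smt (verit) mult_nonneg_nonpos zero_le_power2)
  then have "beta ^ 2 * (beta - 1) \<le> ?g ^ 2 * (?g - 1)"
    using le by (intro mult_mono power_mono) auto
  also have "?g ^ 2 * (?g - 1) = ?g"
    by (simp add: field_simps power2_eq_square)
  finally show False using eq golden_ratio_bounds(2) by simp
qed

lemma beta_bounds: "1 < beta" "beta \<le> 2"
proof -
  show "1 < beta" by (rule less_trans[OF golden_ratio_bounds(1) golden_ratio_less_beta])
  show "beta \<le> 2"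
  proof (rule ccontr)
    assume "\<not> beta \<le> 2"
    then have "2 ^ 2 * 1 \<le> beta ^ 2 * (beta - 1)"
      by (intro mult_mono power_mono) auto
    then show False
      using beta_root(2) by (simp add: algebra_simps power2_eq_square power3_eq_cube)
  qed
qed

lemma beta_equation: "1 / beta + 2 * (1 / beta) ^ 3 = 1"
proof -
  have "1 / beta + 2 * (1 / beta) ^ 3 = (beta ^ 2 + 2) / beta ^ 3"
    using beta_root(1) by (simp add: field_simps power2_eq_square power3_eq_cube)
  also have "beta ^ 2 + 2 = beta ^ 3" using beta_root(2) by simp
  finally show ?thesis using beta_root(1) by simp
qed

section \<open>Lower bounds\<close>

text \<open>The words \<open>u\<close>, \<open>vuu\<close>, \<open>v^-1 uu\<close> have digits 0, 1,
  -1. The last two differ by \<open>2 * x\<close>, which divisibility of digits by \<open>p\<close>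
  cannot detect for \<open>p = 2\<close>; the hypothesis on \<open>2 * x\<close> separates them, as
  both have height \<open>2 * ht u \<ge> 2\<close>. It holds for BS(1,2) and fails for lamps, where
  \<open>2 * x\<close> is congruent to 0.\<close>

lemma (in normalized_pair) growth_rate_ge_beta:
  assumes fg: "finite_generating_set G S"
    and uv: "u \<in> S \<union> m_inv G ` S" "v \<in> S \<union> m_inv G ` S"
    and p: "p = 2" and m: "0 < ht u" and n: "ht v = 0" and x2: "2 * x \<notin> B 2"
  shows "beta \<le> growth_rate G S"
proof -
  define W where "W i = (if i = 0 then [Lu] else [if i = 1 then Lv else Lvi, Lu, Lu])" for i :: int
  have "1 / (1 / beta) \<le> growth_rate G S"
  proof (rule growth_rate_ge_of_separated[OF fg, of "{- 1, 0, 1}" "\<lambda>i. map letter_val (W i)"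
        "\<lambda>i. of_int i * x" "\<lambda>i. if i = 0 then ht u else 2 * ht u"])
    have S: "S \<subseteq> carrier G" using fg by (simp add: finite_generating_set_def)
    have "letter_val l \<in> S \<union> m_inv G ` S" for l
      using uv S by (cases l) (auto simp: subset_eq)
    then show "map letter_val (W i) \<in> symm_words G S" for i
      by (simp add: symm_words_def lists_eq_set image_subset_iff)
    show "\<gamma> (word_prod G (map letter_val (W i))) \<simeq> of_int i * x" if "i \<in> {- 1, 0, 1}" for i
      using \<gamma>_word[of 0 "W i"] that by (auto simp: W_def n)
    show "ht (word_prod G (map letter_val (W i))) = (if i = 0 then ht u else 2 * ht u)" for i
      by (simp add: ht_word W_def n)
    show "of_int i * x \<in> B 0" for i by (rule B_of_int[OF x(1)])
    have x1: "x \<notin> B j" if "1 \<le> j" for j using x(2) B_mono[OF that] by auto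
    have x2: "2 * x \<notin> B j" if "2 \<le> j" for j using assms(7) B_mono[OF that] by auto
    have x1': "- x \<notin> B j" if "1 \<le> j" for j using x1[OF that] B_uminus[of "- x" j] by auto
    have x2': "- (2 * x) \<notin> B j" if "2 \<le> j" for j using x2[OF that] B_uminus[of "- (2 * x)" j] by auto
    have x3: "x + x = 2 * x" "- x - x = - (2 * x)" by simp_all
    show "of_int i * x - of_int j * x \<notin> B (min (if i = 0 then ht u else 2 * ht u) (if j = 0 then ht u else 2 * ht u))"
      if "i \<in> {- 1, 0, 1}" "j \<in> {- 1, 0, 1}" "i \<noteq> j" for i j
      using that m x1 x2 x1' x2' by (auto simp: x3)
    show "1 \<le> (\<Sum>i\<in>{- 1, 0, 1}. (1 / beta) ^ length (map letter_val (W i)))"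
      using beta_equation by (simp add: W_def power3_eq_cube)
  qed (use m beta_bounds in auto)
  then show ?thesis by simp
qed

section \<open>Choosing and normalizing a non-commuting pair of generators\<close>

context group
begin

lemma commute_inv:
  assumes "u \<in> carrier G" "v \<in> carrier G" "inv u \<otimes> v = v \<otimes> inv u"
  shows "u \<otimes> v = v \<otimes> u"
proof -
  have "v \<otimes> u = u \<otimes> (inv u \<otimes> v) \<otimes> u"
    using assms(1,2) by (simp add: m_assoc[symmetric])
  also have "\<dots> = u \<otimes> (v \<otimes> inv u) \<otimes> u" by (simp add: assms(3))
  also have "\<dots> = u \<otimes> v" using assms(1,2) by (simp add: m_assoc)
  finally show ?thesis ..
qed

lemma commute_symm_words:
  assumes "S \<subseteq> carrier G" "c \<in> carrier G" "\<And>s. s \<in> S \<Longrightarrow> s \<otimes> c = c \<otimes> s" "ws \<in> symm_words G S"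
  shows "word_prod G ws \<otimes> c = c \<otimes> word_prod G ws"
  using assms(4)
proof (induction ws)
  case (Cons y ws)
  then have y: "y \<in> S \<union> m_inv G ` S" and ws: "ws \<in> symm_words G S"
    by (auto simp: symm_words_def)
  have yc: "y \<in> carrier G" using y assms(1) by auto
  have wc: "word_prod G ws \<in> carrier G" using symm_words_closed[OF assms(1) ws] by simp
  have "y \<otimes> c = c \<otimes> y"
    using y
  proof
    assume "y \<in> m_inv G ` S"
    then obtain s where s: "s \<in> S" "y = inv s" by auto
    then have "s \<in> carrier G" "inv y = s" using assms(1) by auto
    with commute_inv[OF yc assms(2)] assms(3)[OF s(1)] show ?thesis by simp
  qed (rule assms(3))
  then have "y \<otimes> word_prod G ws \<otimes> c = c \<otimes> y \<otimes> word_prod G ws"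
    using Cons.IH[OF ws] yc wc assms(2) by (metis m_assoc)
  then show ?case using yc wc assms(2) by (simp add: m_assoc)
qed (use assms(2) in simp)

text \<open>If the generators commuted pairwise, each would commute with \<open>h\<close> by
  \<open>commute_symm_words\<close>, and a second application would make \<open>g\<close> commute
  with \<open>h\<close>.\<close>

lemma noncommuting_generators:
  assumes fg: "finite_generating_set G S"
    and gh: "g \<in> carrier G" "h \<in> carrier G" "g \<otimes> h \<noteq> h \<otimes> g"
  shows "\<exists>u\<in>S. \<exists>v\<in>S. u \<otimes> v \<noteq> v \<otimes> u"
proof (rule ccontr)
  assume "\<not> ?thesis"
  then have comm: "u \<otimes> v = v \<otimes> u" if "u \<in> S" "v \<in> S" for u v using that by blast
  have S: "S \<subseteq> carrier G" using fg by (simp add: finite_generating_set_def)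
  obtain vs ws where vs: "vs \<in> symm_words G S" "word_prod G vs = g"
    and ws: "ws \<in> symm_words G S" "word_prod G ws = h"
    using generate_word[OF S] gh(1,2) fg unfolding finite_generating_set_def by metis
  have "s \<otimes> h = h \<otimes> s" if "s \<in> S" for s
    using commute_symm_words[OF S _ comm ws(1), of s] that S ws(2) by (metis subsetD)
  from commute_symm_words[OF S gh(2) this vs(1)] vs(2) gh(3) show False by simp
qed

end

text \<open>\<open>faithful\<close> embeds \<open>G\<close> into the semidirect product, and
  \<open>bounded\<close> ensures that cocycle values other than 0 modulo \<open>\<simeq>\<close>
  have an exact level in the filtration.\<close>

locale faithful_cocycle_group = cocycle_group p act B G \<gamma> ht
  for p :: nat and act :: "int \<Rightarrow> 'b::comm_ring_1 \<Rightarrow> 'b" and B :: "int \<Rightarrow> 'b set"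
    and G :: "('a, 'm) monoid_scheme" (structure) and \<gamma> :: "'a \<Rightarrow> 'b" and ht :: "'a \<Rightarrow> int" +
  assumes bounded: "g \<in> carrier G \<Longrightarrow> \<exists>j. \<gamma> g \<in> B j"
    and faithful: "g \<in> carrier G \<Longrightarrow> h \<in> carrier G \<Longrightarrow> \<gamma> g \<simeq> \<gamma> h \<Longrightarrow> ht g = ht h \<Longrightarrow> g = h"
begin

lemma bounded_act: "g \<in> carrier G \<Longrightarrow> \<exists>j. act h (\<gamma> g) \<in> B j"
  using bounded act_B by blast

lemma bounded_diff: "\<exists>j. x \<in> B j \<Longrightarrow> \<exists>j. y \<in> B j \<Longrightarrow> \<exists>j. x - y \<in> B j"
proof -
  assume "\<exists>j. x \<in> B j" "\<exists>j. y \<in> B j"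
  then obtain i j where "x \<in> B i" "y \<in> B j" by auto
  then have "x - y \<in> B (min i j)"
    using B_mono[of "min i j" i] B_mono[of "min i j" j] by (intro B_diff) auto
  then show ?thesis by blast
qed

text \<open>Conjugating by the fixed point of \<open>u\<close>, which need not exist in the module; applying
  \<open>1 - act (ht u)\<close> clears the denominator.\<close>

lemma exists_normalized_pair:
  assumes u: "u \<in> carrier G" and v: "v \<in> carrier G" and uv: "u \<otimes> v \<noteq> v \<otimes> u"
  shows "\<exists>\<delta> x. normalized_pair p act B G \<delta> ht u v x"
proof -
  \<comment> \<open>\<open>1 - act (ht u)\<close> applied to \<open>\<gamma>\<close>, minus the
    coboundary of \<open>\<gamma> u\<close>: a cocycle with value 0 at \<open>u\<close>.\<close>
  define \<epsilon> where "\<epsilon> g = \<gamma> g - act (ht u) (\<gamma> g) - (\<gamma> u - act (ht g) (\<gamma> u))" for g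
  have coc: "\<epsilon> (g \<otimes> h) \<simeq> \<epsilon> g + act (ht g) (\<epsilon> h)" if "g \<in> carrier G" "h \<in> carrier G" for g h
  proof -
    let ?c = "\<gamma> g + act (ht g) (\<gamma> h)"
    have "\<epsilon> (g \<otimes> h) \<simeq> ?c - act (ht u) ?c - (\<gamma> u - act (ht g + ht h) (\<gamma> u))"
      unfolding \<epsilon>_def ht_mult[OF that] by (intro approx_diff approx_act cocycle[OF that] approx_refl)
    also have "?c - act (ht u) ?c - (\<gamma> u - act (ht g + ht h) (\<gamma> u)) = \<epsilon> g + act (ht g) (\<epsilon> h)"
      by (simp add: \<epsilon>_def act_add act_diff act_act algebra_simps)
    finally show ?thesis .
  qed
  \<comment> \<open>Modulo \<open>\<simeq>\<close>, \<open>\<epsilon> v\<close> is the difference of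
    the cocycle values of \<open>v \<otimes> u\<close> and \<open>u \<otimes> v\<close>, which have
    the same height; faithfulness applies.\<close>
  have "\<not> \<epsilon> v \<simeq> 0"
  proof
    assume 0: "\<epsilon> v \<simeq> 0"
    have "\<gamma> (v \<otimes> u) \<simeq> \<gamma> v + act (ht v) (\<gamma> u)" by (rule cocycle[OF v u])
    also have "\<gamma> v + act (ht v) (\<gamma> u) = (\<gamma> u + act (ht u) (\<gamma> v)) + \<epsilon> v"
      by (simp add: \<epsilon>_def)
    also have "\<dots> \<simeq> \<gamma> (u \<otimes> v) + 0"
      by (intro approx_add 0 approx_sym[OF cocycle[OF u v]])
    finally have "\<gamma> (u \<otimes> v) \<simeq> \<gamma> (v \<otimes> u)" by (simp add: approx_sym)
    then show False using faithful[of "u \<otimes> v" "v \<otimes> u"] u v uv by (simp add: ht_mult)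
  qed
  then obtain i where i: "\<epsilon> v \<notin> B i" by (auto simp: approx_def)
  obtain j where j: "\<epsilon> v \<in> B j"
    unfolding \<epsilon>_def using bounded[OF v] bounded[OF u] bounded_act[OF v] bounded_act[OF u]
    by (meson bounded_diff)
  have "\<exists>l. \<epsilon> v \<in> B l \<and> \<epsilon> v \<notin> B (l + 1)"
  proof (rule ccontr)
    assume *: "\<not> ?thesis"
    have "\<epsilon> v \<in> B l" if "j \<le> l" for l
      using that by (induction l rule: int_ge_induct) (use j * in auto)
    then have "\<epsilon> v \<in> B (max i j)" by simp
    with i B_mono[of i "max i j"] show False by auto
  qed
  then obtain l where l: "\<epsilon> v \<in> B l" "\<epsilon> v \<notin> B (l + 1)" by blast
  \<comment> \<open>Shifting by \<open>- l\<close> moves the exact level of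
    \<open>\<epsilon> v\<close> to 0.\<close>
  have "normalized_pair p act B G (\<lambda>g. act (- l) (\<epsilon> g)) ht u v (act (- l) (\<epsilon> v))"
  proof unfold_locales
    show "act (- l) (\<epsilon> (g \<otimes> h)) \<simeq> act (- l) (\<epsilon> g) + act (ht g) (act (- l) (\<epsilon> h))"
      if "g \<in> carrier G" "h \<in> carrier G" for g h
      using approx_act[OF coc[OF that], of "- l"] by (simp add: act_add act_act add.commute)
    show "act (- l) (\<epsilon> u) \<simeq> 0" by (simp add: \<epsilon>_def)
    show "act (- l) (\<epsilon> v) \<in> B 0" "act (- l) (\<epsilon> v) \<notin> B 1"
      using l by (auto simp: act_B_iff add.commute)
  qed (use u v ht_mult in auto)
  then show ?thesis by blast
qed

text \<open>Passing to inverses makes heights nonnegative and preserves non-commutation. Elements of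
  height 0 commute with each other, so some height is positive, and \<open>u\<close> is taken to be
  an element of smallest positive height among the two.\<close>

lemma exists_generating_pair:
  assumes fg: "finite_generating_set G S"
    and gh: "g \<in> carrier G" "h \<in> carrier G" "g \<otimes> h \<noteq> h \<otimes> g"
  obtains u v where "u \<in> S \<union> m_inv G ` S" "v \<in> S \<union> m_inv G ` S" "u \<otimes> v \<noteq> v \<otimes> u"
    "0 < ht u" "ht v = 0 \<or> ht u \<le> ht v"
proof -
  have S: "S \<subseteq> carrier G" using fg by (simp add: finite_generating_set_def)
  obtain u0 v0 where 0: "u0 \<in> S" "v0 \<in> S" "u0 \<otimes> v0 \<noteq> v0 \<otimes> u0"
    using noncommuting_generators[OF fg gh] by blast
  define pos where "pos g = (if ht g < 0 then inv g else g)" for g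
  have pos: "pos g \<in> S \<union> m_inv G ` S" "0 \<le> ht (pos g)" "pos g \<in> carrier G"
    if "g \<in> S" for g
    using that S by (auto simp: pos_def ht_inv)
  have comm: "pos g \<otimes> h \<noteq> h \<otimes> pos g" if "g \<in> carrier G" "h \<in> carrier G" "g \<otimes> h \<noteq> h \<otimes> g" for g h
    using commute_inv[OF that(1,2)] that(3) by (auto simp: pos_def)
  define u v where "u = pos u0" and "v = pos v0"
  have nc: "u \<otimes> v \<noteq> v \<otimes> u"
    unfolding u_def v_def using 0 S comm[of u0 "pos v0"] comm[of v0 u0] pos(3)[OF 0(2)] by (metis subsetD)
  have mem: "u \<in> S \<union> m_inv G ` S" "v \<in> S \<union> m_inv G ` S" "0 \<le> ht u" "0 \<le> ht v"
    "u \<in> carrier G" "v \<in> carrier G"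
    using pos 0 by (auto simp: u_def v_def)
  have "\<not> (ht u = 0 \<and> ht v = 0)"
  proof
    assume ht: "ht u = 0 \<and> ht v = 0"
    have "\<gamma> (u \<otimes> v) \<simeq> \<gamma> u + \<gamma> v" "\<gamma> (v \<otimes> u) \<simeq> \<gamma> u + \<gamma> v"
      using cocycle[OF mem(5,6)] cocycle[OF mem(6,5)] ht by (simp_all add: add.commute)
    then have "\<gamma> (u \<otimes> v) \<simeq> \<gamma> (v \<otimes> u)" using approx_sym approx_trans by blast
    then show False
      using faithful[of "u \<otimes> v" "v \<otimes> u"] mem nc by (simp add: ht_mult)
  qed
  then consider "0 < ht u" "ht v = 0 \<or> ht u \<le> ht v" | "0 < ht v" "ht u = 0 \<or> ht v \<le> ht u"
    using mem(3,4) by linarith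
  then show ?thesis
    by cases (rule that[OF mem(1,2) nc], assumption+, rule that[OF mem(2,1) nc[symmetric]], assumption+)
qed

theorem growth_rate_ge_omega:
  assumes fg: "finite_generating_set G S"
    and gh: "g \<in> carrier G" "h \<in> carrier G" "g \<otimes> h \<noteq> h \<otimes> g"
    and p: "p = 2 * k + 1" and k: "1 \<le> k"
  shows "omega k \<le> growth_rate G S"
proof -
  obtain u v where uv: "u \<in> S \<union> m_inv G ` S" "v \<in> S \<union> m_inv G ` S" "u \<otimes> v \<noteq> v \<otimes> u"
    and ht: "0 < ht u" "ht v = 0 \<or> ht u \<le> ht v"
    using exists_generating_pair[OF fg gh] by blast
  have "u \<in> carrier G" "v \<in> carrier G"
    using uv fg by (auto simp: finite_generating_set_def)
  then obtain \<delta> x where "normalized_pair p act B G \<delta> ht u v x"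
    using exists_normalized_pair uv(3) by blast
  then interpret N: normalized_pair p act B G \<delta> ht u v x .
  \<comment> \<open>For \<open>p = 3\<close> and distinct heights the free monoid on
    \<open>u\<close>, \<open>v\<close> suffices because \<open>omega 1 \<le> 2\<close>; the longer
    codes require \<open>p \<ge> 5\<close>.\<close>
  consider "ht v = 0" | "ht v = ht u" | "ht u < ht v" "k = 1" | "ht u < ht v" "2 \<le> k"
    using ht(2) k by linarith
  then show ?thesis
  proof cases
    case 1
    then show ?thesis using N.growth_rate_ge_elliptic[OF fg uv(1,2) p k ht(1)] by simp
  next
    case 2
    then show ?thesis using N.growth_rate_ge_equal_heights[OF fg uv(1,2) p k ht(1)] by simp
  next
    case 3
    then show ?thesis using N.growth_rate_ge_2[OF fg uv(1,2)] ht omega_le_2 p by simp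
  next
    case 4
    then show ?thesis
      using N.growth_rate_ge_distinct_heights[OF fg uv(1,2)] ht omega_le_1_plus_sqrt2[OF k] p by simp
  qed
qed

theorem growth_rate_ge_two:
  assumes fg: "finite_generating_set G S"
    and gh: "g \<in> carrier G" "h \<in> carrier G" "g \<otimes> h \<noteq> h \<otimes> g"
    and p: "p = 2"
  shows "(1 + sqrt 5) / 2 \<le> growth_rate G S"
    and "(\<And>x. x \<in> B 0 \<Longrightarrow> x \<notin> B 1 \<Longrightarrow> 2 * x \<notin> B 2) \<Longrightarrow> beta \<le> growth_rate G S"
proof -
  obtain u v where uv: "u \<in> S \<union> m_inv G ` S" "v \<in> S \<union> m_inv G ` S" "u \<otimes> v \<noteq> v \<otimes> u"
    and ht: "0 < ht u" "ht v = 0 \<or> ht u \<le> ht v"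
    using exists_generating_pair[OF fg gh] by blast
  have "u \<in> carrier G" "v \<in> carrier G"
    using uv fg by (auto simp: finite_generating_set_def)
  then obtain \<delta> x where "normalized_pair p act B G \<delta> ht u v x"
    using exists_normalized_pair uv(3) by blast
  then interpret N: normalized_pair p act B G \<delta> ht u v x .
  \<comment> \<open>A \<open>v\<close> of positive height already gives 2, which is at least the
    golden ratio and at least \<open>beta\<close>.\<close>
  have 2: "2 \<le> growth_rate G S" if "ht v \<noteq> 0"
    using N.growth_rate_ge_2[OF fg uv(1,2)] that ht p by simp
  show "(1 + sqrt 5) / 2 \<le> growth_rate G S"
    using N.growth_rate_ge_golden[OF fg uv(1,2)] 2 ht(1) golden_ratio_bounds p by fastforce
  show "beta \<le> growth_rate G S" if "\<And>x. x \<in> B 0 \<Longrightarrow> x \<notin> B 1 \<Longrightarrow> 2 * x \<notin> B 2"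
    using N.growth_rate_ge_beta[OF fg uv(1,2) p ht(1) _ that[OF N.x]] 2 beta_bounds by fastforce
qed

end

section \<open>Upper bounds for the standard generators\<close>

definition abs_sum :: "int list \<Rightarrow> int" where
  "abs_sum cs = (\<Sum>c\<leftarrow>cs. \<bar>c\<bar>)"

lemma abs_sum_simps [simp]:
  "abs_sum [] = 0" "abs_sum (c # cs) = \<bar>c\<bar> + abs_sum cs" "abs_sum (cs @ ds) = abs_sum cs + abs_sum ds"
  by (simp_all add: abs_sum_def)

lemma abs_sum_nonneg: "0 \<le> abs_sum cs"
  by (induction cs) auto

lemma abs_sum_update: "r < length cs \<Longrightarrow> abs_sum (cs[r := cs ! r + d]) \<le> abs_sum cs + \<bar>d\<bar>"
proof (induction cs arbitrary: r)
  case (Cons c cs)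
  then show ?case by (cases r) auto
qed simp

section \<open>Carrying in digit expansions\<close>

context filtered_module
begin

primrec horner :: "'b \<Rightarrow> int list \<Rightarrow> 'b" where
  "horner e [] = 0"
| "horner e (c # cs) = of_int c * e + act 1 (horner e cs)"

lemma horner_append: "horner e (xs @ ys) = horner e xs + act (int (length xs)) (horner e ys)"
  by (induction xs) (auto simp: act_add act_act add.commute)

lemma horner_update:
  "r < length cs \<Longrightarrow> horner e (cs[r := cs ! r + d]) = horner e cs + of_int d * act (int r) e"
proof (induction cs arbitrary: r)
  case (Cons c cs)
  then show ?case
    by (cases r) (auto simp: act_add act_act act_of_int algebra_simps)
qed simp

lemma horner_approx_Cons: "horner e cs \<simeq> horner e ds \<Longrightarrow> horner e (c # cs) \<simeq> horner e (c # ds)"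
  by (simp add: approx_add approx_act)

text \<open>One rule covers both groups: \<open>\<kappa> = 1\<close> is the usual carry for BS(1,p),
  and \<open>\<kappa> = 0\<close> expresses that \<open>p * e\<close> vanishes for lamps.\<close>

lemma horner_carry:
  assumes "of_int (int p) * e \<simeq> of_int \<kappa> * act 1 e"
  shows "horner e ((d + int p * q) # c # cs) \<simeq> horner e (d # (c + \<kappa> * q) # cs)"
proof -
  have "of_int q * (of_int (int p) * e) \<simeq> of_int q * (of_int \<kappa> * act 1 e)"
    by (rule approx_of_int[OF assms])
  then have "of_int d * e + of_int q * (of_int (int p) * e) + act 1 (horner e (c # cs)) \<simeq>
      of_int d * e + of_int q * (of_int \<kappa> * act 1 e) + act 1 (horner e (c # cs))"
    by (intro approx_add approx_refl)
  then show ?thesis unfolding horner.simps act_add act_of_int by (simp add: algebra_simps)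
qed

text \<open>Digits are reduced from the lowest position upwards, each carry being passed to the next
  position. The inequality in \<open>D\<close> keeps the sum of absolute values from growing; the
  top digit absorbs the last carry and stays unrestricted.\<close>

lemma digit_reduction:
  assumes carry: "of_int (int p) * e \<simeq> of_int \<kappa> * act 1 e"
    and D: "\<And>c. \<exists>d\<in>D. \<exists>q. c = d + int p * q \<and> \<bar>d\<bar> + \<bar>\<kappa> * q\<bar> \<le> \<bar>c\<bar>"
    and "cs \<noteq> []"
  shows "\<exists>ds c. length ds = length cs - 1 \<and> set ds \<subseteq> D \<and> abs_sum ds + \<bar>c\<bar> \<le> abs_sum cs \<and>
    horner e cs \<simeq> horner e (ds @ [c])"
  using assms(3)
proof (induction "length cs" arbitrary: cs)
  case (Suc n)
  show ?case
  proof (cases "tl cs")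
    case Nil
    with Suc(3) obtain c where "cs = [c]" by (cases cs) auto
    then show ?thesis by (intro exI[of _ "[]"] exI[of _ c]) auto
  next
    case (Cons c' cs')
    with Suc(3) obtain c where cs: "cs = c # c' # cs'" by (cases cs) auto
    obtain d q where d: "d \<in> D" "c = d + int p * q" "\<bar>d\<bar> + \<bar>\<kappa> * q\<bar> \<le> \<bar>c\<bar>" using D by blast
    have "n = length ((c' + \<kappa> * q) # cs')" using Suc(2) cs by simp
    from Suc(1)[OF this] obtain ds c1 where IH: "length ds = length cs'" "set ds \<subseteq> D"
      "abs_sum ds + \<bar>c1\<bar> \<le> \<bar>c' + \<kappa> * q\<bar> + abs_sum cs'"
      "horner e ((c' + \<kappa> * q) # cs') \<simeq> horner e (ds @ [c1])"
      by auto
    have "horner e cs \<simeq> horner e (d # (c' + \<kappa> * q) # cs')"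
      unfolding cs d(2) by (rule horner_carry[OF carry])
    also have "\<dots> \<simeq> horner e (d # ds @ [c1])" by (rule horner_approx_Cons[OF IH(4)])
    finally show ?thesis
      using IH(1-3) d by (intro exI[of _ "d # ds"] exI[of _ c1]) (auto simp: cs)
  qed
qed simp

end

text \<open>A block stands for the word \<open>t\<close> or \<open>a^d t t\<close>, and
  \<open>naf_weight\<close> is its length when \<open>d\<close> is -1, 0 or 1: the same words as in
  the lower bound by \<open>beta\<close>.\<close>

definition naf_block :: "int \<Rightarrow> int list" where
  "naf_block d = (if d = 0 then [0] else [d, 0])"

definition naf_weight :: "int \<Rightarrow> nat" where
  "naf_weight d = (if d = 0 then 1 else 3)"

text \<open>Non-adjacent forms: in base 2 a nonzero digit can always be followed by 0, without increasing
  the sum of the absolute values of the digits.\<close>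

lemma (in filtered_module) naf_reduction:
  assumes carry: "of_int (int p) * e \<simeq> of_int 1 * act 1 e" and p: "p = 2" and "cs \<noteq> []"
  shows "\<exists>xs c1 c2. set xs \<subseteq> {- 1, 0, 1} \<and>
    int (sum_list (map naf_weight xs)) + \<bar>c1\<bar> + \<bar>c2\<bar> \<le> abs_sum cs + int (length cs) - 1 \<and>
    horner e cs \<simeq> horner e (concat (map naf_block xs) @ [c1, c2])"
  using assms(3)
proof (induction "length cs" arbitrary: cs rule: less_induct)
  case less
  have step: "horner e ((d + 2 * q) # c # cs) \<simeq> horner e (d # (c + q) # cs)" for d q c cs
    using horner_carry[OF carry, of d q c cs] by (simp add: p)
  consider c where "cs = [c]" | c c' where "cs = [c, c']" "odd c"
    | c c' cs' where "cs = c # c' # cs'" "even c"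
    | c c' c'' cs' where "cs = c # c' # c'' # cs'" "odd c"
    using less.prems by (metis list.exhaust)
  then show ?case
  proof cases
    case 1
    show ?thesis by (rule exI[of _ "[]"], rule exI[of _ c], rule exI[of _ 0]) (use 1 in auto)
  next
    case 2
    show ?thesis by (rule exI[of _ "[]"], rule exI[of _ c], rule exI[of _ c']) (use 2 in auto)
  next
    case 3
    then obtain q where q: "c = 0 + 2 * q" by auto
    obtain xs c1 c2 where IH: "set xs \<subseteq> {- 1, 0, 1}"
      "int (sum_list (map naf_weight xs)) + \<bar>c1\<bar> + \<bar>c2\<bar> \<le> abs_sum ((c' + q) # cs') + int (length ((c' + q) # cs')) - 1"
      "horner e ((c' + q) # cs') \<simeq> horner e (concat (map naf_block xs) @ [c1, c2])"
      using less.hyps[of "(c' + q) # cs'"] 3 by auto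
    have "horner e cs \<simeq> horner e (0 # (c' + q) # cs')"
      unfolding 3 q by (rule step)
    also have "\<dots> \<simeq> horner e (0 # concat (map naf_block xs) @ [c1, c2])"
      by (rule horner_approx_Cons[OF IH(3)])
    finally have "horner e cs \<simeq> horner e (0 # concat (map naf_block xs) @ [c1, c2])" .
    then show ?thesis
      by - (rule exI[of _ "0 # xs"], rule exI[of _ c1], rule exI[of _ c2],
        use IH(1,2) q in \<open>auto simp: 3 naf_block_def naf_weight_def\<close>)
  next
    case 4
    \<comment> \<open>The sign of \<open>d\<close> is chosen so that the carry makes the next
      coefficient even. That position then gets the digit 0, and the half \<open>l\<close> is
      carried on.\<close>
    have "\<exists>d q l. d \<in> {- 1, 1} \<and> c = d + 2 * q \<and> c' + q = 0 + 2 * l \<and> 1 + \<bar>l\<bar> \<le> \<bar>c\<bar> + \<bar>c'\<bar>"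
    proof -
      from 4(2) obtain j where j: "c = 2 * j + 1" by (elim oddE)
      show ?thesis
      proof (cases "even (c' + j)")
        case True
        then obtain l where "c' + j = 2 * l" by blast
        then show ?thesis
          by - (rule exI[of _ 1], rule exI[of _ j], rule exI[of _ l], use j in auto)
      next
        case False
        then have "even (c' + (j + 1))" by simp
        then obtain l where "c' + (j + 1) = 2 * l" by blast
        \<comment> \<open>The digit -1 would increase the sum of absolute values only for
          \<open>c = 1\<close> and \<open>c' = 0\<close>, which belongs to the other parity
          case.\<close>
        then have "j \<noteq> 0 \<or> c' \<noteq> 0" by presburger
        then consider "1 \<le> j" | "j \<le> - 1" | "j = 0" "1 \<le> c'" | "j = 0" "c' \<le> - 1" by linarith
        then have "1 + \<bar>l\<bar> \<le> \<bar>2 * j + 1\<bar> + \<bar>c'\<bar>"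
          using \<open>c' + (j + 1) = 2 * l\<close> by cases linarith+
        with \<open>c' + (j + 1) = 2 * l\<close> show ?thesis
          by - (rule exI[of _ "- 1"], rule exI[of _ "j + 1"], rule exI[of _ l], use j in auto)
      qed
    qed
    then obtain d q l where d: "d \<in> {- 1, 1}" "c = d + 2 * q" "c' + q = 0 + 2 * l" "1 + \<bar>l\<bar> \<le> \<bar>c\<bar> + \<bar>c'\<bar>"
      by blast
    obtain xs c1 c2 where IH: "set xs \<subseteq> {- 1, 0, 1}"
      "int (sum_list (map naf_weight xs)) + \<bar>c1\<bar> + \<bar>c2\<bar> \<le> abs_sum ((c'' + l) # cs') + int (length ((c'' + l) # cs')) - 1"
      "horner e ((c'' + l) # cs') \<simeq> horner e (concat (map naf_block xs) @ [c1, c2])"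
      using less.hyps[of "(c'' + l) # cs'"] 4 by auto
    have "horner e cs \<simeq> horner e (d # (c' + q) # c'' # cs')"
      unfolding 4 d(2) by (rule step)
    also have "\<dots> \<simeq> horner e (d # 0 # (c'' + l) # cs')"
      unfolding d(3) by (rule horner_approx_Cons[OF step])
    also have "\<dots> \<simeq> horner e (d # 0 # concat (map naf_block xs) @ [c1, c2])"
      by (intro horner_approx_Cons IH(3))
    finally have "horner e cs \<simeq> horner e (d # 0 # concat (map naf_block xs) @ [c1, c2])" .
    then show ?thesis
      by - (rule exI[of _ "d # xs"], rule exI[of _ c1], rule exI[of _ c2],
        use IH(1,2) d(1,4) abs_triangle_ineq[of c'' l] in \<open>auto simp: 4 naf_block_def naf_weight_def\<close>)
  qed
qed

section \<open>The growth rate of the canonical generating set\<close>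

locale standard_pair = faithful_cocycle_group p act B G \<gamma> ht
  for p :: nat and act :: "int \<Rightarrow> 'b::comm_ring_1 \<Rightarrow> 'b" and B :: "int \<Rightarrow> 'b set"
    and G :: "('a, 'm) monoid_scheme" (structure) and \<gamma> :: "'a \<Rightarrow> 'b" and ht :: "'a \<Rightarrow> int" +
  fixes a t :: 'a and e :: 'b and \<kappa> :: int
  assumes fg: "finite_generating_set G {a, t}"
    and a: "\<gamma> a \<simeq> e" "ht a = 0" and t: "\<gamma> t \<simeq> 0" "ht t = 1"
    and e: "e \<in> B 0" "e \<notin> B 1"
    and carry: "of_int (int p) * e \<simeq> of_int \<kappa> * act 1 e"
begin

lemma closed: "a \<in> carrier G" "t \<in> carrier G"
  using fg by (auto simp: finite_generating_set_def)

text \<open>Commutation would give \<open>e \<simeq> act 1 e\<close>, which places \<open>e\<close>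
  in \<open>B 1\<close>.\<close>

lemma noncommuting: "a \<otimes> t \<noteq> t \<otimes> a"
proof
  assume "a \<otimes> t = t \<otimes> a"
  moreover have "\<gamma> (a \<otimes> t) \<simeq> e + 0"
    using approx_trans[OF cocycle[OF closed] approx_add[OF a(1) approx_act[OF t(1)]]] a(2) by simp
  moreover have "\<gamma> (t \<otimes> a) \<simeq> 0 + act 1 e"
    using approx_trans[OF cocycle[OF closed(2,1)] approx_add[OF t(1) approx_act[OF a(1)]]] t(2) by simp
  ultimately have "e \<simeq> act 1 e" using approx_sym approx_trans by (metis add_0 add_0_right)
  moreover have "act 1 e \<in> B 1" using act_B[OF e(1), of 1] by simp
  ultimately show False using approx_B e(2) by blast
qed

text \<open>\<open>cs\<close> lists the digits from position \<open>- r\<close> on, over an interval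
  containing 0 and the height of the word. Prepending \<open>a\<close> or its inverse changes the
  digit at 0; prepending \<open>t\<close> or its inverse shifts the interval, which grows by one
  only if 0 would leave it. Thus letters \<open>a\<close> pay for \<open>abs_sum\<close> and letters
  \<open>t\<close> for the length.\<close>

lemma symm_words_horner:
  assumes "ws \<in> symm_words G {a, t}"
  shows "\<exists>r cs. r < length cs \<and> - int r \<le> ht (word_prod G ws) \<and> ht (word_prod G ws) < int (length cs) - int r \<and>
    abs_sum cs + int (length cs) \<le> int (length ws) + 1 \<and> \<gamma> (word_prod G ws) \<simeq> act (- int r) (horner e cs)"
  using assms
proof (induction ws)
  case Nil
  show ?case by (intro exI[of _ 0] exI[of _ "[0]"]) (auto simp: \<gamma>_one)
next
  case (Cons l ws)
  let ?g = "word_prod G ws"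
  have ws: "ws \<in> symm_words G {a, t}" and l: "l \<in> {a, t, inv a, inv t}"
    using Cons.prems by (auto simp: symm_words_def)
  have g: "?g \<in> carrier G"
    using symm_words_closed[OF _ ws] closed by simp
  obtain r cs where IH: "r < length cs" "- int r \<le> ht ?g" "ht ?g < int (length cs) - int r"
    "abs_sum cs + int (length cs) \<le> int (length ws) + 1" "\<gamma> ?g \<simeq> act (- int r) (horner e cs)"
    using Cons.IH[OF ws] by blast
  have a_case: ?case if "l \<in> carrier G" "ht l = 0" "\<gamma> l \<simeq> of_int d * e" "\<bar>d\<bar> = 1" for d
  proof (intro exI conjI)
    let ?cs = "cs[r := cs ! r + d]"
    show "r < length ?cs" "- int r \<le> ht (word_prod G (l # ws))" "ht (word_prod G (l # ws)) < int (length ?cs) - int r"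
      using IH that g by (simp_all add: ht_mult)
    show "abs_sum ?cs + int (length ?cs) \<le> int (length (l # ws)) + 1"
      using IH(4) abs_sum_update[OF IH(1), of d] that(4) by simp
    have "\<gamma> (l \<otimes> ?g) \<simeq> of_int d * e + act 0 (act (- int r) (horner e cs))"
      using approx_trans[OF cocycle[OF that(1) g] approx_add[OF that(3) approx_act[OF IH(5)]]] that(2) by simp
    also have "\<dots> = act (- int r) (horner e ?cs)"
      by (simp add: horner_update[OF IH(1)] act_add act_of_int act_act)
    finally show "\<gamma> (word_prod G (l # ws)) \<simeq> act (- int r) (horner e ?cs)" by simp
  qed
  have t_case: "\<gamma> (l \<otimes> ?g) \<simeq> act (h - int r) (horner e cs)" if "l \<in> carrier G" "\<gamma> l \<simeq> 0" "ht l = h" for h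
    using approx_trans[OF cocycle[OF that(1) g] approx_add[OF that(2) approx_act[OF IH(5)]]] that(3)
    by (simp add: act_act)
  have "0 < r \<or> r = 0" "Suc r < length cs \<or> length cs = Suc r" using IH(1) by auto
  with l consider "l = a" | "l = inv a" | "l = t" "0 < r" | "l = t" "r = 0"
    | "l = inv t" "Suc r < length cs" | "l = inv t" "length cs = Suc r"
    by blast
  then show ?case
  proof cases
    case 1
    then show ?thesis using a_case[of 1] a closed by simp
  next
    case 2
    have "- act (- ht a) (\<gamma> a) \<simeq> - e" using approx_uminus[OF a(1)] a(2) by simp
    from approx_trans[OF \<gamma>_inv[OF closed(1)] this] 2 show ?thesis
      using a_case[of "- 1"] a closed by (simp add: ht_inv)
  next
    case 3
    show ?thesis
      using IH 3 t_case[of 1] t closed g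
      by (intro exI[of _ "r - 1"] exI[of _ cs]) (auto simp: ht_mult of_nat_diff)
  next
    case 4
    show ?thesis
      using IH 4 t_case[of 1] t closed g
      by (intro exI[of _ 0] exI[of _ "0 # cs"]) (auto simp: ht_mult)
  next
    case 5
    have "- act (- ht t) (\<gamma> t) \<simeq> 0" using approx_uminus[OF approx_act[OF t(1)]] by simp
    from approx_trans[OF \<gamma>_inv[OF closed(2)] this] 5 show ?thesis
      using IH t_case[of "- 1"] t closed g
      by (intro exI[of _ "Suc r"] exI[of _ cs]) (auto simp: ht_mult ht_inv)
  next
    case 6
    have "- act (- ht t) (\<gamma> t) \<simeq> 0" using approx_uminus[OF approx_act[OF t(1)]] by simp
    from approx_trans[OF \<gamma>_inv[OF closed(2)] this] 6 show ?thesis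
      using IH t_case[of "- 1"] t closed g
      by (intro exI[of _ "Suc r"] exI[of _ "cs @ [0]"]) (auto simp: ht_mult ht_inv horner_append)
  qed
qed

lemma word_ball_horner:
  assumes "g \<in> word_ball G {a, t} n"
  obtains r cs where "cs \<noteq> []" "int r \<le> int n" "\<bar>ht g\<bar> \<le> int n"
    "abs_sum cs + int (length cs) \<le> int n + 1" "\<gamma> g \<simeq> act (- int r) (horner e cs)"
proof -
  obtain ws where ws: "ws \<in> symm_words G {a, t}" "length ws \<le> n" "g = word_prod G ws"
    using assms by (auto simp: word_ball_def)
  obtain r cs where *: "r < length cs" "- int r \<le> ht g" "ht g < int (length cs) - int r"
    "abs_sum cs + int (length cs) \<le> int (length ws) + 1" "\<gamma> g \<simeq> act (- int r) (horner e cs)"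
    using symm_words_horner[OF ws(1)] ws(3) by blast
  show ?thesis
    by (rule that[of cs r]) (use * abs_sum_nonneg[of cs] ws(2) in auto)
qed

text \<open>The offset \<open>r\<close>, the height and the top digit are three integers bounded by
  \<open>n\<close>. The other digits stand for words \<open>a^d t\<close> of length
  \<open>|d| + 1\<close>, with total length at most \<open>n\<close>.\<close>

theorem growth_rate_le_digits:
  assumes D: "finite D" "\<And>c. \<exists>d\<in>D. \<exists>q. c = d + int p * q \<and> \<bar>d\<bar> + \<bar>\<kappa> * q\<bar> \<le> \<bar>c\<bar>"
    and z: "0 < z" "z \<le> 1" "(\<Sum>d\<in>D. z ^ (nat \<bar>d\<bar> + 1)) \<le> 1"
  shows "growth_rate G {a, t} \<le> 1 / z"
proof (rule growth_rate_le_of_coding[OF fg D(1) _ z, where k = 3 and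
      Q = "\<lambda>ps ds g. ht g = ps ! 1 \<and> \<gamma> g \<simeq> act (- (ps ! 0)) (horner e (ds @ [ps ! 2]))"])
  fix n g assume "g \<in> word_ball G {a, t} n"
  then obtain r cs where *: "cs \<noteq> []" "int r \<le> int n" "\<bar>ht g\<bar> \<le> int n"
    "abs_sum cs + int (length cs) \<le> int n + 1" "\<gamma> g \<simeq> act (- int r) (horner e cs)"
    by (rule word_ball_horner)
  obtain ds c where ds: "length ds = length cs - 1" "set ds \<subseteq> D" "abs_sum ds + \<bar>c\<bar> \<le> abs_sum cs"
    "horner e cs \<simeq> horner e (ds @ [c])"
    using digit_reduction[OF carry D(2) *(1)] by blast
  have len: "int (length cs) = int (length ds) + 1" using ds(1) *(1) by (cases cs) auto
  have "int (\<Sum>d\<leftarrow>ds. nat \<bar>d\<bar> + 1) = abs_sum ds + int (length ds)" by (induction ds) auto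
  then have w: "(\<Sum>d\<leftarrow>ds. nat \<bar>d\<bar> + 1) \<le> n" "\<bar>c\<bar> \<le> int n"
    using *(4) ds(3) len abs_sum_nonneg[of ds] by linarith+
  show "\<exists>ps xs. length ps = 3 \<and> set ps \<subseteq> {- int n..int n} \<and> set xs \<subseteq> D \<and> (\<Sum>d\<leftarrow>xs. nat \<bar>d\<bar> + 1) \<le> n \<and>
      ht g = ps ! 1 \<and> \<gamma> g \<simeq> act (- (ps ! 0)) (horner e (xs @ [ps ! 2]))"
    using approx_trans[OF *(5) approx_act[OF ds(4)]] w *(2,3) ds(2)
    by (intro exI[of _ "[int r, ht g, c]"] exI[of _ ds]) auto
next
  fix ps :: "int list" and ds g h
  assume gh: "g \<in> carrier G" "h \<in> carrier G" and Q:
    "ht g = ps ! 1 \<and> \<gamma> g \<simeq> act (- (ps ! 0)) (horner e (ds @ [ps ! 2]))"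
    "ht h = ps ! 1 \<and> \<gamma> h \<simeq> act (- (ps ! 0)) (horner e (ds @ [ps ! 2]))"
  from faithful[OF gh approx_trans[OF conjunct2[OF Q(1)] approx_sym[OF conjunct2[OF Q(2)]]]] Q
    show "g = h" by simp
qed auto

theorem growth_rate_le_naf:
  assumes p: "p = 2" and \<kappa>: "\<kappa> = 1"
  shows "growth_rate G {a, t} \<le> beta"
proof -
  have "growth_rate G {a, t} \<le> 1 / (1 / beta)"
  proof (rule growth_rate_le_of_coding[OF fg, where k = 4 and D = "{- 1, 0, 1}" and wt = naf_weight and
      Q = "\<lambda>ps xs g. ht g = ps ! 1 \<and> \<gamma> g \<simeq> act (- (ps ! 0)) (horner e (concat (map naf_block xs) @ [ps ! 2, ps ! 3]))"])
    fix n g assume "g \<in> word_ball G {a, t} n"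
    then obtain r cs where *: "cs \<noteq> []" "int r \<le> int n" "\<bar>ht g\<bar> \<le> int n"
      "abs_sum cs + int (length cs) \<le> int n + 1" "\<gamma> g \<simeq> act (- int r) (horner e cs)"
      by (rule word_ball_horner)
    obtain xs c1 c2 where xs: "set xs \<subseteq> {- 1, 0, 1}"
      "int (sum_list (map naf_weight xs)) + \<bar>c1\<bar> + \<bar>c2\<bar> \<le> abs_sum cs + int (length cs) - 1"
      "horner e cs \<simeq> horner e (concat (map naf_block xs) @ [c1, c2])"
      using naf_reduction[OF carry[unfolded \<kappa>] p *(1)] by blast
    have w: "sum_list (map naf_weight xs) \<le> n" "\<bar>c1\<bar> \<le> int n" "\<bar>c2\<bar> \<le> int n"
      using *(4) xs(2) by linarith+
    show "\<exists>ps xs. length ps = 4 \<and> set ps \<subseteq> {- int n..int n} \<and> set xs \<subseteq> {- 1, 0, 1} \<and>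
        sum_list (map naf_weight xs) \<le> n \<and>
        ht g = ps ! 1 \<and> \<gamma> g \<simeq> act (- (ps ! 0)) (horner e (concat (map naf_block xs) @ [ps ! 2, ps ! 3]))"
      using approx_trans[OF *(5) approx_act[OF xs(3)]] w *(2,3) xs(1)
      by (intro exI[of _ "[int r, ht g, c1, c2]"] exI[of _ xs]) auto
  next
    fix ps :: "int list" and xs g h
    assume gh: "g \<in> carrier G" "h \<in> carrier G" and Q:
      "ht g = ps ! 1 \<and> \<gamma> g \<simeq> act (- (ps ! 0)) (horner e (concat (map naf_block xs) @ [ps ! 2, ps ! 3]))"
      "ht h = ps ! 1 \<and> \<gamma> h \<simeq> act (- (ps ! 0)) (horner e (concat (map naf_block xs) @ [ps ! 2, ps ! 3]))"
    from faithful[OF gh approx_trans[OF conjunct2[OF Q(1)] approx_sym[OF conjunct2[OF Q(2)]]]] Q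
    show "g = h" by simp
  next
    show "(\<Sum>d\<in>{- 1, 0, 1}. (1 / beta) ^ naf_weight d) \<le> 1"
      using beta_equation by (simp add: naf_weight_def)
  qed (use beta_bounds in \<open>auto simp: naf_weight_def\<close>)
  then show ?thesis by simp
qed

text \<open>\<open>d\<close> is the residue of least absolute value. If \<open>q\<close> is nonzero,
  then \<open>|p * q|\<close> is at least \<open>|q| + 2 * k\<close>, so \<open>|c|\<close> is at
  least \<open>|q| + 2 * k - |d|\<close>, which is at least \<open>|q| + |d|\<close>.\<close>

lemma odd_digits:
  fixes k :: nat
  assumes "p = 2 * k + 1" "1 \<le> k" "\<bar>\<kappa>\<bar> \<le> 1"
  shows "\<exists>d\<in>{- int k..int k}. \<exists>q. c = d + int p * q \<and> \<bar>d\<bar> + \<bar>\<kappa> * q\<bar> \<le> \<bar>c\<bar>"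
proof -
  define d q where "d = (c + int k) mod int p - int k" and "q = (c + int k) div int p"
  have c: "c = d + int p * q" using mod_mult_div_eq[of "c + int k" "int p"] unfolding d_def q_def by linarith
  have "0 \<le> (c + int k) mod int p" "(c + int k) mod int p < int p"
    using pos_mod_sign[of "int p" "c + int k"] pos_mod_bound[of "int p" "c + int k"] assms(1) by linarith+
  then have d: "- int k \<le> d" "d \<le> int k" using assms(1) unfolding d_def by linarith+
  have "\<bar>\<kappa> * q\<bar> \<le> \<bar>q\<bar>" using mult_right_mono[OF assms(3), of "\<bar>q\<bar>"] by (simp add: abs_mult)
  moreover have "\<bar>d\<bar> + \<bar>q\<bar> \<le> \<bar>c\<bar>"
  proof (cases "q = 0")
    case False
    have "2 * int k * 1 \<le> 2 * int k * \<bar>q\<bar>" using False by (intro mult_left_mono) auto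
    then have "\<bar>q\<bar> + 2 * int k \<le> \<bar>int p * q\<bar>"
      using assms(1) by (simp add: abs_mult algebra_simps)
    with c d show ?thesis by linarith
  qed (use c in simp)
  ultimately show ?thesis using c d by (intro bexI[of _ d] exI[of _ q]) auto
qed

theorem min_growth_rate_odd:
  assumes p: "p = 2 * k + 1" and k: "1 \<le> k" and \<kappa>: "\<bar>\<kappa>\<bar> \<le> 1"
  shows "min_growth_rate G = omega k" "growth_rate G {a, t} = omega k"
proof -
  have "growth_rate G {a, t} \<le> 1 / (1 / omega k)"
    using odd_digits[OF p k \<kappa>] omega_equation[OF k]
    by (intro growth_rate_le_digits[of "{- int k..int k}"]) auto
  then show "min_growth_rate G = omega k" "growth_rate G {a, t} = omega k"
    using min_growth_rate_eqI[OF fg] growth_rate_ge_omega[OF _ closed noncommuting p k] by auto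
qed

theorem min_growth_rate_golden:
  assumes p: "p = 2" and \<kappa>: "\<kappa> = 0"
  shows "min_growth_rate G = (1 + sqrt 5) / 2" "growth_rate G {a, t} = (1 + sqrt 5) / 2"
proof -
  \<comment> \<open>With \<open>\<kappa> = 0\<close> the quotient \<open>q\<close> costs nothing, so
    reduction modulo 2 to the digits 0 and 1 is allowed.\<close>
  have digit: "\<exists>d\<in>{0, 1}. \<exists>q. c = d + int p * q \<and> \<bar>d\<bar> + \<bar>\<kappa> * q\<bar> \<le> \<bar>c\<bar>" for c
    unfolding p \<kappa>
  proof (cases "even c")
    case True
    then show "\<exists>d\<in>{0, 1}. \<exists>q. c = d + int 2 * q \<and> \<bar>d\<bar> + \<bar>0 * q\<bar> \<le> \<bar>c\<bar>"
      by (intro bexI[of _ 0] exI[of _ "c div 2"]) auto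
  next
    case False
    then obtain b where b: "c = 2 * b + 1" by (elim oddE)
    then have "1 \<le> \<bar>c\<bar>" by presburger
    with b show "\<exists>d\<in>{0, 1}. \<exists>q. c = d + int 2 * q \<and> \<bar>d\<bar> + \<bar>0 * q\<bar> \<le> \<bar>c\<bar>"
      by (intro bexI[of _ 1] exI[of _ b]) auto
  qed
  define z :: real where "z = 1 / ((1 + sqrt 5) / 2)"
  have "z + z ^ 2 = 1" unfolding z_def by (rule golden_ratio_equation)
  moreover have "0 < 1 / y \<and> 1 / y \<le> 1" if "1 < y" for y :: real using that by simp
  from this[OF golden_ratio_bounds(1)] have "0 < z" "z \<le> 1" by (simp_all only: z_def)
  ultimately have "growth_rate G {a, t} \<le> 1 / z"
    using digit by (intro growth_rate_le_digits[of "{0, 1}"]) (auto simp: power2_eq_square)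
  then have le: "growth_rate G {a, t} \<le> (1 + sqrt 5) / 2" by (simp add: z_def)
  show "min_growth_rate G = (1 + sqrt 5) / 2" "growth_rate G {a, t} = (1 + sqrt 5) / 2"
    by (rule min_growth_rate_eqI[OF fg le growth_rate_ge_two(1)[OF _ closed noncommuting p]]; assumption)+
qed

theorem min_growth_rate_beta:
  assumes p: "p = 2" and \<kappa>: "\<kappa> = 1" and two: "\<And>x. x \<in> B 0 \<Longrightarrow> x \<notin> B 1 \<Longrightarrow> 2 * x \<notin> B 2"
  shows "min_growth_rate G = beta" "growth_rate G {a, t} = beta"
  by (rule min_growth_rate_eqI[OF fg growth_rate_le_naf[OF p \<kappa>]
        growth_rate_ge_two(2)[OF _ closed noncommuting p two]]; assumption)+

end

section \<open>Baumslag-Solitar groups\<close>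

definition bs_act :: "nat \<Rightarrow> int \<Rightarrow> rat \<Rightarrow> rat" where
  "bs_act p h x = of_nat p powi h * x"

definition bs_ball :: "nat \<Rightarrow> int \<Rightarrow> rat set" where
  "bs_ball p j = {of_int k * of_nat p powi j | k. True}"

lemma bs_ball_iff: "0 < p \<Longrightarrow> of_int k * of_nat p powi j \<in> bs_ball p (j + 1) \<longleftrightarrow> int p dvd k"
proof -
  assume p: "0 < p"
  have "of_int k * of_nat p powi j = (of_int l * of_nat p powi (j + 1) :: rat) \<longleftrightarrow> k = int p * l" for l
  proof -
    have "(of_int l * of_nat p powi (j + 1) :: rat) = of_int (int p * l) * of_nat p powi j"
      using p by (simp add: power_int_add)
    moreover have "(of_nat p :: rat) powi j \<noteq> 0" using p by simp
    ultimately show ?thesis by (metis mult_cancel_right of_int_eq_iff)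
  qed
  then show ?thesis by (auto simp: bs_ball_def dvd_def)
qed

lemma filtered_module_bs:
  assumes "prime p"
  shows "filtered_module p (bs_act p) (bs_ball p)"
proof
  have p: "0 < p" using assms by (rule prime_gt_0_nat)
  then have p0: "(of_nat p :: rat) \<noteq> 0" by simp
  fix h k j :: int and d :: int and x y :: rat
  show "bs_act p h (x + y) = bs_act p h x + bs_act p h y" "bs_act p 0 x = x"
    "bs_act p h (of_int d * x) = of_int d * bs_act p h x"
    by (simp_all add: bs_act_def algebra_simps)
  show "bs_act p h (bs_act p k x) = bs_act p (h + k) x"
    using p0 by (simp add: bs_act_def power_int_add)
  show "0 \<in> bs_ball p j" by (auto simp: bs_ball_def intro: exI[of _ 0])
  show "x - y \<in> bs_ball p j" if xy: "x \<in> bs_ball p j" "y \<in> bs_ball p j"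
  proof -
    obtain k l where "x = of_int k * of_nat p powi j" "y = of_int l * of_nat p powi j"
      using xy by (auto simp: bs_ball_def)
    then have "x - y = of_int (k - l) * of_nat p powi j" by (simp add: algebra_simps)
    then show ?thesis unfolding bs_ball_def by blast
  qed
  show "of_int d * x \<in> bs_ball p j" if x: "x \<in> bs_ball p j"
  proof -
    obtain k where "x = of_int k * of_nat p powi j" using x by (auto simp: bs_ball_def)
    then have "of_int d * x = of_int (d * k) * of_nat p powi j" by simp
    then show ?thesis unfolding bs_ball_def by blast
  qed
  show "bs_ball p (j + 1) \<subseteq> bs_ball p j"
  proof
    fix x assume "x \<in> bs_ball p (j + 1)"
    then obtain k where "x = of_int k * of_nat p powi (j + 1)" by (auto simp: bs_ball_def)
    then have "x = of_int (k * int p) * of_nat p powi j" using p0 by (simp add: power_int_add)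
    then show "x \<in> bs_ball p j" unfolding bs_ball_def by blast
  qed
  show "bs_act p h x \<in> bs_ball p (j + h)" if x: "x \<in> bs_ball p j"
  proof -
    obtain k where "x = of_int k * of_nat p powi j" using x by (auto simp: bs_ball_def)
    then have "bs_act p h x = of_int k * of_nat p powi (j + h)"
      using p0 by (simp add: bs_act_def power_int_add)
    then show ?thesis unfolding bs_ball_def by blast
  qed
  show "of_int d * x \<notin> bs_ball p (j + 1)"
    if x: "x \<in> bs_ball p j" "x \<notin> bs_ball p (j + 1)" "\<not> int p dvd d"
  proof -
    obtain k where k: "x = of_int k * of_nat p powi j" using x(1) by (auto simp: bs_ball_def)
    then have "\<not> int p dvd k" using x(2) bs_ball_iff[OF p] by simp
    then have "\<not> int p dvd d * k" using x(3) assms by (simp add: prime_dvd_mult_iff)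
    moreover have "of_int d * x = of_int (d * k) * of_nat p powi j" using k by simp
    ultimately show ?thesis using bs_ball_iff[OF p] by metis
  qed
qed

text \<open>\<open>x\<close> is an integer \<open>k\<close> divisible by \<open>p ^ |k|\<close>,
  which exceeds \<open>|k|\<close>.\<close>

lemma bs_ball_Inter:
  assumes "2 \<le> p" "\<And>j. x \<in> bs_ball p j"
  shows "x = 0"
proof -
  obtain k where k: "x = of_int k" using assms(2)[of 0] by (auto simp: bs_ball_def)
  have "int p ^ n dvd k" for n
  proof -
    obtain l where "x = of_int l * of_nat p powi int n" using assms(2)[of "int n"] by (auto simp: bs_ball_def)
    then have "(of_int k :: rat) = of_int (l * int p ^ n)" using k by (simp add: power_int_of_nat)
    then show ?thesis by (metis dvd_triv_right of_int_eq_iff)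
  qed
  moreover have "\<bar>k\<bar> < int p ^ nat \<bar>k\<bar>"
  proof -
    have "nat \<bar>k\<bar> < 2 ^ nat \<bar>k\<bar>" by (rule less_exp)
    also have "\<dots> \<le> p ^ nat \<bar>k\<bar>" using assms(1) by (rule power_mono) simp
    finally have "int (nat \<bar>k\<bar>) < int (p ^ nat \<bar>k\<bar>)" by (rule iffD2[OF of_nat_less_iff])
    then show ?thesis by simp
  qed
  ultimately have "k = 0" using dvd_imp_le_int[of k "int p ^ nat \<bar>k\<bar>"] by fastforce
  then show ?thesis using k by simp
qed

text \<open>Words act on the rationals, \<open>a\<close> as \<open>x + 1\<close> and
  \<open>t\<close> as \<open>p * x\<close>; the value \<open>(s, h)\<close> encodes the affine map
  sending \<open>x\<close> to \<open>p^h x + s\<close>.\<close>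

fun bs_eval :: "nat \<Rightarrow> bs_gen word \<Rightarrow> rat \<times> int" where
  "bs_eval p [] = (0, 0)"
| "bs_eval p ((gen_a, b) # w) = ((if b then 1 else - 1) + fst (bs_eval p w), snd (bs_eval p w))"
| "bs_eval p ((gen_t, b) # w) = (let h = (if b then 1 else - 1) in
    (bs_act p h (fst (bs_eval p w)), h + snd (bs_eval p w)))"

text \<open>The choice of representative is immaterial for \<open>p > 0\<close> by
  \<open>bs_eval_class\<close>.\<close>

definition bs_trans :: "nat \<Rightarrow> bs_gen word set \<Rightarrow> rat" where
  "bs_trans p X = fst (bs_eval p (SOME w. w \<in> X))"

definition bs_height :: "nat \<Rightarrow> bs_gen word set \<Rightarrow> int" where
  "bs_height p X = snd (bs_eval p (SOME w. w \<in> X))"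

lemma bs_eval_append:
  assumes "0 < p"
  shows "bs_eval p (u @ v) =
    (fst (bs_eval p u) + bs_act p (snd (bs_eval p u)) (fst (bs_eval p v)), snd (bs_eval p u) + snd (bs_eval p v))"
  using assms
  by (induction p u rule: bs_eval.induct) (auto simp: Let_def bs_act_def power_int_add algebra_simps power_int_diff field_simps)

lemma bs_eval_a: "bs_eval p (replicate n (gen_a, True)) = (of_nat n, 0)"
  by (induction n) auto

lemma bs_eval_pres_eq:
  assumes "0 < p" "pres_eq (BS1_relations p) u v"
  shows "bs_eval p u = bs_eval p v"
  using assms(2)
proof (induction rule: pres_eq.induct)
  case (cancel u x b v)
  have "bs_eval p [(x, b), (x, \<not> b)] = (0, 0)"
    by (cases x) (auto simp: bs_act_def)
  then show ?case
    using assms(1) by (simp only: bs_eval_append) (simp add: bs_act_def)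
next
  case (rel r s u v)
  then have "bs_eval p r = bs_eval p s"
    by (auto simp: BS1_relations_def bs_eval_a bs_act_def Let_def)
  then show ?case using assms(1) by (simp only: bs_eval_append)
qed auto

lemma bs_eval_class:
  assumes "0 < p"
  shows "bs_eval p (SOME w. w \<in> pres_class (BS1_relations p) u) = bs_eval p u"
proof -
  have "u \<in> pres_class (BS1_relations p) u"
    by (simp add: pres_class_def pres_rel_def pres_eq.refl)
  then have "(SOME w. w \<in> pres_class (BS1_relations p) u) \<in> pres_class (BS1_relations p) u"
    by (rule someI)
  then show ?thesis
    using bs_eval_pres_eq[OF assms, of u] by (simp add: pres_class_def pres_rel_def)
qed

text \<open>The cocycle identity for \<open>g \<otimes> inv h\<close> reduces injectivity to a
  trivial kernel.\<close>

lemma (in cocycle_group) faithfulI: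
  assumes ker: "\<And>g. g \<in> carrier G \<Longrightarrow> \<gamma> g \<simeq> 0 \<Longrightarrow> ht g = 0 \<Longrightarrow> g = \<one>"
    and gh: "g \<in> carrier G" "h \<in> carrier G" "\<gamma> g \<simeq> \<gamma> h" "ht g = ht h"
  shows "g = h"
proof -
  have "\<gamma> (g \<otimes> inv h) \<simeq> \<gamma> g + act (ht g) (\<gamma> (inv h))" using gh by (intro cocycle) auto
  also have "\<dots> \<simeq> \<gamma> h + act (ht g) (- act (- ht h) (\<gamma> h))"
    by (intro approx_add approx_act \<gamma>_inv gh)
  also have "\<dots> = 0" using gh(4) by (simp add: act_uminus act_act)
  finally have "g \<otimes> inv h = \<one>" using gh by (intro ker) (auto simp: ht_mult ht_inv)
  then show ?thesis using gh(1,2) by (metis inv_equality inv_inv inv_closed)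
qed

section \<open>Normal forms in BS(1,p)\<close>

context group
begin

lemma bs_relation_pow:
  assumes c: "a \<in> carrier G" "t \<in> carrier G" and rel: "t \<otimes> a = a [^] (p::nat) \<otimes> t"
  shows "t [^] (i::nat) \<otimes> a [^] (m::int) = a [^] (int p ^ i * m) \<otimes> t [^] i"
proof -
  have nat: "t \<otimes> a [^] (n::nat) = a [^] (p * n) \<otimes> t" for n
  proof (induction n)
    case (Suc n)
    have "t \<otimes> a [^] Suc n = (t \<otimes> a [^] n) \<otimes> a" using c by (simp add: m_assoc)
    also have "\<dots> = a [^] (p * n) \<otimes> (t \<otimes> a)" using c Suc by (simp add: m_assoc)
    also have "\<dots> = (a [^] (p * n) \<otimes> a [^] p) \<otimes> t" using c rel by (simp add: m_assoc)
    also have "a [^] (p * n) \<otimes> a [^] p = a [^] (p * Suc n)" using c by (simp add: nat_pow_mult add.commute)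
    finally show ?case .
  qed (use c in simp)
  have one: "t \<otimes> a [^] (m::int) = a [^] (int p * m) \<otimes> t" for m
  proof (cases "0 \<le> m")
    case True
    then obtain n where "m = int n" by (metis zero_le_imp_eq_int)
    with nat[of n] show ?thesis by (simp flip: of_nat_mult add: int_pow_int)
  next
    case False
    then obtain n where m: "m = - int n" by (metis nat_int int_nat_eq minus_minus nle_le neg_0_le_iff_le)
    have "a [^] (int p * m) \<otimes> t = a [^] (int p * m) \<otimes> (t \<otimes> a [^] n) \<otimes> a [^] m"
      using c by (simp add: m m_assoc int_pow_neg int_pow_int)
    also have "\<dots> = a [^] (int p * m) \<otimes> a [^] (int p * int n) \<otimes> t \<otimes> a [^] m"
      unfolding nat using c by (simp add: m_assoc flip: of_nat_mult add: int_pow_int)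
    also have "a [^] (int p * m) \<otimes> a [^] (int p * int n) = \<one>"
      using c by (simp add: int_pow_mult[symmetric] m)
    finally show ?thesis using c by simp
  qed
  show ?thesis
  proof (induction i arbitrary: m)
    case (Suc i)
    have "t [^] Suc i \<otimes> a [^] m = t [^] i \<otimes> (t \<otimes> a [^] m)" using c by (simp add: m_assoc)
    also have "\<dots> = (t [^] i \<otimes> a [^] (int p * m)) \<otimes> t" using c one by (simp add: m_assoc)
    also have "\<dots> = a [^] (int p ^ i * (int p * m)) \<otimes> t [^] Suc i" using c Suc by (simp add: m_assoc)
    finally show ?case by (simp add: mult_ac)
  qed (use c in simp)
qed

text \<open>Powers of \<open>t\<close> on the left clear denominators: \<open>t^i\<close> moves past
  powers of \<open>a\<close> by \<open>bs_relation_pow\<close>, and a letter \<open>inv t\<close> is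
  absorbed by raising \<open>i\<close>. This serves to show that the kernel of the cocycle is
  trivial.\<close>

lemma bs_normal_form:
  assumes c: "a \<in> carrier G" "t \<in> carrier G" and rel: "t \<otimes> a = a [^] (p::nat) \<otimes> t"
    and ws: "ws \<in> symm_words G {a, t}"
  shows "\<exists>i j. \<exists>m::int. t [^] (i::nat) \<otimes> word_prod G ws = a [^] m \<otimes> t [^] (j::nat)"
  using ws
proof (induction ws)
  case Nil
  have "t [^] (0::nat) \<otimes> word_prod G [] = a [^] (0::int) \<otimes> t [^] (0::nat)" by simp
  then show ?case by blast
next
  case (Cons l ws)
  let ?g = "word_prod G ws"
  have ws: "ws \<in> symm_words G {a, t}" and l: "l \<in> {a, t, inv a, inv t}"
    using Cons.prems by (auto simp: symm_words_def)
  have g: "?g \<in> carrier G" using symm_words_closed[OF _ ws] c by simp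
  obtain i j m where IH: "t [^] (i::nat) \<otimes> ?g = a [^] (m::int) \<otimes> t [^] (j::nat)"
    using Cons.IH[OF ws] by blast
  have a_case: "t [^] i \<otimes> (a [^] d \<otimes> ?g) = a [^] (int p ^ i * d + m) \<otimes> t [^] j" for d :: int
  proof -
    have "t [^] i \<otimes> (a [^] d \<otimes> ?g) = (t [^] i \<otimes> a [^] d) \<otimes> ?g" using c g by (simp add: m_assoc)
    also have "\<dots> = a [^] (int p ^ i * d) \<otimes> (t [^] i \<otimes> ?g)"
      unfolding bs_relation_pow[OF c rel] using c g by (simp add: m_assoc)
    also have "\<dots> = a [^] (int p ^ i * d + m) \<otimes> t [^] j"
      unfolding IH using c by (simp add: int_pow_mult m_assoc)
    finally show ?thesis .
  qed
  consider "l = a" | "l = inv a" | "l = t" "i = 0" | i' where "l = t" "i = Suc i'" | "l = inv t"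
    using l by (cases i) auto
  then show ?case
  proof cases
    case 1
    then show ?thesis using a_case[of 1] c by auto
  next
    case 2
    have "a [^] (- 1 :: int) = inv a" using c by (simp add: int_pow_neg)
    with 2 show ?thesis using a_case[of "- 1"] c by auto
  next
    case 3
    have "t [^] (0::nat) \<otimes> word_prod G (l # ws) = t [^] (1::nat) \<otimes> a [^] m \<otimes> t [^] j"
      using IH 3 c g by (simp add: m_assoc)
    also have "\<dots> = a [^] (int p * m) \<otimes> t [^] Suc j"
      unfolding bs_relation_pow[OF c rel] nat_pow_Suc2[OF c(2), of j] using c by (simp add: m_assoc)
    finally show ?thesis by blast
  next
    case 4
    then have "t [^] i' \<otimes> word_prod G (l # ws) = a [^] m \<otimes> t [^] j"
      using IH c g by (simp add: m_assoc)
    then show ?thesis by blast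
  next
    case 5
    have "t [^] Suc i \<otimes> word_prod G (l # ws) = t [^] i \<otimes> (t \<otimes> (inv t \<otimes> ?g))"
      using 5 c g by (simp add: m_assoc)
    also have "t \<otimes> (inv t \<otimes> ?g) = ?g" using c g by (simp add: m_assoc[symmetric])
    finally show ?thesis using IH by metis
  qed
qed

end

context cocycle_group
begin

lemma cocycle_nat_pow:
  assumes "g \<in> carrier G" "\<gamma> g \<simeq> 0"
  shows "\<gamma> (g [^] (n::nat)) \<simeq> 0" "ht (g [^] n) = int n * ht g"
proof -
  show "\<gamma> (g [^] n) \<simeq> 0"
  proof (induction n)
    case (Suc n)
    have "\<gamma> (g [^] n \<otimes> g) \<simeq> 0 + act (ht (g [^] n)) 0"
      by (rule approx_trans[OF cocycle approx_add[OF Suc approx_act[OF assms(2)]]]) (use assms in auto)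
    then show ?case by simp
  qed (simp add: \<gamma>_one)
  show "ht (g [^] n) = int n * ht g"
    by (induction n) (use assms in \<open>auto simp: ht_mult algebra_simps\<close>)
qed

lemma cocycle_int_pow:
  assumes g: "g \<in> carrier G" "\<gamma> g \<simeq> e" "ht g = 0"
  shows "\<gamma> (g [^] (m::int)) \<simeq> of_int m * e" "ht (g [^] m) = 0"
proof -
  have nat: "\<gamma> (g [^] n) \<simeq> of_nat n * e \<and> ht (g [^] n) = 0" for n :: nat
  proof (induction n)
    case (Suc n)
    have "\<gamma> (g [^] n \<otimes> g) \<simeq> of_nat n * e + act (ht (g [^] n)) e"
      by (rule approx_trans[OF cocycle approx_add[OF conjunct1[OF Suc] approx_act[OF g(2)]]]) (use g in auto)
    then show ?case using Suc g by (simp add: ht_mult algebra_simps)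
  qed (simp add: \<gamma>_one)
  have "\<gamma> (g [^] m) \<simeq> of_int m * e \<and> ht (g [^] m) = 0"
  proof (cases "0 \<le> m")
    case True
    then obtain n where "m = int n" by (metis zero_le_imp_eq_int)
    with nat[of n] show ?thesis by (simp add: int_pow_int)
  next
    case False
    define n where "n = nat (- m)"
    have m: "m = - int n" using False by (simp add: n_def)
    have "\<gamma> (inv (g [^] n)) \<simeq> - act (- ht (g [^] n)) (\<gamma> (g [^] n))" using g by (intro \<gamma>_inv) auto
    also have "\<dots> \<simeq> - act (- ht (g [^] n)) (of_nat n * e)"
      by (rule approx_uminus[OF approx_act[OF conjunct1[OF nat]]])
    finally show ?thesis
      using nat[of n] g by (simp add: m int_pow_neg int_pow_int ht_inv)
  qed
  then show "\<gamma> (g [^] m) \<simeq> of_int m * e" "ht (g [^] m) = 0" by auto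
qed

end

lemma standard_pair_bs:
  assumes "prime p"
  shows "standard_pair p (bs_act p) (bs_ball p) (BS1 p) (bs_trans p) (bs_height p)
    (BS1_gen p gen_a) (BS1_gen p gen_t) 1 1"
proof -
  have p: "0 < p" "2 \<le> p" using assms prime_gt_0_nat prime_ge_2_nat by auto
  let ?cl = "pres_class (BS1_relations p)"
  have eval: "bs_trans p (?cl u) = fst (bs_eval p u)" "bs_height p (?cl u) = snd (bs_eval p u)" for u
    unfolding bs_trans_def bs_height_def bs_eval_class[OF p(1)] by simp_all
  have carrier: "carrier (BS1 p) = range ?cl" by (simp add: BS1_def carrier_presented_group)
  have mult: "?cl u \<otimes>\<^bsub>BS1 p\<^esub> ?cl v = ?cl (u @ v)" for u v
    by (simp add: BS1_def mult_presented_group)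
  interpret filtered_module p "bs_act p" "bs_ball p" by (rule filtered_module_bs[OF assms])
  interpret cocycle_group p "bs_act p" "bs_ball p" "BS1 p" "bs_trans p" "bs_height p"
    by (intro cocycle_group.intro filtered_module_axioms cocycle_group_axioms.intro,
        simp add: BS1_def group_presented_group)
       (auto simp: carrier mult eval bs_eval_append[OF p(1)])
  define a t where "a = BS1_gen p gen_a" and "t = BS1_gen p gen_t"
  have c: "a \<in> carrier (BS1 p)" "t \<in> carrier (BS1 p)"
    by (auto simp: a_def t_def BS1_gen_def carrier)
  have at: "bs_trans p a = 1" "bs_height p a = 0" "bs_trans p t = 0" "bs_height p t = 1"
    by (simp_all add: a_def t_def BS1_gen_def eval bs_act_def)
  have "a [^]\<^bsub>BS1 p\<^esub> n = ?cl (replicate n (gen_a, True))" for n :: nat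
    by (induction n)
       (simp_all add: a_def BS1_gen_def mult replicate_append_same one_presented_group BS1_def mult_presented_group)
  \<comment> \<open>The defining relation in the form \<open>t a = a^p t\<close>, obtained by
    appending \<open>t\<close> and cancelling \<open>t^-1 t\<close>.\<close>
  moreover have "?cl ([(gen_t, True)] @ [(gen_a, True)]) = ?cl (replicate p (gen_a, True) @ [(gen_t, True)])"
  proof -
    have "pres_eq (BS1_relations p) ([(gen_t, True), (gen_a, True)] @ [(gen_t, False), (gen_t, \<not> False)] @ [])
      ([(gen_t, True), (gen_a, True)] @ [])"
      by (rule pres_eq.cancel)
    moreover have "pres_eq (BS1_relations p) ([] @ [(gen_t, True), (gen_a, True), (gen_t, False)] @ [(gen_t, True)])
      ([] @ replicate p (gen_a, True) @ [(gen_t, True)])"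
      by (rule pres_eq.rel) (simp add: BS1_relations_def)
    ultimately show ?thesis
      unfolding pres_class_eq_iff by (auto intro: pres_eq.sym pres_eq.trans)
  qed
  ultimately have rel: "t \<otimes>\<^bsub>BS1 p\<^esub> a = a [^]\<^bsub>BS1 p\<^esub> p \<otimes>\<^bsub>BS1 p\<^esub> t"
    by (simp add: a_def t_def BS1_gen_def mult)
  have "of_int 1 * of_nat p powi 0 \<in> bs_ball p 0" unfolding bs_ball_def by blast
  then have one: "1 \<in> bs_ball p 0" by simp
  have fg: "finite_generating_set (BS1 p) {a, t}"
    unfolding a_def t_def by (rule finite_generating_set_BS1)
  show ?thesis
    unfolding a_def[symmetric] t_def[symmetric]
  proof unfold_locales
    show "finite_generating_set (BS1 p) {a, t}" by (rule fg)
    show "\<exists>j. bs_trans p g \<in> bs_ball p j" if g: "g \<in> carrier (BS1 p)" for g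
    proof -
      have "\<exists>j. fst (bs_eval p u) \<in> bs_ball p j" for u
      proof (induction u)
        case Nil
        show ?case by (auto intro: B_0)
      next
        case (Cons l u)
        then obtain j where j: "fst (bs_eval p u) \<in> bs_ball p j" by blast
        obtain x b where l: "l = (x, b)" by force
        show ?case
        proof (cases x)
          case gen_a
          have "(if b then 1 else - 1) + fst (bs_eval p u) \<in> bs_ball p (min 0 j)"
          proof (rule B_add)
            show "(if b then 1 else - 1) \<in> bs_ball p (min 0 j)"
              using B_mono[of "min 0 j" 0] one B_uminus[OF one] by auto
            show "fst (bs_eval p u) \<in> bs_ball p (min 0 j)"
              using B_mono[of "min 0 j" j] j by auto
          qed
          then show ?thesis by (auto simp: l gen_a)
        next
          case gen_t
          show ?thesis
            using act_B[OF j, of "if b then 1 else - 1"] by (auto simp: l gen_t Let_def)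
        qed
      qed
      then show ?thesis using g by (auto simp: carrier eval)
    qed
    show "g = h" if "g \<in> carrier (BS1 p)" "h \<in> carrier (BS1 p)" "approx (bs_trans p g) (bs_trans p h)"
      "bs_height p g = bs_height p h" for g h
    proof (rule faithfulI[OF _ that])
      fix g assume g: "g \<in> carrier (BS1 p)" "approx (bs_trans p g) 0" "bs_height p g = 0"
      obtain ws where "ws \<in> symm_words (BS1 p) {a, t}" "word_prod (BS1 p) ws = g"
        using generate_word[of "{a, t}" g] fg g(1) c by (auto simp: finite_generating_set_def)
      then obtain i j m where nf: "t [^]\<^bsub>BS1 p\<^esub> (i::nat) \<otimes>\<^bsub>BS1 p\<^esub> g = a [^]\<^bsub>BS1 p\<^esub> (m::int) \<otimes>\<^bsub>BS1 p\<^esub> t [^]\<^bsub>BS1 p\<^esub> (j::nat)"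
        using bs_normal_form[OF c rel] by metis
      note tp = cocycle_nat_pow[OF c(2), unfolded at, OF approx_refl]
      note ap = cocycle_int_pow[OF c(1), unfolded at, OF approx_refl HOL.refl]
      have "bs_height p (t [^]\<^bsub>BS1 p\<^esub> i \<otimes>\<^bsub>BS1 p\<^esub> g) = int i"
        using c g tp by (subst ht_mult) auto
      moreover have "bs_height p (a [^]\<^bsub>BS1 p\<^esub> m \<otimes>\<^bsub>BS1 p\<^esub> t [^]\<^bsub>BS1 p\<^esub> j) = int j"
        using c tp ap by (subst ht_mult) auto
      \<comment> \<open>Heights give \<open>i = j\<close>; comparing translations then gives
        \<open>m = 0\<close>, so \<open>t^i g = t^i\<close>.\<close>
      ultimately have ij: "i = j" using nf by simp
      have A: "approx (bs_trans p (t [^]\<^bsub>BS1 p\<^esub> i \<otimes>\<^bsub>BS1 p\<^esub> g)) (0 + bs_act p (bs_height p (t [^]\<^bsub>BS1 p\<^esub> i)) 0)"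
        by (rule approx_trans[OF cocycle approx_add[OF tp(1) approx_act[OF g(2)]]]) (use c g in auto)
      have "approx (bs_trans p (a [^]\<^bsub>BS1 p\<^esub> m \<otimes>\<^bsub>BS1 p\<^esub> t [^]\<^bsub>BS1 p\<^esub> j))
          (of_int m * 1 + bs_act p (bs_height p (a [^]\<^bsub>BS1 p\<^esub> m)) 0)"
        by (rule approx_trans[OF cocycle approx_add[OF ap(1) approx_act[OF tp(1)]]]) (use c in auto)
      from approx_trans[OF approx_sym[OF this] A[unfolded nf]] have "approx (of_int m) (0::rat)"
        by simp
      then have "(of_int m :: rat) = 0"
        by (intro bs_ball_Inter[OF p(2)]) (simp add: approx_def)
      then have "t [^]\<^bsub>BS1 p\<^esub> i \<otimes>\<^bsub>BS1 p\<^esub> g = t [^]\<^bsub>BS1 p\<^esub> i" using nf ij c by simp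
      then show "g = \<one>\<^bsub>BS1 p\<^esub>" using c g(1) by simp
    qed
    show "1 \<in> bs_ball p 0" by (rule one)
    show "1 \<notin> bs_ball p 1" using bs_ball_iff[OF p(1), of 1 0] p(2) by auto
    show "approx (of_int (int p) * 1) (of_int 1 * bs_act p 1 1)" by (simp add: bs_act_def)
  qed (simp_all add: at)
qed

section \<open>Lamplighter groups\<close>

definition lamp_act :: "int \<Rightarrow> (int \<Rightarrow> int) \<Rightarrow> int \<Rightarrow> int" where
  "lamp_act h f = (\<lambda>i. f (i - h))"

definition lamp_ball :: "nat \<Rightarrow> int \<Rightarrow> (int \<Rightarrow> int) set" where
  "lamp_ball p j = {f. \<forall>i<j. int p dvd f i}"

text \<open>In the pointwise ring of sequences integers are constant sequences, so
  \<open>of_int d * f\<close> multiplies every entry by \<open>d\<close>.\<close>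

lemma of_int_fun_apply: "(of_int d :: int \<Rightarrow> int) i = d"
proof (induction d rule: int_induct[where k = 0])
  case (step1 d)
  then show ?case by (simp add: plus_fun_def one_fun_def)
next
  case (step2 d)
  then show ?case by (simp add: fun_diff_def one_fun_def)
qed (simp add: zero_fun_def)

lemma filtered_module_lamp:
  assumes "prime p"
  shows "filtered_module p lamp_act (lamp_ball p)"
proof
  fix h k j d :: int and f g :: "int \<Rightarrow> int"
  show "lamp_act h (f + g) = lamp_act h f + lamp_act h g" "lamp_act 0 f = f"
    "lamp_act h (of_int d * f) = of_int d * lamp_act h f"
    by (auto simp: lamp_act_def fun_eq_iff of_int_fun_apply)
  show "lamp_act h (lamp_act k f) = lamp_act (h + k) f"
    by (auto simp: lamp_act_def fun_eq_iff algebra_simps)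
  show "0 \<in> lamp_ball p j" by (simp add: lamp_ball_def)
  show "f - g \<in> lamp_ball p j" if "f \<in> lamp_ball p j" "g \<in> lamp_ball p j"
    using that by (simp add: lamp_ball_def)
  show "of_int d * f \<in> lamp_ball p j" if "f \<in> lamp_ball p j"
    using that by (simp add: lamp_ball_def of_int_fun_apply)
  show "lamp_ball p (j + 1) \<subseteq> lamp_ball p j" by (auto simp: lamp_ball_def)
  show "lamp_act h f \<in> lamp_ball p (j + h)" if "f \<in> lamp_ball p j"
    using that by (simp add: lamp_ball_def lamp_act_def)
  show "of_int d * f \<notin> lamp_ball p (j + 1)"
    if f: "f \<in> lamp_ball p j" "f \<notin> lamp_ball p (j + 1)" "\<not> int p dvd d"
  proof -
    obtain i where "i < j + 1" "\<not> int p dvd f i" using f(2) by (auto simp: lamp_ball_def)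
    then show ?thesis
      using f(3) assms by (auto simp: lamp_ball_def of_int_fun_apply prime_dvd_mult_iff)
  qed
qed

text \<open>Here \<open>\<simeq>\<close> is entrywise congruence modulo \<open>p\<close>, and
  elements of the group have entries in \<open>{0..<p}\<close>, so congruent ones are equal. The
  carry constant is 0 because \<open>p\<close> divides every entry of \<open>p * e\<close>.\<close>

lemma standard_pair_lamp:
  assumes "prime p"
  shows "standard_pair p lamp_act (lamp_ball p) (lamplighter p) fst snd (lamp_a p) lamp_t (fst (lamp_a p)) 0"
proof -
  have p: "0 < p" "1 < p" using assms prime_gt_0_nat prime_gt_1_nat by auto
  have carr: "carrier (integer_mod_group p) = {0..<int p}"
    using p by (simp add: carrier_integer_mod_group)
  interpret filtered_module p lamp_act "lamp_ball p" by (rule filtered_module_lamp[OF assms])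
  have approx: "approx f g \<longleftrightarrow> (\<forall>i. int p dvd f i - g i)" for f g
    unfolding approx_def lamp_ball_def using zless_add1_eq by fastforce
  interpret cocycle_group p lamp_act "lamp_ball p" "lamplighter p" fst snd
  proof (intro cocycle_group.intro filtered_module_axioms group_lamplighter cocycle_group_axioms.intro)
    fix x y
    show "approx (fst (x \<otimes>\<^bsub>lamplighter p\<^esub> y)) (fst x + lamp_act (snd x) (fst y))"
      by (cases x; cases y) (simp add: mult_lamplighter approx lamp_act_def dvd_eq_mod_eq_0 mod_diff_left_eq)
    show "snd (x \<otimes>\<^bsub>lamplighter p\<^esub> y) = snd x + snd y"
      by (cases x; cases y) (simp add: mult_lamplighter)
  qed
  show ?thesis
  proof unfold_locales
    show "finite_generating_set (lamplighter p) {lamp_a p, lamp_t}"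
      by (rule finite_generating_set_lamplighter)
    show "\<exists>j. fst g \<in> lamp_ball p j" if "g \<in> carrier (lamplighter p)" for g
    proof -
      have "finite {i. fst g i \<noteq> 0}" using that by (auto simp: carrier_lamplighter)
      then have "\<exists>m. \<forall>i\<in>{i. fst g i \<noteq> 0}. m \<le> i"
        by (intro exI[of _ "Min {i. fst g i \<noteq> 0}"]) auto
      then obtain m where "\<And>i. fst g i \<noteq> 0 \<Longrightarrow> m \<le> i" by auto
      then have "fst g \<in> lamp_ball p m"
        unfolding lamp_ball_def mem_Collect_eq by (metis dvd_0_right linorder_not_le)
      then show ?thesis by blast
    qed
    show "g = h" if gh: "g \<in> carrier (lamplighter p)" "h \<in> carrier (lamplighter p)" "approx (fst g) (fst h)" "snd g = snd h"
      for g h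
    proof -
      have "fst g i = fst h i" for i
      proof -
        have "fst g i \<in> {0..<int p}" "fst h i \<in> {0..<int p}"
          using gh(1,2) carr by (auto simp: carrier_lamplighter)
        moreover have "fst g i mod int p = fst h i mod int p"
          using gh(3) by (simp add: approx mod_eq_dvd_iff)
        ultimately show ?thesis by simp
      qed
      then show ?thesis using gh(4) by (auto simp: prod_eq_iff)
    qed
    show "fst (lamp_a p) \<in> lamp_ball p 0" by (simp add: lamp_a_def lamp_ball_def)
    have "fst (lamp_a p) 0 = 1" using p by (simp add: lamp_a_def)
    moreover have "\<not> int p dvd 1" using p by simp
    ultimately have "\<not> int p dvd fst (lamp_a p) 0" by simp
    then show "fst (lamp_a p) \<notin> lamp_ball p 1" unfolding lamp_ball_def mem_Collect_eq by (metis zero_less_one)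
    show "approx (fst lamp_t) 0" by (simp add: lamp_t_def approx)
    show "approx (of_int (int p) * fst (lamp_a p)) (of_int 0 * lamp_act 1 (fst (lamp_a p)))"
      by (simp add: approx of_int_fun_apply lamp_a_def)
  qed (simp_all add: lamp_a_def lamp_t_def)
qed

theorem theorem1:
  fixes p :: nat
  assumes "prime p"
  shows "min_growth_rate (BS1 p) = growth_rate (BS1 p) {BS1_gen p gen_a, BS1_gen p gen_t} \<and>
         min_growth_rate (lamplighter p) = growth_rate (lamplighter p) {lamp_a p, lamp_t} \<and>
         (\<forall>k. p = 2 * k + 1 \<longrightarrow>
            min_growth_rate (lamplighter p) = omega k \<and> min_growth_rate (BS1 p) = omega k) \<and>
         (p = 2 \<longrightarrow>
            min_growth_rate (lamplighter 2) = (1 + sqrt 5) / 2 \<and>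
            (1 + sqrt 5) / 2 < min_growth_rate (BS1 2) \<and>
            min_growth_rate (BS1 2) = beta)"
proof -
  interpret BS: standard_pair p "bs_act p" "bs_ball p" "BS1 p" "bs_trans p" "bs_height p"
    "BS1_gen p gen_a" "BS1_gen p gen_t" 1 1
    by (rule standard_pair_bs[OF assms])
  interpret L: standard_pair p lamp_act "lamp_ball p" "lamplighter p" fst snd "lamp_a p" lamp_t "fst (lamp_a p)" 0
    by (rule standard_pair_lamp[OF assms])
  show ?thesis
  proof (cases "p = 2")
    case True
    \<comment> \<open>Elements of exact level 0 are the odd integers, and twice an odd integer is
      not divisible by 4.\<close>
    have "2 * x \<notin> bs_ball p 2" if x: "x \<in> bs_ball p 0" "x \<notin> bs_ball p 1" for x
    proof -
      obtain k where k: "x = of_int k" using x(1) by (auto simp: bs_ball_def)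
      then have "\<not> int p dvd k" using x(2) bs_ball_iff[of p k 0] True by simp
      moreover have "2 * x = of_int k * of_nat p powi 1" using k True by simp
      ultimately show ?thesis using bs_ball_iff[of p k 1] True by (simp add: mult.commute)
    qed
    note BS2 = BS.min_growth_rate_beta[OF True HOL.refl this]
    note L2 = L.min_growth_rate_golden[OF True HOL.refl]
    show ?thesis
      using BS2 L2 golden_ratio_less_beta True by auto
  next
    case False
    then have "odd p" using assms primes_dvd_imp_eq two_is_prime_nat by blast
    then obtain k where k: "p = 2 * k + 1" by (elim oddE)
    \<comment> \<open>\<open>k = 0\<close> would give \<open>p = 1\<close>, which is not
      prime.\<close>
    then have "1 \<le> k" using assms by (cases k) auto
    then show ?thesis
      using BS.min_growth_rate_odd[OF k] L.min_growth_rate_odd[OF k] k False by auto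
  qed
qed

end
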